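(* Let $\mathbf w=w_0w_1w_2\cdots$ be a morphic infinite word over a finite alphabet $\Sigma$, and let $\Delta\subsetneq\Sigma$ be a nonempty subalphabet such that $\mathbf w$ contains infinitely many letters of $\overline\Delta=\Sigma\setminus\Delta$ and $\Delta$-blocks of unbounded length. For $k\ge0$ let $u^{(k)}=w_{i_k}\cdots w_{j_k}$ be the $k$-th maximal $\Delta$-block of $\mathbf w$. Then $\limsup_{k\to\infty}j_k/i_k$ is algebraic. If $\mathbf w$ is moreover automatic, then $\limsup_{k\to\infty}j_k/i_k$ is rational.
   Context: Positions are indexed from $0$. A factor $w_i\cdots w_j$ ($i\le j$) is a $\Delta$-block if all its letters lie in $\Delta$; it is maximal if moreover $w_{j+1}\in\overline\Delta$ and either $i=0$ or $w_{i-1}\in\overline\Delta$. Maximal $\Delta$-blocks are enumerated in increasing order of position. Morphic/automatic words: Let $\Sigma'$ be a finite alphabet. A morphism $h:\Sigma'^*\to\Sigma'^*$ is prolongable on $a$ if $h(a)=ax$ with $x$ nonempty and $h^n(x)$ nonempty for all $n\ge0$; then $h^\omega(a)=a\,x\,h(x)h^2(x)\cdots$ is a pure morphic word. A coding is a letter-to-letter morphism. An infinite word is morphic if it is the image under a coding of a pure morphic word, and automatic if it is the image under a coding of a pure morphic word $h^\omega(a)$ with $h$ uniform (all $|h(c)|$ equal). *)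

theory Defs
  imports "HOL-Analysis.Analysis" "HOL-Computational_Algebra.Polynomial"
begin

(* Letters of auxiliary alphabets are encoded as natural numbers (Sigma' is a finite set of nats). *)

definition morph_ext :: "(nat \<Rightarrow> nat list) \<Rightarrow> nat list \<Rightarrow> nat list" where
  "morph_ext h xs = concat (map h xs)"

definition prolongable :: "nat set \<Rightarrow> (nat \<Rightarrow> nat list) \<Rightarrow> nat \<Rightarrow> bool" where
  "prolongable S' h a \<longleftrightarrow> finite S' \<and> a \<in> S' \<and> (\<forall>c\<in>S'. set (h c) \<subseteq> S') \<and>
     (\<exists>x. h a = a # x \<and> x \<noteq> [] \<and> (\<forall>n. (morph_ext h ^^ n) x \<noteq> []))"

definition is_fixpoint_word :: "(nat \<Rightarrow> nat list) \<Rightarrow> nat \<Rightarrow> (nat \<Rightarrow> nat) \<Rightarrow> bool" where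
  "is_fixpoint_word h a u \<longleftrightarrow>
     (\<forall>n i. i < length ((morph_ext h ^^ n) [a]) \<longrightarrow> u i = (morph_ext h ^^ n) [a] ! i)"

definition morphic :: "(nat \<Rightarrow> 'a) \<Rightarrow> bool" where
  "morphic w \<longleftrightarrow> (\<exists>S' h a u (\<tau>::nat \<Rightarrow> 'a). prolongable S' h a \<and> is_fixpoint_word h a u \<and>
      (\<forall>n. w n = \<tau> (u n)))"

definition automatic :: "(nat \<Rightarrow> 'a) \<Rightarrow> bool" where
  "automatic w \<longleftrightarrow> (\<exists>S' h a u (\<tau>::nat \<Rightarrow> 'a) m. prolongable S' h a \<and> (\<forall>c\<in>S'. length (h c) = m) \<and>
      is_fixpoint_word h a u \<and> (\<forall>n. w n = \<tau> (u n)))"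

definition block_starts :: "(nat \<Rightarrow> 'a) \<Rightarrow> 'a set \<Rightarrow> nat set" where
  "block_starts w D = {i. w i \<in> D \<and> (i = 0 \<or> w (i - 1) \<notin> D)}"

definition blk_start :: "(nat \<Rightarrow> 'a) \<Rightarrow> 'a set \<Rightarrow> nat \<Rightarrow> nat" where
  "blk_start w D k = enumerate (block_starts w D) k"

definition blk_end :: "(nat \<Rightarrow> 'a) \<Rightarrow> 'a set \<Rightarrow> nat \<Rightarrow> nat" where
  "blk_end w D k = (LEAST j. blk_start w D k \<le> j \<and> w (Suc j) \<notin> D)"

end

theory Submission
  imports Defs "HOL-Computational_Algebra.Fundamental_Theorem_Algebra"
begin

text \<open>
  Call a letter \<open>c\<close> good if \<open>h\<^sup>n(c)\<close> has all its letters in the block alphabet for every \<open>n > 0\<close>.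
  After replacing \<open>h\<close> by a power, a single \<open>n > 0\<close> decides this. Every long maximal block then
  lies between the images, under some \<open>h\<^sup>n\<close>, of two consecutive bad letters inside one \<open>h(c)\<close>; its
  length depends only on \<open>n\<close> and on that pair, so the ratio is largest at the first occurrence of
  \<open>c\<close>. Hence the limsup is governed by finitely many pairs of sequences: the positions \<open>X\<^sub>n < Y\<^sub>n\<close>
  of the two letters that bound the block. Both are \<open>\<nat>\<close>-rational and comparable to \<open>|h\<^sup>n(a)|\<close>. By
  Berstel's theorem the poles of minimal modulus \<open>R\<close> of an \<open>\<nat>\<close>-rational series are \<open>R\<close> times roots
  of unity, so along residue classes \<open>Y\<^sub>n / X\<^sub>n\<close> converges, to a quotient of values of algebraic
  rational functions at algebraic points. If \<open>h\<close> is uniform with \<open>|h(c)| = m\<close>, both \<open>X\<^sub>n / m\<^sup>n\<close> and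
  \<open>Y\<^sub>n / m\<^sup>n\<close> converge to rational limits.
\<close>

section \<open>Algebraic numbers form a field\<close>

text \<open>Two obstacles shape the argument. A left end of bounded position would make the ratio
  infinite; the critical case is a left letter at position 0. There, infinitely many letters outside
  the block alphabet force a bad letter in the tail \<open>x\<close> of \<open>h a = a # x\<close>,
  so the last bad letter of \<open>h a\<close> is not its first letter, and the left end grows like
  |h^n(a)|. The second obstacle is that the order of the dominant poles is unknown. Denominators are
  completed to (1 - X^p)^k Q with \<open>k\<close> possibly too large, and \<open>k\<close> is
  lowered for both series at once as long as all leading coefficients vanish. Since the right end is
  at most a constant times the left end, vanishing for the left series forces vanishing for the
  right one. Berstel's theorem is obtained as a closure property: the series with the pole condition
  contain the needed polynomials and are closed under sum, product and star. Roots of unity arise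
  only in the star, from equality in the triangle inequality. Besides the limits from the gaps, the
  value 1 always competes in the limsup, because a block ends no earlier than it starts.\<close>

lemma vector_space_rat_complex: "vector_space (\<lambda>q (x::complex). of_rat q * x)"
  by unfold_locales (simp_all add: algebra_simps of_rat_add of_rat_mult)

abbreviation rat_span :: "complex set \<Rightarrow> complex set" where
  "rat_span \<equiv> module.span (\<lambda>q x. of_rat q * x)"

lemma rat_span_mult:
  fixes x :: complex
  assumes "\<And>b. b \<in> B \<Longrightarrow> x * b \<in> rat_span B" and "v \<in> rat_span B"
  shows "x * v \<in> rat_span B"
proof -
  interpret V: vector_space "\<lambda>q (x::complex). of_rat q * x"
    by (rule vector_space_rat_complex)
  show ?thesis
    using assms(2)
  proof (induction rule: V.span_induct_alt)
    case base
    show ?case by (simp add: V.span_zero)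
  next
    case (step c b v)
    have "of_rat c * (x * b) + x * v \<in> rat_span B"
      using step assms(1) by (intro V.span_add V.span_scale) auto
    then show ?case by (simp add: algebra_simps)
  qed
qed

text \<open>All powers of \<open>x\<close> stay in a rational space of dimension at most
  \<open>card B\<close>, so \<open>card B + 1\<close> of them are dependent, and the dependence is a
  polynomial annihilating \<open>x\<close>. Applied to \<open>x + y\<close> and
  \<open>x * y\<close>, this replaces resultants.\<close>

lemma algebraic_if_rat_span_invariant:
  fixes x :: complex
  assumes "finite B" and one: "1 \<in> rat_span B"
    and inv: "\<And>v. v \<in> rat_span B \<Longrightarrow> x * v \<in> rat_span B"
  shows "algebraic x"
proof -
  interpret V: vector_space "\<lambda>q (x::complex). of_rat q * x"
    by (rule vector_space_rat_complex)
  have pow: "x ^ k \<in> rat_span B" for k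
    by (induction k) (use one inv in auto)
  define S where "S = (\<lambda>k. x ^ k) ` {..card B}"
  \<comment> \<open>Dependence is a statement about the set \<open>S\<close>. If two powers
    coincide, \<open>S\<close> is too small for the dimension count, but then X^i - X^j already
    annihilates \<open>x\<close>.\<close>
  show ?thesis
  proof (cases "inj_on (\<lambda>k. x ^ k) {..card B}")
    case False
    then obtain i j where ij: "i \<noteq> j" "x ^ i = x ^ j"
      by (auto simp: inj_on_def)
    show ?thesis
    proof (rule algebraicI)
      show "coeff (monom 1 i - monom 1 j :: complex poly) k \<in> \<int>" for k
        by auto
      show "monom 1 i - monom 1 j \<noteq> (0 :: complex poly)"
        using ij(1) by (simp add: monom_eq_iff')
      show "poly (monom 1 i - monom 1 j) x = 0"
        using ij(2) by (simp add: poly_monom)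
    qed
  next
    case True
    then have card: "card S = Suc (card B)"
      by (simp add: S_def card_image)
    have "V.dependent S"
    proof (rule ccontr)
      assume "\<not> V.dependent S"
      then have "card S \<le> card B"
        using V.independent_span_bound[of B S] assms(1) pow by (auto simp: S_def)
      with card show False by simp
    qed
    then obtain u where u: "\<exists>v\<in>S. u v \<noteq> 0" "(\<Sum>v\<in>S. of_rat (u v) * v) = 0"
      using V.dependent_finite[of S] by (auto simp: S_def)
    define p :: "complex poly" where
      "p = (\<Sum>k\<le>card B. monom (of_rat (u (x ^ k))) k)"
    have coeff_p: "coeff p k = (if k \<le> card B then of_rat (u (x ^ k)) else 0)" for k
      by (simp add: p_def coeff_sum)
    show ?thesis
    proof (rule algebraicI')
      show "coeff p k \<in> \<rat>" for k by (simp add: coeff_p)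
      show "p \<noteq> 0"
      proof -
        obtain k where "k \<le> card B" "u (x ^ k) \<noteq> 0" using u(1) by (auto simp: S_def)
        then have "coeff p k \<noteq> 0" by (simp add: coeff_p)
        then show ?thesis by auto
      qed
      have "poly p x = (\<Sum>k\<le>card B. of_rat (u (x ^ k)) * x ^ k)"
        by (simp add: p_def poly_sum poly_monom)
      also have "\<dots> = (\<Sum>v\<in>S. of_rat (u v) * v)"
        unfolding S_def by (subst sum.reindex[OF True]) simp
      finally show "poly p x = 0" using u(2) by simp
    qed
  qed
qed

lemma algebraic_top_power:
  fixes x :: complex
  assumes "algebraic x"
  obtains m c where "m > 0" "x ^ m = (\<Sum>i<m. of_rat (c i) * x ^ i)"
proof -
  obtain p where p: "p \<noteq> 0" "poly (map_poly of_int p) x = 0"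
    using assms by (elim algebraicE')
  define P :: "complex poly" where "P = map_poly of_int p"
  have cP: "coeff P i = of_int (coeff p i)" for i
    by (simp add: P_def coeff_map_poly)
  have degP: "degree P = degree p"
    unfolding P_def by (rule map_poly_degree_eq) (use p in auto)
  define m where "m = degree p"
  have lc: "coeff p m \<noteq> 0" using p by (simp add: m_def)
  have "(\<Sum>i\<le>m. of_int (coeff p i) * x ^ i) = 0"
    using p(2) by (simp add: poly_altdef degP cP m_def flip: P_def)
  then have eq: "of_int (coeff p m) * x ^ m = - (\<Sum>i<m. of_int (coeff p i) * x ^ i)"
    by (simp add: lessThan_Suc_atMost[symmetric] eq_neg_iff_add_eq_0 add.commute)
  have "m > 0"
    using eq lc by (cases m) auto
  moreover have "x ^ m = (\<Sum>i<m. of_rat (- of_int (coeff p i) / of_int (coeff p m)) * x ^ i)"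
  proof -
    have "x ^ m = (of_int (coeff p m) * x ^ m) / of_int (coeff p m)"
      using lc by simp
    also have "\<dots> = (\<Sum>i<m. of_rat (- of_int (coeff p i) / of_int (coeff p m)) * x ^ i)"
      unfolding eq by (simp add: sum_divide_distrib of_rat_divide of_rat_minus sum_negf)
    finally show ?thesis .
  qed
  ultimately show ?thesis by (rule that)
qed

text \<open>Multiplication by \<open>x\<close> raises the exponent \<open>i\<close> by one; only the
  top exponent leaves the range, and the relation for \<open>x ^ m\<close> brings it back.\<close>

lemma rat_span_power_products:
  fixes x y :: complex
  assumes "m > 0" "x ^ m = (\<Sum>i<m. of_rat (c i) * x ^ i)"
    and "v \<in> rat_span ((\<lambda>(i, j). x ^ i * y ^ j) ` ({..<m} \<times> {..<n}))"
  shows "x * v \<in> rat_span ((\<lambda>(i, j). x ^ i * y ^ j) ` ({..<m} \<times> {..<n}))"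
    (is "_ \<in> rat_span ?B")
proof (rule rat_span_mult[OF _ assms(3)])
  interpret V: vector_space "\<lambda>q (x::complex). of_rat q * x"
    by (rule vector_space_rat_complex)
  fix b assume "b \<in> ?B"
  then obtain i j where ij: "i < m" "j < n" "b = x ^ i * y ^ j" by auto
  have base: "x ^ k * y ^ j \<in> rat_span ?B" if "k < m" for k
    using that ij by (intro V.span_base) auto
  show "x * b \<in> rat_span ?B"
  proof (cases "Suc i < m")
    case True
    then show ?thesis using base[of "Suc i"] ij by (simp add: mult.assoc)
  next
    case False
    then have "m = Suc i" using ij by simp
    then have "x * b = x ^ m * y ^ j" by (simp add: ij mult.assoc)
    also have "\<dots> = (\<Sum>k<m. of_rat (c k) * (x ^ k * y ^ j))"
      by (simp add: assms(2) sum_distrib_right mult.assoc)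
    also have "\<dots> \<in> rat_span ?B"
      by (intro V.span_sum V.span_scale base) auto
    finally show ?thesis .
  qed
qed

lemma
  fixes x y :: complex
  assumes "algebraic x" "algebraic y"
  shows algebraic_add: "algebraic (x + y)"
    and algebraic_mult: "algebraic (x * y)"
proof -
  interpret V: vector_space "\<lambda>q (x::complex). of_rat q * x"
    by (rule vector_space_rat_complex)
  obtain m c where m: "m > 0" "x ^ m = (\<Sum>i<m. of_rat (c i) * x ^ i)"
    using algebraic_top_power[OF assms(1)] by blast
  obtain n d where n: "n > 0" "y ^ n = (\<Sum>i<n. of_rat (d i) * y ^ i)"
    using algebraic_top_power[OF assms(2)] by blast
  define B where "B = (\<lambda>(i, j). x ^ i * y ^ j) ` ({..<m} \<times> {..<n})"
  \<comment> \<open>The same set with \<open>x\<close> and \<open>y\<close> exchanged, so that one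
    stability lemma serves both factors.\<close>
  have B': "B = (\<lambda>(i, j). y ^ i * x ^ j) ` ({..<n} \<times> {..<m})"
    by (force simp: B_def image_iff mult.commute)
  have fin: "finite B" by (simp add: B_def)
  have "1 \<in> B" using m n by (force simp: B_def image_iff)
  then have one: "1 \<in> rat_span B" by (rule V.span_base)
  have x: "x * v \<in> rat_span B" if "v \<in> rat_span B" for v
    using rat_span_power_products[OF m] that unfolding B_def by blast
  have y: "y * v \<in> rat_span B" if "v \<in> rat_span B" for v
    using rat_span_power_products[OF n] that unfolding B' by blast
  show "algebraic (x + y)"
    by (rule algebraic_if_rat_span_invariant[OF fin one])
       (auto simp: distrib_right intro: V.span_add x y)
  show "algebraic (x * y)"
    by (rule algebraic_if_rat_span_invariant[OF fin one])
       (auto simp: mult.assoc intro: x y)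
qed

lemma algebraic_diff: "algebraic x \<Longrightarrow> algebraic y \<Longrightarrow> algebraic (x - y)" for x y :: complex
  using algebraic_add[of x "- y"] by simp

lemma algebraic_divide: "algebraic x \<Longrightarrow> algebraic y \<Longrightarrow> algebraic (x / y)" for x y :: complex
  unfolding divide_inverse by (intro algebraic_mult algebraic_inverse)

lemma algebraic_power: "algebraic x \<Longrightarrow> algebraic (x ^ n)" for x :: complex
  by (induction n) (auto intro: algebraic_mult)

lemma algebraic_sum: "(\<And>i. i \<in> I \<Longrightarrow> algebraic (f i)) \<Longrightarrow> algebraic (\<Sum>i\<in>I. f i)"
  for f :: "'i \<Rightarrow> complex"
  by (induction I rule: infinite_finite_induct) (auto intro: algebraic_add)

lemma algebraic_power_imp: "algebraic (x ^ n) \<Longrightarrow> n > 0 \<Longrightarrow> algebraic x" for x :: complex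
  by (rule algebraic_root[where p = "monom 1 n" and y = "x ^ n"])
     (auto simp: poly_monom degree_monom_eq)

section \<open>Series whose dominant poles are roots of unity times the radius\<close>

definition conv_at :: "complex fps \<Rightarrow> real \<Rightarrow> bool" where
  "conv_at f x \<longleftrightarrow> summable (\<lambda>n. norm (fps_nth f n) * x ^ n)"

definition eval_at :: "complex fps \<Rightarrow> complex \<Rightarrow> complex" where
  "eval_at f z = (\<Sum>n. fps_nth f n * z ^ n)"

lemma conv_at_summable_norm: "conv_at f (norm z) \<longleftrightarrow> summable (\<lambda>n. norm (fps_nth f n * z ^ n))"
  by (simp add: conv_at_def norm_mult norm_power)

lemma conv_at_summable: "conv_at f (norm z) \<Longrightarrow> summable (\<lambda>n. fps_nth f n * z ^ n)"
  unfolding conv_at_summable_norm by (rule summable_norm_cancel)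

lemma conv_at_0 [simp]: "conv_at f 0"
  unfolding conv_at_def by (rule summable_finite[of "{0}"]) auto

lemma conv_at_fps_of_poly [simp]: "conv_at (fps_of_poly p) x"
  unfolding conv_at_def by (rule summable_finite[of "{..degree p}"]) (auto simp: coeff_eq_0)

lemma eval_at_fps_of_poly [simp]: "eval_at (fps_of_poly p) z = poly p z"
proof -
  have "eval_at (fps_of_poly p) z = (\<Sum>n\<le>degree p. coeff p n * z ^ n)"
    unfolding eval_at_def by (subst suminf_finite[of "{..degree p}"]) (auto simp: coeff_eq_0)
  then show ?thesis by (simp add: poly_altdef)
qed

lemma conv_at_mono:
  assumes "conv_at g x" "x \<ge> 0" "\<And>n. norm (fps_nth f n) \<le> norm (fps_nth g n)"
  shows "conv_at f x"
  using assms(1) unfolding conv_at_def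
  by (rule summable_comparison_test'[where N = 0]) (use assms(2,3) in \<open>auto intro!: mult_right_mono\<close>)

lemma eval_at_diff:
  assumes "conv_at f (norm z)" "conv_at g (norm z)"
  shows "eval_at (f - g) z = eval_at f z - eval_at g z"
  using suminf_diff[OF assms[THEN conv_at_summable]]
  by (simp add: eval_at_def left_diff_distrib)

lemma fps_mult_nth_power:
  fixes f g :: "complex fps"
  shows "fps_nth (f * g) n * z ^ n = (\<Sum>i\<le>n. (fps_nth f i * z ^ i) * (fps_nth g (n - i) * z ^ (n - i)))"
proof -
  have *: "fps_nth f i * fps_nth g (n - i) * z ^ n = (fps_nth f i * z ^ i) * (fps_nth g (n - i) * z ^ (n - i))"
    if "i \<le> n" for i
  proof -
    have "z ^ n = z ^ i * z ^ (n - i)" using that by (simp flip: power_add)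
    then show ?thesis by (simp only: mult_ac)
  qed
  show ?thesis
    unfolding fps_mult_nth sum_distrib_right atLeast0AtMost
    by (intro sum.cong[OF refl] *) simp
qed

lemma eval_at_mult:
  assumes "conv_at f (norm z)" "conv_at g (norm z)"
  shows "eval_at (f * g) z = eval_at f z * eval_at g z"
  using Cauchy_product[OF assms[unfolded conv_at_summable_norm]]
  by (simp add: eval_at_def fps_mult_nth_power)

lemma conv_at_mult:
  assumes "conv_at f x" "conv_at g x" "x \<ge> 0"
  shows "conv_at (f * g) x"
proof -
  have "summable (\<lambda>n. \<Sum>i\<le>n. (norm (fps_nth f i) * x ^ i) * (norm (fps_nth g (n - i)) * x ^ (n - i)))"
    using assms unfolding conv_at_def by (intro summable_Cauchy_product) (auto simp: abs_mult)
  then show ?thesis unfolding conv_at_def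
  proof (rule summable_comparison_test'[where N = 0])
    fix n
    have "(norm (fps_nth f i) * x ^ i) * (norm (fps_nth g (n - i)) * x ^ (n - i))
       = norm (fps_nth f i * fps_nth g (n - i)) * x ^ n" if "i \<le> n" for i
    proof -
      have "x ^ n = x ^ i * x ^ (n - i)" using that by (simp flip: power_add)
      then show ?thesis by (simp only: norm_mult mult_ac)
    qed
    then have "(\<Sum>i\<le>n. (norm (fps_nth f i) * x ^ i) * (norm (fps_nth g (n - i)) * x ^ (n - i)))
       = (\<Sum>i\<le>n. norm (fps_nth f i * fps_nth g (n - i))) * x ^ n"
      by (simp add: sum_distrib_right)
    moreover have "norm (fps_nth (f * g) n) \<le> (\<Sum>i\<le>n. norm (fps_nth f i * fps_nth g (n - i)))"
      by (simp add: fps_mult_nth atLeast0AtMost norm_sum)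
    ultimately show "norm (norm (fps_nth (f * g) n) * x ^ n)
        \<le> (\<Sum>i\<le>n. (norm (fps_nth f i) * x ^ i) * (norm (fps_nth g (n - i)) * x ^ (n - i)))"
      using assms(3) by (auto intro!: mult_right_mono)
  qed
qed

text \<open>Nonnegative real coefficients, but inside the complex series, since the series are
  evaluated at complex roots of their denominators.\<close>

definition nonneg_coeffs :: "complex fps \<Rightarrow> bool" where
  "nonneg_coeffs f \<longleftrightarrow> (\<forall>n. fps_nth f n = of_real (norm (fps_nth f n)))"

lemma nonneg_coeffsI: "(\<And>n. \<exists>r\<ge>0. fps_nth f n = of_real r) \<Longrightarrow> nonneg_coeffs f"
  unfolding nonneg_coeffs_def
  by (metis norm_of_real abs_of_nonneg)

lemma nonneg_coeffsD: "nonneg_coeffs f \<Longrightarrow> fps_nth f n = of_real (norm (fps_nth f n))"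
  by (simp add: nonneg_coeffs_def)

lemma norm_add_nonneg_coeffs:
  assumes "nonneg_coeffs f" "nonneg_coeffs g"
  shows "norm (fps_nth (f + g) n) = norm (fps_nth f n) + norm (fps_nth g n)"
proof -
  have "fps_nth (f + g) n = of_real (norm (fps_nth f n) + norm (fps_nth g n))"
    by (simp only: fps_add_nth of_real_add assms[THEN nonneg_coeffsD, symmetric])
  then show ?thesis by (simp only: norm_of_real) simp
qed

lemma mult_nonneg_coeffs_nth:
  assumes "nonneg_coeffs f" "nonneg_coeffs g"
  shows "fps_nth (f * g) n = of_real (\<Sum>i\<le>n. norm (fps_nth f i) * norm (fps_nth g (n - i)))"
  by (simp only: fps_mult_nth atLeast0AtMost of_real_sum of_real_mult assms[THEN nonneg_coeffsD, symmetric])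

lemma norm_mult_nonneg_coeffs:
  assumes "nonneg_coeffs f" "nonneg_coeffs g"
  shows "norm (fps_nth (f * g) n) = (\<Sum>i\<le>n. norm (fps_nth f i) * norm (fps_nth g (n - i)))"
  unfolding mult_nonneg_coeffs_nth[OF assms] norm_of_real
  by (rule abs_of_nonneg) (auto intro: sum_nonneg)

lemma nonneg_coeffs_mult:
  assumes "nonneg_coeffs f" "nonneg_coeffs g"
  shows "nonneg_coeffs (f * g)"
proof (rule nonneg_coeffsI, intro exI conjI)
  show "fps_nth (f * g) n = of_real (\<Sum>i\<le>n. norm (fps_nth f i) * norm (fps_nth g (n - i)))" for n
    by (rule mult_nonneg_coeffs_nth[OF assms])
qed (auto intro: sum_nonneg)

lemma nonneg_coeffs_add:
  assumes "nonneg_coeffs f" "nonneg_coeffs g"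
  shows "nonneg_coeffs (f + g)"
proof (rule nonneg_coeffsI, intro exI conjI)
  fix n
  show "fps_nth (f + g) n = of_real (norm (fps_nth f n) + norm (fps_nth g n))"
    by (simp only: fps_add_nth of_real_add assms[THEN nonneg_coeffsD, symmetric])
qed simp

text \<open>Here \<open>g\<close> is the star 1/(1 - f). As \<open>f\<close> has no constant term, a
  coefficient of \<open>f * g\<close> involves only earlier coefficients of \<open>g\<close>, so
  strong induction applies.\<close>

lemma nonneg_coeffs_star:
  assumes f: "nonneg_coeffs f" "fps_nth f 0 = 0" and g: "g = 1 + f * g"
  shows "nonneg_coeffs g"
proof -
  have "fps_nth g n = of_real (norm (fps_nth g n))" for n
  proof (induction n rule: less_induct)
    case (less n)
    have "\<exists>r\<ge>0. fps_nth g n = of_real r"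
    proof -
      have "fps_nth g n = (if n = 0 then 1 else 0) + (\<Sum>i=0..n. fps_nth f i * fps_nth g (n - i))"
        by (subst g) (simp add: fps_mult_nth)
      also have "(\<Sum>i=0..n. fps_nth f i * fps_nth g (n - i))
          = (\<Sum>i=0..n. of_real (norm (fps_nth f i) * norm (fps_nth g (n - i))))"
      proof (rule sum.cong[OF refl])
        fix i assume "i \<in> {0..n}"
        show "fps_nth f i * fps_nth g (n - i) = of_real (norm (fps_nth f i) * norm (fps_nth g (n - i)))"
        proof (cases "i = 0")
          case True
          then show ?thesis using f(2) by simp
        next
          case False
          then have "i \<le> n" "n - i < n" using \<open>i \<in> _\<close> by auto
          then have "fps_nth g (n - i) = of_real (norm (fps_nth g (n - i)))" by (intro less) 
          then show ?thesis using nonneg_coeffsD[OF f(1), of i] by (metis of_real_mult)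
        qed
      qed
      also have "(if n = 0 then 1 else 0) + \<dots> =
          of_real ((if n = 0 then 1 else 0) + (\<Sum>i=0..n. norm (fps_nth f i) * norm (fps_nth g (n - i))))"
        by simp
      finally show ?thesis
        by (intro exI[of _ "(if n = 0 then 1 else 0) + (\<Sum>i=0..n. norm (fps_nth f i) * norm (fps_nth g (n - i)))"])
           (auto intro!: add_nonneg_nonneg sum_nonneg)
    qed
    then show ?case by auto
  qed
  then show ?thesis by (simp add: nonneg_coeffs_def)
qed

section \<open>Berstel's class of series and its closure properties\<close>

definition int_poly :: "complex poly \<Rightarrow> bool" where
  "int_poly p \<longleftrightarrow> (\<forall>i. coeff p i \<in> \<int>)"

lemma int_poly_simps [simp]: "int_poly 0" "int_poly 1" "int_poly [:0, 1:]"
  by (auto simp: int_poly_def coeff_pCons split: nat.splits)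

lemma int_poly_add: "int_poly p \<Longrightarrow> int_poly q \<Longrightarrow> int_poly (p + q)"
  and int_poly_diff: "int_poly p \<Longrightarrow> int_poly q \<Longrightarrow> int_poly (p - q)"
  and int_poly_mult: "int_poly p \<Longrightarrow> int_poly q \<Longrightarrow> int_poly (p * q)"
  by (auto simp: int_poly_def coeff_mult)

text \<open>The property of Berstel's theorem, phrased through an arbitrary denominator so that no reduction
  to lowest terms is needed: every root of \<open>D\<close> lies outside the convergence disc, and those on its
  boundary are \<open>p\<close>-th roots of unity times their modulus.\<close>

definition berstel_denom :: "complex fps \<Rightarrow> complex poly \<Rightarrow> nat \<Rightarrow> bool" where
  "berstel_denom f D p \<longleftrightarrow> int_poly D \<and> coeff D 0 \<noteq> 0 \<and>
     (\<exists>N. int_poly N \<and> fps_of_poly D * f = fps_of_poly N) \<and> p > 0 \<and>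
     (\<forall>z. poly D z = 0 \<longrightarrow> \<not> conv_at f (norm z) \<and>
        ((\<forall>x. 0 \<le> x \<longrightarrow> x < norm z \<longrightarrow> conv_at f x) \<longrightarrow> z ^ p = of_real (norm z ^ p)))"

definition berstel_series :: "complex fps \<Rightarrow> bool" where
  "berstel_series f \<longleftrightarrow> nonneg_coeffs f \<and> (\<exists>D p. berstel_denom f D p)"

lemma power_eq_of_real_norm_mult:
  fixes z :: complex
  assumes "z ^ p = of_real (norm z ^ p)"
  shows "z ^ (p * q) = of_real (norm z ^ (p * q))"
  using assms by (metis of_real_power power_mult)

lemma berstel_fps_of_poly:
  assumes "int_poly P" "nonneg_coeffs (fps_of_poly P)"
  shows "berstel_series (fps_of_poly P)"
proof -
  have "berstel_denom (fps_of_poly P) 1 1"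
    using assms(1) unfolding berstel_denom_def by (auto intro!: exI[of _ P])
  then show ?thesis using assms(2) by (auto simp: berstel_series_def)
qed

lemma berstel_0: "berstel_series 0"
  using berstel_fps_of_poly[of 0] by (simp add: nonneg_coeffs_def)

lemma berstel_1: "berstel_series 1"
  using berstel_fps_of_poly[of 1] by (simp add: nonneg_coeffs_def)

lemma berstel_X: "berstel_series fps_X"
  using berstel_fps_of_poly[of "[:0, 1:]"] by (simp add: nonneg_coeffs_def fps_of_poly_fps_X)

text \<open>Nonnegative coefficients do not cancel: \<open>f + g\<close> converges only where both
  summands do, so no root of \<open>D1 * D2\<close> moves into the disc. A root on its boundary
  belongs to one factor, and \<open>p1 * p2\<close> is a multiple of either exponent.\<close>

lemma berstel_add:
  assumes "berstel_series f" "berstel_series g"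
  shows "berstel_series (f + g)"
proof -
  obtain D1 p1 where D1: "berstel_denom f D1 p1" and f: "nonneg_coeffs f"
    using assms(1) by (auto simp: berstel_series_def)
  obtain D2 p2 where D2: "berstel_denom g D2 p2" and g: "nonneg_coeffs g"
    using assms(2) by (auto simp: berstel_series_def)
  obtain N1 where N1: "int_poly N1" "fps_of_poly D1 * f = fps_of_poly N1"
    using D1 by (auto simp: berstel_denom_def)
  obtain N2 where N2: "int_poly N2" "fps_of_poly D2 * g = fps_of_poly N2"
    using D2 by (auto simp: berstel_denom_def)
  have conv: "conv_at f x" "conv_at g x" if "conv_at (f + g) x" "x \<ge> 0" for x
    using that by (auto intro!: conv_at_mono[of "f + g"] simp: norm_add_nonneg_coeffs[OF f g] simp del: fps_add_nth)
  have "berstel_denom (f + g) (D1 * D2) (p1 * p2)"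
    unfolding berstel_denom_def
  proof (intro conjI allI impI)
    show "int_poly (D1 * D2)" "coeff (D1 * D2) 0 \<noteq> 0" "p1 * p2 > 0"
      using D1 D2 by (auto simp: berstel_denom_def int_poly_mult coeff_mult)
    have "fps_of_poly (D1 * D2) * (f + g) =
        fps_of_poly D2 * (fps_of_poly D1 * f) + fps_of_poly D1 * (fps_of_poly D2 * g)"
      by (simp add: fps_of_poly_mult algebra_simps)
    also have "\<dots> = fps_of_poly (D2 * N1 + D1 * N2)"
      by (simp add: N1 N2 fps_of_poly_mult fps_of_poly_add)
    finally show "\<exists>N. int_poly N \<and> fps_of_poly (D1 * D2) * (f + g) = fps_of_poly N"
      using D1 D2 N1 N2 by (intro exI[of _ "D2 * N1 + D1 * N2"])
        (auto simp: berstel_denom_def intro!: int_poly_mult int_poly_add)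
  next
    fix z assume "poly (D1 * D2) z = 0"
    then consider "poly D1 z = 0" | "poly D2 z = 0" by auto
    then show "\<not> conv_at (f + g) (norm z)"
      by cases (use D1 D2 conv in \<open>auto simp: berstel_denom_def\<close>)
  next
    fix z assume "poly (D1 * D2) z = 0"
      and *: "\<forall>x. 0 \<le> x \<longrightarrow> x < norm z \<longrightarrow> conv_at (f + g) x"
    then consider "poly D1 z = 0" | "poly D2 z = 0" by auto
    then have "z ^ p1 = of_real (norm z ^ p1) \<or> z ^ p2 = of_real (norm z ^ p2)"
      by cases (use D1 D2 conv * in \<open>auto simp: berstel_denom_def\<close>)
    then show "z ^ (p1 * p2) = of_real (norm z ^ (p1 * p2))"
      using power_eq_of_real_norm_mult[of z p1 p2] power_eq_of_real_norm_mult[of z p2 p1]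
      by (auto simp: mult.commute)
  qed
  then show ?thesis
    using nonneg_coeffs_add[OF f g] by (auto simp: berstel_series_def)
qed

text \<open>A single nonzero coefficient g_m gives f_n g_m <= (f g)_(n+m), so \<open>f\<close> is
  dominated by a shift of the product.\<close>

lemma conv_at_mult_cancel:
  assumes f: "nonneg_coeffs f" and g: "nonneg_coeffs g" "g \<noteq> 0"
    and conv: "conv_at (f * g) x" "x \<ge> 0"
  shows "conv_at f x"
proof (cases "x = 0")
  case False
  then have x: "x > 0" using conv by simp
  obtain m where m: "fps_nth g m \<noteq> 0" using g(2) by (auto simp: fps_eq_iff)
  define c where "c = norm (fps_nth g m) * x ^ m"
  have c: "c > 0" using m x by (simp add: c_def)
  have "summable (\<lambda>n. (norm (fps_nth (f * g) (n + m)) * x ^ (n + m)) / c)"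
    using conv(1) unfolding conv_at_def
    by (intro summable_divide) (subst summable_iff_shift)
  then show ?thesis unfolding conv_at_def
  proof (rule summable_comparison_test'[where N = 0])
    fix n
    have "norm (fps_nth f n) * norm (fps_nth g m) \<le> norm (fps_nth (f * g) (n + m))"
      unfolding norm_mult_nonneg_coeffs[OF f g(1)]
      using member_le_sum[of n "{..n + m}" "\<lambda>i. norm (fps_nth f i) * norm (fps_nth g (n + m - i))"]
      by simp
    then have "norm (fps_nth f n) * norm (fps_nth g m) * x ^ (n + m)
        \<le> norm (fps_nth (f * g) (n + m)) * x ^ (n + m)"
      using x by (intro mult_right_mono) auto
    then show "norm (norm (fps_nth f n) * x ^ n) \<le> norm (fps_nth (f * g) (n + m)) * x ^ (n + m) / c"
      using c x by (simp add: field_simps power_add) (simp add: c_def mult_ac)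
  qed
qed auto

lemma berstel_mult:
  assumes "berstel_series f" "berstel_series g"
  shows "berstel_series (f * g)"
proof (cases "f = 0 \<or> g = 0")
  \<comment> \<open>A zero factor makes the product converge everywhere, so roots of the other
    denominator could not be kept.\<close>
  case True
  then show ?thesis using berstel_0 by auto
next
  case False
  obtain D1 p1 where D1: "berstel_denom f D1 p1" and f: "nonneg_coeffs f"
    using assms(1) by (auto simp: berstel_series_def)
  obtain D2 p2 where D2: "berstel_denom g D2 p2" and g: "nonneg_coeffs g"
    using assms(2) by (auto simp: berstel_series_def)
  obtain N1 where N1: "int_poly N1" "fps_of_poly D1 * f = fps_of_poly N1"
    using D1 by (auto simp: berstel_denom_def)
  obtain N2 where N2: "int_poly N2" "fps_of_poly D2 * g = fps_of_poly N2"
    using D2 by (auto simp: berstel_denom_def)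
  have conv: "conv_at f x" "conv_at g x" if "conv_at (f * g) x" "x \<ge> 0" for x
    using conv_at_mult_cancel[of f g x] conv_at_mult_cancel[of g f x] f g False that
    by (auto simp: mult.commute)
  have "berstel_denom (f * g) (D1 * D2) (p1 * p2)"
    unfolding berstel_denom_def
  proof (intro conjI allI impI)
    show "int_poly (D1 * D2)" "coeff (D1 * D2) 0 \<noteq> 0" "p1 * p2 > 0"
      using D1 D2 by (auto simp: berstel_denom_def int_poly_mult coeff_mult)
    have "fps_of_poly (D1 * D2) * (f * g) = (fps_of_poly D1 * f) * (fps_of_poly D2 * g)"
      by (simp add: fps_of_poly_mult algebra_simps)
    also have "\<dots> = fps_of_poly (N1 * N2)"
      by (simp add: N1 N2 fps_of_poly_mult)
    finally show "\<exists>N. int_poly N \<and> fps_of_poly (D1 * D2) * (f * g) = fps_of_poly N"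
      using N1 N2 by (intro exI[of _ "N1 * N2"]) (auto intro!: int_poly_mult)
  next
    fix z assume "poly (D1 * D2) z = 0"
    then consider "poly D1 z = 0" | "poly D2 z = 0" by auto
    then show "\<not> conv_at (f * g) (norm z)"
      by cases (use D1 D2 conv in \<open>auto simp: berstel_denom_def\<close>)
  next
    fix z assume "poly (D1 * D2) z = 0"
      and *: "\<forall>x. 0 \<le> x \<longrightarrow> x < norm z \<longrightarrow> conv_at (f * g) x"
    then consider "poly D1 z = 0" | "poly D2 z = 0" by auto
    then have "z ^ p1 = of_real (norm z ^ p1) \<or> z ^ p2 = of_real (norm z ^ p2)"
      by cases (use D1 D2 conv * in \<open>auto simp: berstel_denom_def\<close>)
    then show "z ^ (p1 * p2) = of_real (norm z ^ (p1 * p2))"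
      using power_eq_of_real_norm_mult[of z p1 p2] power_eq_of_real_norm_mult[of z p2 p1]
      by (auto simp: mult.commute)
  qed
  then show ?thesis
    using nonneg_coeffs_mult[OF f g] by (auto simp: berstel_series_def)
qed

lemma eval_at_of_real:
  assumes "nonneg_coeffs f" "conv_at f x" "x \<ge> 0"
  shows "eval_at f (of_real x) = of_real (\<Sum>n. norm (fps_nth f n) * x ^ n)"
proof -
  have "eval_at f (of_real x) = (\<Sum>n. of_real (norm (fps_nth f n) * x ^ n))"
    unfolding eval_at_def of_real_mult of_real_power nonneg_coeffsD[OF assms(1), symmetric] ..
  also have "\<dots> = of_real (\<Sum>n. norm (fps_nth f n) * x ^ n)"
    using assms(2) unfolding conv_at_def by (rule suminf_of_real[symmetric])
  finally show ?thesis .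
qed

text \<open>The equality case of the triangle inequality for \<open>f(z) = 1\<close>.\<close>

lemma eval_at_eq_1_imp_power_eq:
  assumes f: "nonneg_coeffs f" and conv: "conv_at f (norm z)"
    and le1: "(\<Sum>n. norm (fps_nth f n) * norm z ^ n) \<le> 1"
    and eq: "eval_at f z = 1" and n: "fps_nth f n \<noteq> 0"
  shows "z ^ n = of_real (norm z ^ n)"
proof -
  define a where "a = (\<lambda>n. norm (fps_nth f n))"
  have fn: "fps_nth f n = of_real (a n)" for n
    unfolding a_def by (rule nonneg_coeffsD[OF f])
  have s1: "summable (\<lambda>n. a n * norm z ^ n)"
    using conv by (simp add: conv_at_def a_def)
  have s: "(\<lambda>n. fps_nth f n * z ^ n) sums 1"
    using conv_at_summable[OF conv] eq by (simp add: sums_iff eval_at_def)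
  have s2: "(\<lambda>n. a n * Re (z ^ n)) sums 1"
    using sums_Re[OF s] by (simp add: fn)
  \<comment> \<open>The deficits between modulus and real part of the terms. They are nonnegative
    and their total is at most 0, so each of them vanishes.\<close>
  define e where "e = (\<lambda>n. a n * norm z ^ n - a n * Re (z ^ n))"
  have e_nonneg: "e n \<ge> 0" for n
    using complex_Re_le_cmod[of "z ^ n"]
    by (auto simp: e_def a_def norm_power intro!: mult_left_mono)
  have se: "summable e" unfolding e_def using s1 s2 by (intro summable_diff) (auto simp: sums_iff)
  have "suminf e = (\<Sum>n. a n * norm z ^ n) - 1"
    unfolding e_def using suminf_diff[OF s1, of "\<lambda>n. a n * Re (z ^ n)"] s2 by (simp add: sums_iff)
  then have "suminf e \<le> 0" using le1 by (simp add: a_def)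
  then have "suminf e = 0" using suminf_nonneg[OF se e_nonneg] by simp
  then have "e n = 0" using suminf_eq_zero_iff[OF se e_nonneg] by simp
  moreover have "a n > 0" using n by (simp add: a_def)
  ultimately have re: "Re (z ^ n) = norm (z ^ n)" by (simp add: e_def norm_power)
  then have "Im (z ^ n) = 0"
    using cmod_power2[of "z ^ n"] by simp
  with re show ?thesis by (simp add: complex_eq_iff norm_power)
qed

text \<open>Finite sums are continuous, so the bound reaches the boundary of the disc before
  convergence there is known.\<close>

lemma sum_le_1_if_less:
  fixes a :: "nat \<Rightarrow> real"
  assumes "r > 0" "\<And>x. 0 \<le> x \<Longrightarrow> x < r \<Longrightarrow> (\<Sum>n<N. a n * x ^ n) \<le> 1"
  shows "(\<Sum>n<N. a n * r ^ n) \<le> 1"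
proof (rule tendsto_upperbound)
  show "((\<lambda>x. \<Sum>n<N. a n * x ^ n) \<longlongrightarrow> (\<Sum>n<N. a n * r ^ n)) (at_left r)"
    by (intro tendsto_intros)
  show "\<forall>\<^sub>F x in at_left r. (\<Sum>n<N. a n * x ^ n) \<le> 1"
    using eventually_at_left_real[OF assms(1)] by eventually_elim (use assms(2) in auto)
qed auto

text \<open>The denominator of 1/(1 - f) is \<open>D - N\<close>; where \<open>f\<close> converges,
  its roots solve f(z) = 1. At a root on the circle of convergence of \<open>g\<close> one gets
  f(|z|) <= 1 = f(z), and the equality case of the triangle inequality fixes the argument of
  \<open>z\<close>.\<close>

lemma berstel_star:
  assumes "berstel_series f" and f0: "fps_nth f 0 = 0" and g: "g = 1 + f * g"
  shows "berstel_series g"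
proof -
  obtain D p where D: "berstel_denom f D p" and f: "nonneg_coeffs f"
    using assms(1) by (auto simp: berstel_series_def)
  obtain N where N: "int_poly N" "fps_of_poly D * f = fps_of_poly N"
    using D by (auto simp: berstel_denom_def)
  have gnn: "nonneg_coeffs g" using nonneg_coeffs_star[OF f f0 g] .
  have g0: "fps_nth g 0 = 1" by (subst g) (simp add: f0)
  have le: "norm (fps_nth f n) \<le> norm (fps_nth g n)" for n
  proof (cases "n = 0")
    case False
    then have "fps_nth g n = fps_nth (f * g) n" by (subst g) simp
    then have "norm (fps_nth g n) = (\<Sum>i\<le>n. norm (fps_nth f i) * norm (fps_nth g (n - i)))"
      by (simp only: norm_mult_nonneg_coeffs[OF f gnn])
    then show ?thesis
      using member_le_sum[of n "{..n}" "\<lambda>i. norm (fps_nth f i) * norm (fps_nth g (n - i))"]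
      by (simp add: g0)
  qed (use f0 in auto)
  have conv: "conv_at f x" if "conv_at g x" "x \<ge> 0" for x
    by (rule conv_at_mono[OF that le])
  have g1: "g - f * g = 1" using g by (metis add_diff_cancel_right')
  have eval_g: "eval_at g z - eval_at f z * eval_at g z = 1" if "conv_at g (norm z)" for z
  proof -
    have "eval_at (g - f * g) z = eval_at g z - eval_at f z * eval_at g z"
      using that conv by (simp add: eval_at_diff eval_at_mult conv_at_mult)
    then show ?thesis unfolding g1 using eval_at_fps_of_poly[of 1 z] by simp
  qed
  have eval_f: "eval_at f z = 1" if "conv_at f (norm z)" "poly (D - N) z = 0" for z
  proof -
    have "poly D z \<noteq> 0" using D that(1) by (auto simp: berstel_denom_def)
    moreover have "poly D z * eval_at f z = poly N z"
      using eval_at_mult[of "fps_of_poly D" z f] that(1) N(2) by simp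
    ultimately show ?thesis using that(2) by simp
  qed
  \<comment> \<open>Any index with a nonzero coefficient of \<open>f\<close> can serve as the
    exponent of the root of unity; it is positive because the constant term vanishes.\<close>
  have p: "\<exists>p>0. f \<noteq> 0 \<longrightarrow> fps_nth f p \<noteq> 0"
  proof (cases "f = 0")
    case False
    then obtain p where "fps_nth f p \<noteq> 0" by (auto simp: fps_eq_iff)
    then show ?thesis using f0 by (intro exI[of _ p]) (auto intro!: gr0I)
  qed auto
  then obtain q where q: "q > 0" "f \<noteq> 0 \<Longrightarrow> fps_nth f q \<noteq> 0" by auto
  have N0: "coeff N 0 = 0"
  proof -
    have "fps_nth (fps_of_poly N) 0 = 0" unfolding N(2)[symmetric] using f0 by simp
    then show ?thesis by simp
  qed
  have "berstel_denom g (D - N) q"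
    unfolding berstel_denom_def
  proof (intro conjI allI impI)
    show "int_poly (D - N)" "coeff (D - N) 0 \<noteq> 0" "q > 0"
      using D N q N0 by (auto simp: berstel_denom_def int_poly_diff)
    have "fps_of_poly (D - N) * g = fps_of_poly D * (g - f * g)"
      using N(2)[symmetric] by (simp add: fps_of_poly_diff algebra_simps)
    then show "\<exists>N'. int_poly N' \<and> fps_of_poly (D - N) * g = fps_of_poly N'"
      unfolding g1 using D by (auto simp: berstel_denom_def)
  next
    fix z assume z: "poly (D - N) z = 0"
    show "\<not> conv_at g (norm z)"
    proof
      assume c: "conv_at g (norm z)"
      then have "eval_at f z = 1" using eval_f[OF conv[OF c] z] by simp
      then show False using eval_g[OF c] by simp
    qed
  next
    fix z assume z: "poly (D - N) z = 0"
      and *: "\<forall>x. 0 \<le> x \<longrightarrow> x < norm z \<longrightarrow> conv_at g x"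
    have "z \<noteq> 0" using z N0 D by (auto simp: berstel_denom_def poly_0_coeff_0)
    then have z0: "norm z > 0" by simp
    \<comment> \<open>Inside the disc, G (1 - F) = 1 together with G >= 0 forces F < 1.\<close>
    have less1: "(\<Sum>n. norm (fps_nth f n) * x ^ n) < 1" if "0 \<le> x" "x < norm z" for x
    proof -
      have cg: "conv_at g x" using * that by auto
      note cf = conv[OF cg that(1)]
      define F where "F = (\<Sum>n. norm (fps_nth f n) * x ^ n)"
      define G where "G = (\<Sum>n. norm (fps_nth g n) * x ^ n)"
      have "complex_of_real (G - F * G) = 1"
        using eval_g[of "of_real x"] that cg eval_at_of_real[OF f cf that(1)]
          eval_at_of_real[OF gnn cg that(1)] by (simp add: F_def G_def)
      then have *: "G * (1 - F) = 1" by (simp only: of_real_eq_1_iff) (simp add: algebra_simps)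
      moreover have "G \<ge> 0" unfolding G_def using cg that
        by (intro suminf_nonneg) (auto simp: conv_at_def)
      ultimately have "G > 0" by (cases "G = 0") auto
      with * have "1 - F > 0" by (metis zero_less_mult_pos zero_less_one)
      then show ?thesis by (simp add: F_def)
    qed
    \<comment> \<open>Whether \<open>f\<close> converges at \<open>norm z\<close> is still open; the
      bound on partial sums yields this convergence and the value bound together.\<close>
    have partial: "(\<Sum>n<k. norm (fps_nth f n) * norm z ^ n) \<le> 1" for k
    proof (rule sum_le_1_if_less[OF z0])
      fix x assume x: "0 \<le> x" "x < norm z"
      have "(\<Sum>n<k. norm (fps_nth f n) * x ^ n) \<le> (\<Sum>n. norm (fps_nth f n) * x ^ n)"
        using conv[of x] * x by (intro sum_le_suminf) (auto simp: conv_at_def)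
      then show "(\<Sum>n<k. norm (fps_nth f n) * x ^ n) \<le> 1" using less1[OF x] by linarith
    qed
    have cf: "conv_at f (norm z)"
      unfolding conv_at_def by (rule summableI_nonneg_bounded[where x = 1]) (use partial in auto)
    have le1: "(\<Sum>n. norm (fps_nth f n) * norm z ^ n) \<le> 1"
      using cf partial unfolding conv_at_def by (intro suminf_le_const) auto
    have f1: "eval_at f z = 1" by (rule eval_f[OF cf z])
    then have "f \<noteq> 0" by (auto simp: eval_at_def)
    from eval_at_eq_1_imp_power_eq[OF f cf le1 f1 q(2)[OF this]]
    show "z ^ q = of_real (norm z ^ q)" .
  qed
  then show ?thesis using gnn by (auto simp: berstel_series_def)
qed

lemma berstel_of_nat: "berstel_series (of_nat n)"
  by (induction n) (auto intro: berstel_0 berstel_1 berstel_add)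

lemma berstel_sum: "(\<And>i. i \<in> I \<Longrightarrow> berstel_series (f i)) \<Longrightarrow> berstel_series (\<Sum>i\<in>I. f i)"
  by (induction I rule: infinite_finite_induct) (auto intro: berstel_0 berstel_add)

lemma berstel_sum_list: "(\<And>f. f \<in> set fs \<Longrightarrow> berstel_series f) \<Longrightarrow> berstel_series (sum_list fs)"
  by (induction fs) (auto intro: berstel_0 berstel_add)

text \<open>Gaussian elimination, one unknown at a time.\<close>

lemma berstel_linear_system:
  assumes "finite I"
    and "\<And>i. i \<in> I \<Longrightarrow> F i = A i + (\<Sum>j\<in>I. B i j * F j)"
    and "\<And>i. i \<in> I \<Longrightarrow> berstel_series (A i)"
    and "\<And>i j. i \<in> I \<Longrightarrow> j \<in> I \<Longrightarrow> berstel_series (B i j)"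
    and "\<And>i j. i \<in> I \<Longrightarrow> j \<in> I \<Longrightarrow> fps_nth (B i j) 0 = 0"
    and "i \<in> I"
  shows "berstel_series (F i)"
  using assms
proof (induction I arbitrary: A B i rule: finite_induct)
  case (insert k I)
  \<comment> \<open>The star of \<open>B k k\<close> solves the \<open>k\<close>-th equation for
    \<open>F k\<close>. After substitution the new coefficients
    \<open>B i j + B i k * g * B k j\<close> again have no constant term, so the induction
    continues.\<close>
  define g where "g = inverse (1 - B k k)"
  have g1: "(1 - B k k) * g = 1"
    unfolding g_def by (rule inverse_mult_eq_1') (simp add: insert.prems(4))
  then have g: "g = 1 + B k k * g" by (simp add: algebra_simps)
  have Bg: "berstel_series g"
    by (rule berstel_star[OF _ _ g]) (use insert.prems(3,4) in auto)
  have "(1 - B k k) * F k = A k + (\<Sum>j\<in>I. B k j * F j)"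
  proof -
    have sum_insert: "(\<Sum>j\<in>insert k I. B k j * F j) = B k k * F k + (\<Sum>j\<in>I. B k j * F j)"
      using insert.hyps by simp
    show ?thesis
      using arg_cong[OF insert.prems(1)[of k, unfolded sum_insert], of "\<lambda>t. t - B k k * F k"]
      by (simp add: left_diff_distrib)
  qed
  then have "g * ((1 - B k k) * F k) = g * (A k + (\<Sum>j\<in>I. B k j * F j))" by simp
  then have Fk: "F k = g * (A k + (\<Sum>j\<in>I. B k j * F j))"
    by (simp only: mult.assoc[symmetric] mult.commute[of g] g1 mult_1)
  have I: "berstel_series (F i)" if "i \<in> I" for i
  proof (rule insert.IH[where A = "\<lambda>i. A i + B i k * g * A k"
        and B = "\<lambda>i j. B i j + B i k * g * B k j"])
    fix i assume "i \<in> I"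
    then have "F i = A i + (B i k * F k + (\<Sum>j\<in>I. B i j * F j))"
      using insert.prems(1)[of i] by (simp only: sum.insert[OF insert.hyps] insertI2)
    also have "\<dots> = A i + B i k * g * A k + (\<Sum>j\<in>I. (B i j + B i k * g * B k j) * F j)"
      unfolding Fk by (simp add: algebra_simps sum_distrib_left sum.distrib)
    finally show "F i = A i + B i k * g * A k + (\<Sum>j\<in>I. (B i j + B i k * g * B k j) * F j)" .
  qed (use insert.prems(2-4) Bg that in \<open>auto intro!: berstel_add berstel_mult\<close>)
  show ?case
  proof (cases "i = k")
    case True
    then show ?thesis unfolding True Fk using I Bg insert.prems(2-4)
      by (auto intro!: berstel_add berstel_mult berstel_sum)
  qed (use I insert.prems(5) in auto)
qed auto

section \<open>Asymptotics along residue classes\<close>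

definition alg_poly :: "complex poly \<Rightarrow> bool" where
  "alg_poly p \<longleftrightarrow> (\<forall>i. algebraic (coeff p i))"

lemma alg_poly_0_1 [simp]: "alg_poly 0" "alg_poly 1"
  by (auto simp: alg_poly_def coeff_pCons one_pCons split: nat.splits)

lemma alg_poly_mult: "alg_poly p \<Longrightarrow> alg_poly q \<Longrightarrow> alg_poly (p * q)"
  by (auto simp: alg_poly_def coeff_mult intro!: algebraic_sum algebraic_mult)

lemma alg_poly_diff: "alg_poly p \<Longrightarrow> alg_poly q \<Longrightarrow> alg_poly (p - q)"
  by (auto simp: alg_poly_def intro!: algebraic_diff)

lemma alg_poly_monom: "algebraic c \<Longrightarrow> alg_poly (monom c n)"
  by (auto simp: alg_poly_def)

lemma alg_poly_pCons: "algebraic c \<Longrightarrow> alg_poly p \<Longrightarrow> alg_poly (pCons c p)"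
  by (auto simp: alg_poly_def coeff_pCons split: nat.splits)

lemma alg_poly_int_poly: "int_poly p \<Longrightarrow> alg_poly p"
  unfolding alg_poly_def
proof
  fix i assume "int_poly p"
  then have "coeff p i \<in> \<int>" by (simp add: int_poly_def)
  then show "algebraic (coeff p i)" by (cases rule: Ints_cases) simp
qed

lemma algebraic_poly: "alg_poly p \<Longrightarrow> algebraic z \<Longrightarrow> algebraic (poly p z)"
  unfolding poly_altdef alg_poly_def by (intro algebraic_sum algebraic_mult algebraic_power) auto

text \<open>Long division by a series with nonzero constant term uses only field operations on
  coefficients.\<close>

lemma algebraic_fps_quotient:
  assumes "alg_poly D" "alg_poly N" "coeff D 0 \<noteq> 0" "fps_of_poly D * g = fps_of_poly N"
  shows "algebraic (fps_nth g n)"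
proof (induction n rule: less_induct)
  case (less n)
  have "coeff N n = (\<Sum>i=0..n. coeff D i * fps_nth g (n - i))"
    using arg_cong[OF assms(4), of "\<lambda>f. fps_nth f n"] by (simp add: fps_mult_nth)
  also have "\<dots> = coeff D 0 * fps_nth g n + (\<Sum>i=Suc 0..n. coeff D i * fps_nth g (n - i))"
    by (subst sum.atLeast_Suc_atMost) auto
  finally have "fps_nth g n = (coeff N n - (\<Sum>i=Suc 0..n. coeff D i * fps_nth g (n - i))) / coeff D 0"
    using assms(3) by (simp add: eq_divide_eq mult.commute)
  also have "algebraic \<dots>"
  proof (intro algebraic_divide algebraic_diff algebraic_sum algebraic_mult)
    fix i assume "i \<in> {Suc 0..n}"
    then show "algebraic (fps_nth g (n - i))" by (intro less) auto
  qed (use assms(1,2) in \<open>auto simp: alg_poly_def\<close>)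
  finally show ?case .
qed

lemma alg_poly_quotient:
  assumes "alg_poly D" "alg_poly (D * q)" "coeff D 0 \<noteq> 0"
  shows "alg_poly q"
proof -
  have "algebraic (fps_nth (fps_of_poly q) n)" for n
    by (rule algebraic_fps_quotient[OF assms]) (simp add: fps_of_poly_mult)
  then show ?thesis by (simp add: alg_poly_def)
qed

text \<open>Linear factors are peeled off one at a time: a root \<open>z\<close> has modulus above
  1, so 1/(X - z) is a geometric series with ratio 1/z, and absolute convergence at 1 survives
  products.\<close>

lemma inverse_conv_at_1:
  assumes "\<And>z. norm z \<le> 1 \<Longrightarrow> poly Q z \<noteq> 0"
  shows "\<exists>b. fps_of_poly Q * b = 1 \<and> conv_at b 1"
  using assms
proof (induction "degree Q" arbitrary: Q)
  case 0
  then obtain c where c: "Q = [:c:]" using degree_eq_zeroE by metis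
  have "c \<noteq> 0" using "0.prems"[of 0] c by simp
  then have "fps_of_poly Q * fps_of_poly [:1 / c:] = 1"
    by (simp add: c flip: fps_of_poly_mult)
  then show ?case using conv_at_fps_of_poly by blast
next
  case (Suc n)
  then have "\<not> constant (poly Q)" by (simp add: constant_degree)
  then obtain z where z: "poly Q z = 0" using fundamental_theorem_of_algebra by blast
  then obtain Q' where Q: "Q = [:- z, 1:] * Q'" by (auto simp: poly_eq_0_iff_dvd)
  have "Q' \<noteq> 0" using Q Suc.hyps(2) by auto
  then have "degree Q = Suc (degree Q')" unfolding Q by (subst degree_mult_eq) auto
  then have "degree Q' = n" using Suc.hyps(2) by simp
  moreover have "poly Q' y \<noteq> 0" if "norm y \<le> 1" for y using Suc.prems[OF that] Q by auto
  ultimately obtain b where b: "fps_of_poly Q' * b = 1" "conv_at b 1"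
    using Suc.hyps(1) by metis
  have z1: "norm z > 1" using z Suc.prems[of z] by force
  define c where "c = Abs_fps (\<lambda>n. - ((1 / z) ^ Suc n))"
  have c1: "fps_of_poly [:- z, 1:] * c = 1"
  proof (rule fps_ext)
    fix n
    have "z \<noteq> 0" using z1 by auto
    then show "fps_nth (fps_of_poly [:- z, 1:] * c) n = fps_nth 1 n"
      by (cases n) (simp_all add: c_def fps_of_poly_pCons algebra_simps)
  qed
  have "conv_at c 1"
  proof -
    have "summable (\<lambda>n. (norm (1 / z)) ^ Suc n)"
      using z1 by (subst summable_Suc_iff) (auto intro!: summable_geometric simp: norm_divide divide_less_eq)
    then show ?thesis by (simp add: conv_at_def c_def norm_mult norm_power norm_divide)
  qed
  then have "conv_at (c * b) 1" using b by (intro conv_at_mult) auto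
  moreover have "fps_of_poly Q * (c * b) = (fps_of_poly [:- z, 1:] * c) * (fps_of_poly Q' * b)"
    unfolding Q fps_of_poly_mult by (simp only: mult_ac)
  then have "fps_of_poly Q * (c * b) = 1" unfolding c1 b(1) by simp
  ultimately show ?case by blast
qed

text \<open>For z^p = 1 the factor X - z divides 1 - X^p, and multiplying by the cofactor trades it
  for 1 - X^p. All roots in the closed disc thus become copies of one polynomial, which avoids
  partial fractions; the price is that \<open>k\<close> may exceed the true pole order.\<close>

lemma poly_factor_unit_circle:
  assumes "p > 0" "alg_poly D" "D \<noteq> 0"
    and "\<And>z. poly D z = 0 \<Longrightarrow> norm z \<le> 1 \<Longrightarrow> z ^ p = 1"
  shows "\<exists>E k Q. alg_poly E \<and> alg_poly Q \<and> D * E = (1 - monom 1 p) ^ k * Q \<and>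
           (\<forall>z. norm z \<le> 1 \<longrightarrow> poly Q z \<noteq> 0)"
  using assms(2-)
proof (induction "degree D" arbitrary: D rule: less_induct)
  case less
  show ?case
  proof (cases "\<exists>z. poly D z = 0 \<and> norm z \<le> 1")
    case False
    then show ?thesis using less.prems
      by (intro exI[of _ 1] exI[of _ 0] exI[of _ D]) auto
  next
    case True
    then obtain z where z: "poly D z = 0" "norm z \<le> 1" by auto
    then have zp: "z ^ p = 1" by (rule less.prems)
    then have z0: "z \<noteq> 0" using assms(1) by (auto simp: power_0_left)
    have "algebraic z" by (rule algebraic_power_imp[of z p]) (use zp assms(1) in auto)
    then have az: "alg_poly [:- z, 1:]" by (intro alg_poly_pCons) auto
    obtain D' where D': "D = [:- z, 1:] * D'" using z(1) by (auto simp: poly_eq_0_iff_dvd)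
    have "D' \<noteq> 0" using D' less.prems by auto
    then have "degree D = Suc (degree D')" unfolding D' by (subst degree_mult_eq) auto
    then have deg: "degree D' < degree D" by simp
    have "alg_poly D'" by (rule alg_poly_quotient[OF az]) (use z0 less.prems D' in auto)
    then obtain E k Q where E: "alg_poly E" "alg_poly Q" "D' * E = (1 - monom 1 p) ^ k * Q"
       "\<forall>z. norm z \<le> 1 \<longrightarrow> poly Q z \<noteq> 0"
      using less.hyps[OF deg _ \<open>D' \<noteq> 0\<close>] less.prems(3) D' by auto
    have "poly (1 - monom 1 p) z = 0" using zp by (simp add: poly_monom)
    then have "[:- z, 1:] dvd 1 - monom 1 p" by (simp only: poly_eq_0_iff_dvd)
    then obtain W where W: "1 - monom 1 p = [:- z, 1:] * W" by (rule dvdE)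
    have "alg_poly W"
      by (rule alg_poly_quotient[OF az, of W], subst W[symmetric])
         (use z0 in \<open>auto intro!: alg_poly_diff alg_poly_monom\<close>)
    moreover have "D * (E * W) = ([:- z, 1:] * W) * (D' * E)" unfolding D' by (simp only: mult_ac)
    then have "D * (E * W) = (1 - monom 1 p) ^ Suc k * Q" unfolding W[symmetric] E(3)
      by (simp only: mult_ac power_Suc)
    ultimately show ?thesis using E(1,2,4) alg_poly_mult by blast
  qed
qed

text \<open>The Stolz-Cesaro theorem. From \<open>M\<close> on the errors \<open>e\<close> are small
  relative to the weights, and the fixed initial part \<open>K\<close> is swallowed by the
  divergence of the weight sums.\<close>

lemma weighted_sum_quotient_tendsto:
  fixes x :: "nat \<Rightarrow> complex" and w :: "nat \<Rightarrow> real"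
  assumes w: "\<And>j. w j > 0" and W: "filterlim (\<lambda>m. \<Sum>j\<le>m. w j) at_top sequentially"
    and x: "(\<lambda>j. x j / of_real (w j)) \<longlonglongrightarrow> c"
  shows "(\<lambda>m. (\<Sum>j\<le>m. x j) / of_real (\<Sum>j\<le>m. w j)) \<longlonglongrightarrow> c"
proof (rule LIMSEQ_I)
  fix r :: real assume r: "r > 0"
  define e where "e = (\<lambda>j. x j - c * of_real (w j))"
  obtain M where M: "\<And>j. j \<ge> M \<Longrightarrow> norm (x j / of_real (w j) - c) < r / 2"
    using LIMSEQ_D[OF x, of "r / 2"] r by auto
  have e: "norm (e j) \<le> r / 2 * w j" if "j \<ge> M" for j
  proof -
    have "e j = (x j / of_real (w j) - c) * of_real (w j)"
      using w[of j] by (simp add: e_def field_simps)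
    then have "norm (e j) = norm (x j / of_real (w j) - c) * w j"
      using w[of j] by (simp add: norm_mult)
    then show ?thesis using M[OF that] w[of j] by (auto intro!: mult_right_mono)
  qed
  define K where "K = (\<Sum>j<M. norm (e j))"
  have sum_e: "norm (\<Sum>j\<le>m. e j) \<le> K + r / 2 * (\<Sum>j\<le>m. w j)" for m
  proof -
    have "norm (\<Sum>j\<le>m. e j) \<le> (\<Sum>j\<le>m. norm (e j))" by (rule norm_sum)
    also have "\<dots> \<le> (\<Sum>j\<le>m. (if j < M then norm (e j) else 0) + r / 2 * w j)"
      using e r w by (intro sum_mono) (auto simp: not_less less_imp_le)
    also have "\<dots> = (\<Sum>j\<in>{..m} \<inter> {..<M}. norm (e j)) + r / 2 * (\<Sum>j\<le>m. w j)"
      by (simp add: sum.distrib sum_distrib_left sum.If_cases lessThan_def)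
    also have "(\<Sum>j\<in>{..m} \<inter> {..<M}. norm (e j)) \<le> K"
      unfolding K_def by (rule sum_mono2) auto
    finally show ?thesis by simp
  qed
  have "\<forall>\<^sub>F m in sequentially. (\<Sum>j\<le>m. w j) > max 0 (2 * K / r)"
    using W unfolding filterlim_at_top_dense by blast
  then obtain M' where M': "\<And>m. m \<ge> M' \<Longrightarrow> (\<Sum>j\<le>m. w j) > max 0 (2 * K / r)"
    by (auto simp: eventually_sequentially)
  show "\<exists>no. \<forall>n\<ge>no. norm ((\<Sum>j\<le>n. x j) / of_real (\<Sum>j\<le>n. w j) - c) < r"
  proof (intro exI allI impI)
    fix m assume "m \<ge> M'"
    define V where "V = (\<Sum>j\<le>m. w j)"
    have V: "V > 0" "2 * K / r < V" using M'[OF \<open>m \<ge> M'\<close>] by (auto simp: V_def)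
    have "(\<Sum>j\<le>m. e j) = (\<Sum>j\<le>m. x j) - c * of_real V"
      by (simp add: e_def sum_subtractf V_def sum_distrib_left)
    then have "(\<Sum>j\<le>m. x j) / of_real V - c = (\<Sum>j\<le>m. e j) / of_real V"
      using V by (simp add: diff_divide_distrib)
    then have "norm ((\<Sum>j\<le>m. x j) / of_real V - c) = norm (\<Sum>j\<le>m. e j) / V"
      using V by (simp add: norm_divide)
    also have "\<dots> \<le> (K + r / 2 * V) / V"
      using sum_e[of m] V by (intro divide_right_mono) (auto simp: V_def)
    also have "\<dots> < r" using V r by (simp add: field_simps)
    finally show "norm ((\<Sum>j\<le>m. x j) / of_real (\<Sum>j\<le>m. w j) - c) < r" by (simp add: V_def)
  qed
qed

lemma nth_div_one_minus_power:
  fixes a b :: "complex fps"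
  assumes "a * (1 - fps_X ^ p) = b" "t < p"
  shows "fps_nth a (p * m + t) = (\<Sum>j\<le>m. fps_nth b (p * j + t))"
proof -
  have b: "fps_nth b n = fps_nth a n - (if n < p then 0 else fps_nth a (n - p))" for n
    unfolding assms(1)[symmetric]
    by (simp only: right_diff_distrib mult_1_right fps_sub_nth fps_X_power_mult_right_nth)
  show ?thesis
  proof (induction m)
    case 0
    then show ?case using assms(2) by (simp add: b)
  next
    case (Suc m)
    have *: "\<not> p * Suc m + t < p" "p * Suc m + t - p = p * m + t" by auto
    have "fps_nth b (p * Suc m + t) = fps_nth a (p * Suc m + t) - fps_nth a (p * m + t)"
      by (simp only: b * if_False)
    then show ?case using Suc by simp
  qed
qed

lemma summable_section:
  assumes "conv_at b 1" "p > 0"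
  shows "summable (\<lambda>j. fps_nth b (p * j + t))"
proof -
  have "summable ((\<lambda>n. norm (fps_nth b n)) \<circ> (\<lambda>j. p * j + t))"
    by (rule summable_reindex) (use assms in \<open>auto simp: conv_at_def inj_on_def\<close>)
  then have "summable (\<lambda>j. norm (fps_nth b (p * j + t)))" by (simp add: o_def)
  then show ?thesis by (rule summable_norm_cancel)
qed

text \<open>Each division by 1 - X^p is a partial summation within a residue class. The hockey-stick
  identity sums the binomial weights to those of the next step, and Stolz-Cesaro carries the limit
  along.\<close>

lemma nth_div_one_minus_power_asymp:
  fixes a b :: "complex fps"
  assumes "a * (1 - fps_X ^ p) ^ Suc d = b" "t < p" "conv_at b 1"
  shows "(\<lambda>m. fps_nth a (p * m + t) / of_nat ((d + m) choose d)) \<longlonglongrightarrow> (\<Sum>j. fps_nth b (p * j + t))"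
  using assms
proof (induction d arbitrary: a)
  case 0
  have "(\<lambda>m. \<Sum>j\<le>m. fps_nth b (p * j + t)) \<longlonglongrightarrow> (\<Sum>j. fps_nth b (p * j + t))"
    using 0 by (intro summable_LIMSEQ' summable_section) auto
  then show ?case using nth_div_one_minus_power[of a p b t] 0 by simp
next
  case (Suc d)
  define a' where "a' = a * (1 - fps_X ^ p)"
  define w where "w = (\<lambda>m. real ((d + m) choose d))"
  have sum_w: "(\<Sum>j\<le>m. w j) = real ((Suc d + m) choose Suc d)" for m
    unfolding w_def using choose_rising_sum(1)[of d m] by (simp flip: of_nat_sum)
  have lim: "(\<lambda>m. fps_nth a' (p * m + t) / of_real (w m)) \<longlonglongrightarrow> (\<Sum>j. fps_nth b (p * j + t))"
    using Suc.IH[of a'] Suc.prems by (simp add: a'_def w_def mult_ac)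
  have w1: "w j \<ge> 1" for j
  proof -
    have "(d + j) choose d > 0" by (simp add: zero_less_binomial)
    then show ?thesis unfolding w_def by linarith
  qed
  have "filterlim (\<lambda>m. \<Sum>j\<le>m. w j) at_top sequentially"
  proof (rule filterlim_at_top_mono[OF filterlim_real_sequentially])
    have "real m \<le> (\<Sum>j\<le>m. w j)" for m
      using sum_mono[of "{..m}" "\<lambda>_. 1" w] w1 by simp
    then show "\<forall>\<^sub>F m in sequentially. real m \<le> (\<Sum>j\<le>m. w j)" by simp
  qed
  then have "(\<lambda>m. (\<Sum>j\<le>m. fps_nth a' (p * j + t)) / of_real (\<Sum>j\<le>m. w j)) \<longlonglongrightarrow> (\<Sum>j. fps_nth b (p * j + t))"
    using w1 lim by (intro weighted_sum_quotient_tendsto) (auto intro: less_le_trans[of _ 1])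
  then show ?case
    unfolding sum_w using nth_div_one_minus_power[OF a'_def[symmetric] Suc.prems(2)] by simp
qed

text \<open>Multiplication by the primitive root \<omega> permutes the roots of unity and multiplies
  the sum by \<omega>^k, which is not 1 unless \<open>p\<close> divides \<open>k\<close>.\<close>

lemma sum_power_roots_unity:
  fixes p :: nat
  assumes "p > 0"
  shows "(\<Sum>z | z ^ p = (1::complex). z ^ k) = (if p dvd k then of_nat p else 0)"
proof (cases "p dvd k")
  case True
  then obtain l where "k = p * l" by auto
  then have "(\<Sum>z | z ^ p = (1::complex). z ^ k) = of_nat (card {z::complex. z ^ p = 1})"
    by (simp add: power_mult)
  then show ?thesis using True assms card_roots_unity_eq[of p] by simp
next
  case False
  define U where "U = {z::complex. z ^ p = 1}"
  define \<omega> where "\<omega> = exp (2 * of_real pi * \<i> * of_nat 1 / of_nat p)"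
  have pow: "\<omega> ^ j = exp (2 * of_real pi * \<i> * of_nat j / of_nat p)" for j
    unfolding \<omega>_def exp_of_nat_mult[symmetric] by (simp add: mult_ac)
  have wp: "\<omega> ^ p = 1" and wk: "\<omega> ^ k \<noteq> 1"
    unfolding pow using complex_root_unity_eq_1[of p] assms False by auto
  have "\<omega> \<noteq> 0" by (simp add: \<omega>_def)
  have "bij_betw (\<lambda>z. \<omega> * z) U U"
  proof (rule bij_betwI[where g = "\<lambda>z. z / \<omega>"])
    show "(\<lambda>z. \<omega> * z) \<in> U \<rightarrow> U" "(\<lambda>z. z / \<omega>) \<in> U \<rightarrow> U"
      using wp by (auto simp: U_def power_mult_distrib power_divide)
  qed (use \<open>\<omega> \<noteq> 0\<close> in auto)
  then have "(\<Sum>z\<in>U. z ^ k) = (\<Sum>z\<in>U. (\<omega> * z) ^ k)"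
    by (rule sum.reindex_bij_betw[symmetric])
  also have "\<dots> = \<omega> ^ k * (\<Sum>z\<in>U. z ^ k)" by (simp add: power_mult_distrib sum_distrib_left)
  finally have "(\<Sum>z\<in>U. z ^ k) = 0" using wk by simp
  then show ?thesis using False by (simp add: U_def)
qed

lemma norm_root_unity:
  fixes z :: complex
  assumes "z ^ p = 1" "p > 0"
  shows "norm z = 1"
proof -
  have "norm z ^ p = 1 ^ p" using assms(1) by (simp flip: norm_power)
  then show ?thesis by (rule power_eq_imp_eq_base) (use assms(2) in auto)
qed

text \<open>The roots-of-unity filter: summing over all p-th roots of unity isolates one residue
  class. The factor \<open>z ^ (p - t)\<close> is the inverse of \<open>z ^ t\<close> without
  negative exponents.\<close>

lemma section_suminf:
  assumes b: "conv_at b 1" and t: "t < p"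
  shows "of_nat p * (\<Sum>j. fps_nth b (p * j + t)) = (\<Sum>z | z ^ p = 1. z ^ (p - t) * eval_at b z)"
proof -
  define U where "U = {z::complex. z ^ p = 1}"
  have p: "p > 0" using t by simp
  have norm1: "norm z = 1" if "z \<in> U" for z
    using that p norm_root_unity unfolding U_def by blast
  have "(\<Sum>z\<in>U. z ^ (p - t) * eval_at b z) = (\<Sum>z\<in>U. \<Sum>n. fps_nth b n * z ^ (n + (p - t)))"
  proof (rule sum.cong[OF refl])
    fix z assume z: "z \<in> U"
    have "z ^ (p - t) * eval_at b z = (\<Sum>n. z ^ (p - t) * (fps_nth b n * z ^ n))"
      unfolding eval_at_def using conv_at_summable[of b z] norm1[OF z] b by (simp add: suminf_mult)
    then show "z ^ (p - t) * eval_at b z = (\<Sum>n. fps_nth b n * z ^ (n + (p - t)))"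
      by (simp add: power_add mult_ac)
  qed
  also have "\<dots> = (\<Sum>n. \<Sum>z\<in>U. fps_nth b n * z ^ (n + (p - t)))"
  proof (rule suminf_sum[symmetric])
    fix z assume z: "z \<in> U"
    have "summable (\<lambda>n. z ^ (p - t) * (fps_nth b n * z ^ n))"
      using conv_at_summable[of b z] norm1[OF z] b by (intro summable_mult) simp
    then show "summable (\<lambda>n. fps_nth b n * z ^ (n + (p - t)))" by (simp add: power_add mult_ac)
  qed
  also have "\<dots> = (\<Sum>n. fps_nth b n * (if p dvd n + (p - t) then of_nat p else 0))"
    using sum_power_roots_unity[OF p] by (simp add: U_def flip: sum_distrib_left)
  also have "\<dots> = (\<Sum>j. fps_nth b (p * j + t) * of_nat p)"
  proof -
    have dvd: "p dvd n + (p - t) \<longleftrightarrow> n \<in> range (\<lambda>j. p * j + t)" for n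
    proof
      assume "p dvd n + (p - t)"
      then obtain k where k: "n + (p - t) = p * k" by auto
      have "k \<noteq> 0" using k t by (intro notI) simp
      then obtain j where "k = Suc j" by (cases k) auto
      then have "n = p * j + t" using k t by simp
      then show "n \<in> range (\<lambda>j. p * j + t)" by auto
    next
      assume "n \<in> range (\<lambda>j. p * j + t)"
      then obtain j where "n = p * j + t" by auto
      then have "n + (p - t) = p * Suc j" using t by simp
      then show "p dvd n + (p - t)" by (metis dvd_triv_left)
    qed
    have "strict_mono (\<lambda>j. p * j + t)" using p by (auto simp: strict_mono_def)
    from suminf_mono_reindex[OF this, of "\<lambda>n. fps_nth b n * (if p dvd n + (p - t) then of_nat p else 0)"]
    moreover have "p * j + t \<in> range (\<lambda>j. p * j + t)" for j by blast
    ultimately show ?thesis by (simp add: dvd)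
  qed
  also have "\<dots> = (\<Sum>j. fps_nth b (p * j + t)) * of_nat p"
    by (rule suminf_mult2[OF summable_section[OF b p], symmetric])
  finally show ?thesis by (simp add: U_def mult.commute)
qed

text \<open>By the filter the sum is a combination of values of N/Q at roots of unity, where
  \<open>Q\<close> has no zero.\<close>

lemma algebraic_section_suminf:
  assumes b: "conv_at b 1" "fps_of_poly Q * b = fps_of_poly N" and t: "t < p"
    and Q: "alg_poly Q" "alg_poly N" "\<And>z. norm z \<le> 1 \<Longrightarrow> poly Q z \<noteq> 0"
  shows "algebraic (\<Sum>j. fps_nth b (p * j + t))"
proof -
  have p: "p > 0" using t by simp
  have "algebraic (z ^ (p - t) * eval_at b z)" if z: "z ^ p = 1" for z
  proof -
    have nz: "norm z = 1" using norm_root_unity[OF z p] .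
    have az: "algebraic z" by (rule algebraic_power_imp[of z p]) (use z p in auto)
    have "poly Q z * eval_at b z = poly N z"
      using eval_at_mult[of "fps_of_poly Q" z b] b nz by simp
    then have "eval_at b z = poly N z / poly Q z" using Q(3)[of z] nz by (simp add: field_simps)
    then show ?thesis
      by (simp only:) (intro algebraic_mult algebraic_power algebraic_divide algebraic_poly az Q(1,2))
  qed
  then have "algebraic (of_nat p * (\<Sum>j. fps_nth b (p * j + t)))"
    unfolding section_suminf[OF b(1) t] by (intro algebraic_sum) auto
  from algebraic_divide[OF this, of "of_nat p"] show ?thesis using p by simp
qed

lemma fps_of_poly_if_eventually_0:
  assumes "\<And>n. n > M \<Longrightarrow> fps_nth s n = 0"
  shows "\<exists>P. s = fps_of_poly (P :: complex poly)"
proof -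
  have "s = fps_of_poly (\<Sum>n\<le>M. monom (fps_nth s n) n)"
    by (rule fps_ext) (use assms in \<open>auto simp: coeff_sum not_le\<close>)
  then show ?thesis by blast
qed

lemma tendsto_0_if_sections:
  fixes f :: "nat \<Rightarrow> complex"
  assumes "p > 0" "\<And>t. t < p \<Longrightarrow> (\<lambda>m. f (p * m + t)) \<longlonglongrightarrow> 0"
  shows "f \<longlonglongrightarrow> 0"
proof (rule LIMSEQ_I)
  fix r :: real assume r: "r > 0"
  have "\<forall>t. \<exists>M. t < p \<longrightarrow> (\<forall>m\<ge>M. norm (f (p * m + t)) < r)"
    using LIMSEQ_D[OF assms(2) r] by fastforce
  then obtain M where M: "\<And>t m. t < p \<Longrightarrow> m \<ge> M t \<Longrightarrow> norm (f (p * m + t)) < r" by metis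
  define K where "K = (\<Sum>t<p. M t)"
  show "\<exists>no. \<forall>n\<ge>no. norm (f n - 0) < r"
  proof (intro exI allI impI)
    fix n assume n: "n \<ge> p * K"
    have t: "n mod p < p" using assms(1) by simp
    then have "M (n mod p) \<le> K" unfolding K_def by (intro member_le_sum) auto
    also have "K \<le> n div p" using n assms(1) by (simp add: less_eq_div_iff_mult_less_eq mult.commute)
    finally show "norm (f n - 0) < r" using M[OF t] by (metis diff_zero mult_div_mod_eq)
  qed
qed

text \<open>If all leading coefficients vanish, the order of the dominant poles can be lowered: then
  \<open>s = F (1 - X\<^sup>p)\<^sup>d Q\<close> has coefficients that are eventually \<open>p\<close>-periodic and tend to \<open>0\<close>.\<close>

lemma one_minus_power_cancel:
  assumes eq: "F * (1 - fps_X ^ p) ^ Suc d * fps_of_poly Q = fps_of_poly N"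
    and p: "p > 0" and b: "conv_at (F * (1 - fps_X ^ p) ^ Suc d) 1"
    and N: "alg_poly N"
    and zero: "\<And>t. t < p \<Longrightarrow> (\<Sum>j. fps_nth (F * (1 - fps_X ^ p) ^ Suc d) (p * j + t)) = 0"
  shows "\<exists>N'. alg_poly N' \<and> F * (1 - fps_X ^ p) ^ d * fps_of_poly Q = fps_of_poly N'"
proof -
  define c where "c = F * (1 - fps_X ^ p) ^ d"
  define s where "s = fps_of_poly Q * c"
  have c: "c * (1 - fps_X ^ p) = F * (1 - fps_X ^ p) ^ Suc d" by (simp only: c_def power_Suc2 mult.assoc)
  \<comment> \<open>With one factor 1 - X^p fewer, the coefficients in each class converge to the
    section sum; this is the asymptotics for \<open>d = 0\<close>, and those sums vanish by
    \<open>zero\<close>.\<close>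
  have "fps_nth c \<longlonglongrightarrow> 0"
  proof (rule tendsto_0_if_sections[OF p])
    fix t assume t: "t < p"
    have "(\<lambda>m. fps_nth c (p * m + t) / of_nat ((0 + m) choose 0)) \<longlonglongrightarrow> 0"
      using nth_div_one_minus_power_asymp[of c p 0 _ t, OF _ t b] c zero[OF t] by simp
    then show "(\<lambda>m. fps_nth c (p * m + t)) \<longlonglongrightarrow> 0" by simp
  qed
  have s_lim: "fps_nth s \<longlonglongrightarrow> 0"
  proof -
    have "(\<lambda>n. \<Sum>i\<le>degree Q. coeff Q i * fps_nth c (n - i)) \<longlonglongrightarrow> (\<Sum>i\<le>degree Q. coeff Q i * 0)"
    proof (intro tendsto_sum tendsto_mult tendsto_const)
      fix i
      have "filterlim (\<lambda>n. n - i) sequentially sequentially"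
        by (rule filterlim_minus_const_nat_at_top)
      with \<open>fps_nth c \<longlonglongrightarrow> 0\<close> show "(\<lambda>n. fps_nth c (n - i)) \<longlonglongrightarrow> 0"
        by (rule filterlim_compose)
    qed
    then have lim: "(\<lambda>n. \<Sum>i\<le>degree Q. coeff Q i * fps_nth c (n - i)) \<longlonglongrightarrow> 0" by simp
    have "\<forall>\<^sub>F n in sequentially. fps_nth s n = (\<Sum>i\<le>degree Q. coeff Q i * fps_nth c (n - i))"
      using eventually_ge_at_top[of "degree Q"]
    proof eventually_elim
      case (elim n)
      have "fps_nth s n = (\<Sum>i\<le>n. coeff Q i * fps_nth c (n - i))"
        by (simp add: s_def fps_mult_nth atLeast0AtMost)
      also have "\<dots> = (\<Sum>i\<le>degree Q. coeff Q i * fps_nth c (n - i))"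
        by (rule sum.mono_neutral_right) (use elim in \<open>auto simp: coeff_eq_0\<close>)
      finally show ?case .
    qed
    from tendsto_cong[OF this] lim show ?thesis by blast
  qed
  have sN: "s * (1 - fps_X ^ p) = fps_of_poly N"
  proof -
    have "s * (1 - fps_X ^ p) = fps_of_poly Q * (c * (1 - fps_X ^ p))"
      by (simp only: s_def mult.assoc)
    then show ?thesis unfolding c using eq by (simp only: mult.commute)
  qed
  have rec: "coeff N n = fps_nth s n - (if n < p then 0 else fps_nth s (n - p))" for n
  proof -
    have "coeff N n = fps_nth (s * (1 - fps_X ^ p)) n" by (simp add: sN)
    then show ?thesis
      by (simp only: right_diff_distrib mult_1_right fps_sub_nth fps_X_power_mult_right_nth)
  qed
  have "fps_nth s n = 0" if n: "n > degree N" for n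
  proof -
    have per: "fps_nth s (n + p * j) = fps_nth s n" for j
    proof (induction j)
      case (Suc j)
      have "coeff N (n + p * Suc j) = 0" using n by (intro coeff_eq_0) simp
      moreover have "\<not> n + p * Suc j < p" "n + p * Suc j - p = n + p * j" by auto
      ultimately have "fps_nth s (n + p * Suc j) = fps_nth s (n + p * j)"
        using rec[of "n + p * Suc j"] by simp
      then show ?case using Suc by simp
    qed simp
    have "filterlim (\<lambda>j. n + p * j) sequentially sequentially"
      by (rule filterlim_subseq) (use p in \<open>auto simp: strict_mono_def\<close>)
    with s_lim have "(\<lambda>j. fps_nth s (n + p * j)) \<longlonglongrightarrow> 0" by (rule filterlim_compose)
    then show ?thesis unfolding per by (simp add: LIMSEQ_const_iff)
  qed
  then obtain N' where N': "s = fps_of_poly N'" using fps_of_poly_if_eventually_0 by blast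
  have "alg_poly N'"
  proof (rule alg_poly_quotient)
    show "alg_poly (1 - monom 1 p)" by (intro alg_poly_diff alg_poly_monom) auto
    have "fps_of_poly ((1 - monom 1 p) * N') = fps_of_poly N"
      using sN by (simp add: N' fps_of_poly_mult fps_of_poly_diff fps_of_poly_monom mult.commute)
    then have "(1 - monom 1 p) * N' = N" by (simp only: fps_of_poly_eq_iff)
    then show "alg_poly ((1 - monom 1 p) * N')" using N by simp
    show "coeff (1 - monom 1 p :: complex poly) 0 \<noteq> 0" using p by simp
  qed
  moreover have "F * (1 - fps_X ^ p) ^ d * fps_of_poly Q = fps_of_poly N'"
    unfolding N'[symmetric] s_def c_def by (rule mult.commute)
  ultimately show ?thesis by blast
qed

section \<open>Quotients of comparable series\<close>

text \<open>One class with nonzero leading coefficient suffices: consecutive values of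
  \<open>f\<close> are comparable, so the limit is positive in every class and the limits may be
  divided.\<close>

lemma quotient_section_tendsto:
  fixes f g :: "nat \<Rightarrow> real" and w :: "nat \<Rightarrow> real"
  assumes f: "\<And>n. f n > 0" "\<And>n. f n \<le> C * f (Suc n)" "\<And>n. f (Suc n) \<le> C * f n"
    and w: "\<And>m. w m > 0"
    and limf: "\<And>t. t < p \<Longrightarrow> (\<lambda>m. complex_of_real (f (p * m + t)) / of_real (w m)) \<longlonglongrightarrow> \<sigma> t"
    and limg: "\<And>t. t < p \<Longrightarrow> (\<lambda>m. complex_of_real (g (p * m + t)) / of_real (w m)) \<longlonglongrightarrow> \<sigma>' t"
    and alg: "\<And>t. t < p \<Longrightarrow> algebraic (\<sigma> t)" "\<And>t. t < p \<Longrightarrow> algebraic (\<sigma>' t)"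
    and nz: "t0 < p" "\<sigma> t0 \<noteq> 0"
  shows "\<exists>v. \<forall>t<p. algebraic (v t) \<and> (\<lambda>m. g (p * m + t) / f (p * m + t)) \<longlonglongrightarrow> v t"
proof -
  have lim_re: "(\<lambda>m. f (p * m + t) / w m) \<longlonglongrightarrow> Re (\<sigma> t)"
      "(\<lambda>m. g (p * m + t) / w m) \<longlonglongrightarrow> Re (\<sigma>' t)" if "t < p" for t
    using tendsto_Re[OF limf[OF that]] tendsto_Re[OF limg[OF that]]
    by (simp_all flip: of_real_divide)
  have "Im (\<sigma> t) = 0" "Im (\<sigma>' t) = 0" if "t < p" for t
  proof -
    have "(\<lambda>m::nat. 0) \<longlonglongrightarrow> Im (\<sigma> t)" "(\<lambda>m::nat. 0) \<longlonglongrightarrow> Im (\<sigma>' t)"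
      using tendsto_Im[OF limf[OF that]] tendsto_Im[OF limg[OF that]]
      by (simp_all flip: of_real_divide)
    then show "Im (\<sigma> t) = 0" "Im (\<sigma>' t) = 0" by (simp_all add: LIMSEQ_const_iff)
  qed
  then have real: "\<sigma> t = of_real (Re (\<sigma> t))" "\<sigma>' t = of_real (Re (\<sigma>' t))" if "t < p" for t
    using that by (simp_all add: complex_eq_iff)
  have "0 < f 0" "f 0 \<le> C * f 1" "0 < f 1" using f by auto
  then have "0 < C * f 1" by linarith
  then have C0: "C > 0" using f(1)[of 1] by (simp add: zero_less_mult_iff)
  have step: "f n \<le> C ^ i * f (n + i)" "f (n + i) \<le> C ^ i * f n" for n i
  proof -
    show "f n \<le> C ^ i * f (n + i)"
    proof (induction i)
      case (Suc i)
      also have "C ^ i * f (n + i) \<le> C ^ i * (C * f (Suc (n + i)))"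
        using f(2) C0 by (intro mult_left_mono) auto
      finally show ?case by (simp add: mult_ac)
    qed simp
    show "f (n + i) \<le> C ^ i * f n"
    proof (induction i)
      case (Suc i)
      have "f (n + Suc i) \<le> C * f (n + i)" using f(3)[of "n + i"] by simp
      also have "\<dots> \<le> C * (C ^ i * f n)" using Suc C0 by (intro mult_left_mono) auto
      finally show ?case by (simp add: mult_ac)
    qed simp
  qed
  define s where "s = Re (\<sigma> t0)"
  have "s \<ge> 0"
    by (rule tendsto_lowerbound[OF lim_re(1)[OF nz(1)], folded s_def])
       (use f(1) w in \<open>auto intro!: always_eventually divide_nonneg_pos less_imp_le\<close>)
  moreover have "s \<noteq> 0" using real(1)[OF nz(1)] nz(2) by (auto simp: s_def)
  ultimately have s: "s > 0" by simp
  have pos: "Re (\<sigma> t) > 0" if t: "t < p" for t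
  proof -
    \<comment> \<open>The classes \<open>t0\<close> and \<open>t\<close> are compared within the
      same period, moving forwards or backwards by the distance between them; each move costs a
      factor \<open>C\<close>.\<close>
    obtain K where K: "K > 0" "\<And>m. f (p * m + t0) \<le> K * f (p * m + t)"
    proof (cases "t0 \<le> t")
      case True
      then show ?thesis using that[of "C ^ (t - t0)"] step(1)[of "p * _ + t0" "t - t0"] C0
        by (simp add: add.assoc)
    next
      case False
      then show ?thesis using that[of "C ^ (t0 - t)"] step(2)[of "p * _ + t" "t0 - t"] C0
        by (simp add: add.assoc)
    qed
    have "s \<le> K * Re (\<sigma> t)"
    proof (rule tendsto_le[OF _ _ lim_re(1)[OF nz(1), folded s_def]])
      show "(\<lambda>m. K * (f (p * m + t) / w m)) \<longlonglongrightarrow> K * Re (\<sigma> t)"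
        by (intro tendsto_intros lim_re t)
      show "\<forall>\<^sub>F m in sequentially. f (p * m + t0) / w m \<le> K * (f (p * m + t) / w m)"
        using K(2) w by (intro always_eventually allI) (simp add: divide_right_mono less_imp_le)
    qed simp
    then show ?thesis using s K(1) by (metis less_le_trans zero_less_mult_pos)
  qed
  show ?thesis
  proof (intro exI allI impI conjI)
    fix t assume t: "t < p"
    show "algebraic (Re (\<sigma>' t) / Re (\<sigma> t))"
    proof -
      have "algebraic (\<sigma>' t / \<sigma> t)" using alg t by (intro algebraic_divide)
      also have "\<sigma>' t / \<sigma> t = of_real (Re (\<sigma>' t) / Re (\<sigma> t))"
        using real[OF t] by (metis of_real_divide)
      finally show ?thesis by (simp only: algebraic_of_real_iff)
    qed
    have lim: "(\<lambda>m. (g (p * m + t) / w m) / (f (p * m + t) / w m)) \<longlonglongrightarrow> Re (\<sigma>' t) / Re (\<sigma> t)"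
      using pos[OF t] by (intro tendsto_divide lim_re t) auto
    have eq: "(g (p * m + t) / w m) / (f (p * m + t) / w m) = g (p * m + t) / f (p * m + t)" for m
      using w[of m] by simp
    show "(\<lambda>m. g (p * m + t) / f (p * m + t)) \<longlonglongrightarrow> Re (\<sigma>' t) / Re (\<sigma> t)"
      using lim unfolding eq .
  qed
qed

text \<open>Induction on the bound \<open>k\<close> for the pole order. If all leading coefficients
  of \<open>f\<close> vanish, the domination of \<open>g\<close> by \<open>f\<close> makes those of
  \<open>g\<close> vanish too, and a factor 1 - X^p is dropped from both. At \<open>k = 0\<close>
  the series of \<open>f\<close> would converge at 1, contradicting \<open>div\<close>.\<close>

lemma quotient_sections_algebraic_normalized:
  fixes f g :: "nat \<Rightarrow> real"
  assumes p: "p > 0"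
    and Q: "alg_poly Q" "\<And>z. norm z \<le> 1 \<Longrightarrow> poly Q z \<noteq> 0"
    and f: "\<And>n. f n > 0" "\<And>n. f n \<le> C * f (Suc n)" "\<And>n. f (Suc n) \<le> C * f n"
    and g: "\<And>n. 0 \<le> g n" "\<And>n. g n \<le> C * f n"
    and div: "\<not> summable f"
    and N: "alg_poly N1" "alg_poly N2"
    and eqf: "Abs_fps (\<lambda>n. of_real (f n)) * (1 - fps_X ^ p) ^ k * fps_of_poly Q = fps_of_poly N1"
    and eqg: "Abs_fps (\<lambda>n. of_real (g n)) * (1 - fps_X ^ p) ^ k * fps_of_poly Q = fps_of_poly N2"
  shows "\<exists>v. \<forall>t<p. algebraic (v t) \<and> (\<lambda>m. g (p * m + t) / f (p * m + t)) \<longlonglongrightarrow> v t"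
  using N eqf eqg
proof (induction k arbitrary: N1 N2)
  define F where "F = Abs_fps (\<lambda>n. complex_of_real (f n))"
  define G where "G = Abs_fps (\<lambda>n. complex_of_real (g n))"
  obtain q where q: "fps_of_poly Q * q = 1" "conv_at q 1" using inverse_conv_at_1[OF Q(2)] by blast
  have quot: "b = q * fps_of_poly N" "conv_at b 1" if "b * fps_of_poly Q = fps_of_poly N" for b N
  proof -
    have "b = b * (fps_of_poly Q * q)" by (simp add: q)
    also have "\<dots> = q * (b * fps_of_poly Q)" by (simp only: mult_ac)
    finally show "b = q * fps_of_poly N" by (simp only: that)
    then show "conv_at b 1" using q(2) by (simp add: conv_at_mult)
  qed
  {
    case 0
    have "conv_at F 1" by (rule quot(2)[of _ N1]) (use 0 in \<open>simp add: F_def\<close>)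
    then have "summable f" using f(1) by (simp add: conv_at_def F_def less_imp_le)
    then show ?case using div by simp
  next
    case (Suc d)
    define bf where "bf = F * (1 - fps_X ^ p) ^ Suc d"
    define bg where "bg = G * (1 - fps_X ^ p) ^ Suc d"
    have bfQ: "bf * fps_of_poly Q = fps_of_poly N1" unfolding bf_def F_def by (rule Suc.prems(3))
    have bgQ: "bg * fps_of_poly Q = fps_of_poly N2" unfolding bg_def G_def by (rule Suc.prems(4))
    note cf = quot(2)[OF bfQ] and cg = quot(2)[OF bgQ]
    define \<sigma> where "\<sigma> = (\<lambda>t. \<Sum>j. fps_nth bf (p * j + t))"
    define \<sigma>' where "\<sigma>' = (\<lambda>t. \<Sum>j. fps_nth bg (p * j + t))"
    define w where "w = (\<lambda>m. real ((d + m) choose d))"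
    have w: "w m > 0" for m unfolding w_def by (simp add: zero_less_binomial)
    have limf: "(\<lambda>m. complex_of_real (f (p * m + t)) / of_real (w m)) \<longlonglongrightarrow> \<sigma> t"
      and limg: "(\<lambda>m. complex_of_real (g (p * m + t)) / of_real (w m)) \<longlonglongrightarrow> \<sigma>' t" if "t < p" for t
      using nth_div_one_minus_power_asymp[OF bf_def[symmetric] that cf]
        nth_div_one_minus_power_asymp[OF bg_def[symmetric] that cg]
      by (simp_all add: F_def G_def w_def \<sigma>_def \<sigma>'_def)
    have alg: "algebraic (\<sigma> t)" "algebraic (\<sigma>' t)" if "t < p" for t
      unfolding \<sigma>_def \<sigma>'_def
      using algebraic_section_suminf[OF cf bfQ[unfolded mult.commute[of bf]] that Q(1) Suc.prems(1) Q(2)]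
        algebraic_section_suminf[OF cg bgQ[unfolded mult.commute[of bg]] that Q(1) Suc.prems(2) Q(2)]
      by blast+
    show ?case
    proof (cases "\<exists>t<p. \<sigma> t \<noteq> 0")
      case True
      then obtain t0 where "t0 < p" "\<sigma> t0 \<noteq> 0" by blast
      with quotient_section_tendsto[OF f w limf limg alg] show ?thesis by blast
    next
      case False
      then have \<sigma>0: "\<sigma> t = 0" if "t < p" for t using that by blast
      have \<sigma>'0: "\<sigma>' t = 0" if t: "t < p" for t
      proof -
        have "(\<lambda>m. complex_of_real (g (p * m + t)) / of_real (w m)) \<longlonglongrightarrow> 0"
        proof (rule Lim_null_comparison)
          show "\<forall>\<^sub>F m in sequentially. norm (complex_of_real (g (p * m + t)) / of_real (w m))
              \<le> C * norm (complex_of_real (f (p * m + t)) / of_real (w m))"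
          proof (intro always_eventually allI)
            fix m
            have "g (p * m + t) / w m \<le> C * f (p * m + t) / w m"
              using g(2) w[of m] by (intro divide_right_mono) auto
            then show "norm (complex_of_real (g (p * m + t)) / of_real (w m))
              \<le> C * norm (complex_of_real (f (p * m + t)) / of_real (w m))"
              using g(1)[of "p * m + t"] f(1)[of "p * m + t"] w[of m] by (simp add: norm_divide)
          qed
          show "(\<lambda>m. C * norm (complex_of_real (f (p * m + t)) / of_real (w m))) \<longlonglongrightarrow> 0"
            using tendsto_mult[OF tendsto_const[of C] tendsto_norm[OF limf[OF t]]] \<sigma>0[OF t] by simp
        qed
        with limg[OF t] show ?thesis by (rule LIMSEQ_unique)
      qed
      obtain N1' where N1': "alg_poly N1'" "F * (1 - fps_X ^ p) ^ d * fps_of_poly Q = fps_of_poly N1'"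
        using one_minus_power_cancel[OF bfQ[unfolded bf_def] p cf[unfolded bf_def] Suc.prems(1)] \<sigma>0
        unfolding \<sigma>_def bf_def by blast
      obtain N2' where N2': "alg_poly N2'" "G * (1 - fps_X ^ p) ^ d * fps_of_poly Q = fps_of_poly N2'"
        using one_minus_power_cancel[OF bgQ[unfolded bg_def] p cg[unfolded bg_def] Suc.prems(2)] \<sigma>'0
        unfolding \<sigma>'_def bg_def by blast
      show ?thesis
        by (rule Suc.IH[OF N1'(1) N2'(1) N1'(2)[unfolded F_def] N2'(2)[unfolded G_def]])
    qed
  }
qed

section \<open>Rescaling the dominant poles to the unit circle\<close>

lemma conv_at_scale:
  "conv_at (fps_compose f (fps_const (of_real r) * fps_X)) x \<longleftrightarrow> conv_at f (\<bar>r\<bar> * x)"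
  unfolding conv_at_def fps_nth_compose_linear
  by (simp add: norm_mult norm_power power_mult_distrib mult_ac)

lemma fps_of_poly_scale:
  fixes P :: "complex poly"
  shows "fps_compose (fps_of_poly P) (fps_const c * fps_X) = fps_of_poly (pcompose P [:0, c:])"
  by (subst fps_of_poly_pcompose) (auto simp: fps_of_poly_pCons)

lemma alg_poly_scale:
  assumes "alg_poly P" "algebraic c"
  shows "alg_poly (pcompose P [:0, c:])"
proof -
  have "coeff (pcompose P [:0, c:]) n = c ^ n * coeff P n" for n
  proof -
    have "coeff (pcompose P [:0, c:]) n = fps_nth (fps_of_poly (pcompose P [:0, c:])) n" by simp
    also have "\<dots> = c ^ n * coeff P n" unfolding fps_of_poly_scale[symmetric] by simp
    finally show ?thesis .
  qed
  then show ?thesis using assms by (simp add: alg_poly_def algebraic_mult algebraic_power)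
qed

text \<open>Rescaling radius \<open>x\<close> to 1 reduces the claim to inverting a polynomial
  without roots in the closed unit disc.\<close>

lemma conv_at_if_no_root:
  assumes D: "fps_of_poly D * f = fps_of_poly N" and "x \<ge> 0"
    and nz: "\<And>z. norm z \<le> x \<Longrightarrow> poly D z \<noteq> 0"
  shows "conv_at f x"
proof -
  define sc where "sc = (\<lambda>f::complex fps. fps_compose f (fps_const (of_real x) * fps_X))"
  have sc_mult: "sc (a * b) = sc a * sc b" for a b
    unfolding sc_def by (rule fps_compose_mult_distrib) simp
  have "poly (pcompose D [:0, of_real x:]) z \<noteq> 0" if "norm z \<le> 1" for z
    using nz[of "of_real x * z"] that assms(2)
    by (simp add: poly_pcompose norm_mult mult_left_le mult.commute)
  then obtain b where b: "sc (fps_of_poly D) * b = 1" "conv_at b 1"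
    using inverse_conv_at_1[of "pcompose D [:0, of_real x:]"]
    unfolding sc_def fps_of_poly_scale by blast
  have "sc f = sc f * (sc (fps_of_poly D) * b)" by (simp add: b)
  also have "\<dots> = b * sc (fps_of_poly D * f)" unfolding sc_mult by (simp only: mult_ac)
  also have "\<dots> = b * sc (fps_of_poly N)" by (simp only: D)
  finally have "sc f = b * sc (fps_of_poly N)" .
  moreover have "conv_at (b * sc (fps_of_poly N)) 1"
    by (rule conv_at_mult) (simp_all add: b sc_def fps_of_poly_scale)
  ultimately have "conv_at (sc f) 1" by simp
  then show ?thesis using assms(2) by (simp add: sc_def conv_at_scale)
qed

text \<open>Substituting R X for X, with \<open>R\<close> the least modulus of a root of
  \<open>D1 * D2\<close>, moves the dominant roots to roots of unity. As \<open>g\<close> is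
  dominated by \<open>f\<close>, the series \<open>F\<close> diverges at the roots of both
  denominators, so \<open>R\<close> is its radius of convergence and one normalization serves both
  series.\<close>

theorem quotient_sections_algebraic:
  fixes f g :: "nat \<Rightarrow> real"
  assumes bf: "berstel_series (Abs_fps (\<lambda>n. of_real (f n)))"
    and bg: "berstel_series (Abs_fps (\<lambda>n. of_real (g n)))"
    and f: "\<And>n. f n > 0" "\<And>n. f n \<le> C * f (Suc n)" "\<And>n. f (Suc n) \<le> C * f n"
    and g: "\<And>n. 0 \<le> g n" "\<And>n. g n \<le> C * f n"
  shows "\<exists>p>0. \<exists>v. \<forall>t<p. algebraic (v t) \<and> (\<lambda>m. g (p * m + t) / f (p * m + t)) \<longlonglongrightarrow> v t"
proof -
  define F where "F = Abs_fps (\<lambda>n. complex_of_real (f n))"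
  define G where "G = Abs_fps (\<lambda>n. complex_of_real (g n))"
  obtain D1 p1 where D1: "berstel_denom F D1 p1" using bf by (auto simp: berstel_series_def F_def)
  obtain D2 p2 where D2: "berstel_denom G D2 p2" using bg by (auto simp: berstel_series_def G_def)
  obtain N1 where N1: "int_poly N1" "fps_of_poly D1 * F = fps_of_poly N1"
    using D1 by (auto simp: berstel_denom_def)
  obtain N2 where N2: "int_poly N2" "fps_of_poly D2 * G = fps_of_poly N2"
    using D2 by (auto simp: berstel_denom_def)
  have convFG: "conv_at G x" if "conv_at F x" "x \<ge> 0" for x
  proof -
    have "summable (\<lambda>n. C * (f n * x ^ n))"
      using that(1) f(1) by (intro summable_mult) (simp add: conv_at_def F_def less_imp_le)
    then show ?thesis unfolding conv_at_def
      by (rule summable_comparison_test'[where N = 0])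
         (use g that in \<open>auto simp: G_def mult.assoc[symmetric] intro!: mult_right_mono\<close>)
  qed
  define D where "D = D1 * D2"
  define p where "p = p1 * p2"
  have p: "p > 0" and D0: "coeff D 0 \<noteq> 0" and Dint: "int_poly D"
    using D1 D2 by (auto simp: berstel_denom_def p_def D_def coeff_mult int_poly_mult)
  then have Dnz: "D \<noteq> 0" by auto
  have F_div: "\<not> conv_at F (norm z)" if "poly D z = 0" for z
    using that D1 D2 convFG[of "norm z"] by (auto simp: D_def berstel_denom_def)
  \<comment> \<open>A constant denominator would make the series of \<open>f\<close> a polynomial,
    but all its coefficients are positive.\<close>
  have "\<not> constant (poly D)"
  proof
    assume "constant (poly D)"
    then have "degree (D1 * D2) = 0" by (simp add: constant_degree D_def)
    then have "degree D1 = 0" using Dnz by (simp add: degree_mult_eq D_def)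
    then obtain c where c: "D1 = [:c:]" using degree_eq_zeroE by metis
    then have c0: "c \<noteq> 0" using Dnz by (auto simp: D_def)
    have "fps_nth (fps_of_poly D1 * F) (Suc (degree N1)) = c * of_real (f (Suc (degree N1)))"
      by (simp add: c F_def fps_of_poly_pCons)
    moreover have "\<dots> \<noteq> 0" using c0 f(1)[of "Suc (degree N1)"] by simp
    ultimately show False unfolding N1(2) by (simp add: coeff_eq_0)
  qed
  then have ex_root: "{z. poly D z = 0} \<noteq> {}" using fundamental_theorem_of_algebra by blast
  have fin: "finite {z. poly D z = 0}" using Dnz by (rule poly_roots_finite)
  define R where "R = Min (norm ` {z. poly D z = 0})"
  have "R \<in> norm ` {z. poly D z = 0}" unfolding R_def using ex_root fin by (intro Min_in) auto
  then obtain z0 where z0: "poly D z0 = 0" "norm z0 = R" by auto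
  have R_le: "R \<le> norm z" if "poly D z = 0" for z
    unfolding R_def using that fin by (intro Min_le) auto
  have R: "R > 0"
  proof -
    have "z0 \<noteq> 0" using z0 D0 by (auto simp: poly_0_coeff_0)
    then show ?thesis using z0 by auto
  qed
  have conv: "conv_at F x" "conv_at G x" if "0 \<le> x" "x < R" for x
  proof -
    have "poly D z \<noteq> 0" if "norm z \<le> x" for z using R_le[of z] that \<open>x < R\<close> by auto
    then have "poly D1 z \<noteq> 0" if "norm z \<le> x" for z using that by (simp add: D_def)
    then show "conv_at F x" by (rule conv_at_if_no_root[OF N1(2) that(1)])
    then show "conv_at G x" by (rule convFG[OF _ that(1)])
  qed
  have root_power: "z ^ p = of_real (R ^ p)" if z: "poly D z = 0" "norm z = R" for z
  proof -
    have "z ^ p1 = of_real (norm z ^ p1) \<or> z ^ p2 = of_real (norm z ^ p2)"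
      using z conv D1 D2 by (auto simp: D_def berstel_denom_def)
    then show ?thesis
      using power_eq_of_real_norm_mult[of z p1 p2] power_eq_of_real_norm_mult[of z p2 p1] z(2)
      by (auto simp: mult.commute p_def)
  qed
  \<comment> \<open>The root-of-unity property gives R^p = z0^p, so \<open>R\<close> is algebraic
    without a proof that \<open>R\<close> is itself a root.\<close>
  have "algebraic z0"
    using Dint Dnz z0 by (intro algebraicI[of D]) (auto simp: int_poly_def)
  then have "algebraic (z0 ^ p)" by (rule algebraic_power)
  then have "algebraic (complex_of_real R ^ p)" using root_power[OF z0] by simp
  then have algR: "algebraic (complex_of_real R)" using p by (rule algebraic_power_imp)
  define sc where "sc = (\<lambda>f::complex fps. fps_compose f (fps_const (of_real R) * fps_X))"
  define ps where "ps = (\<lambda>P::complex poly. pcompose P [:0, of_real R:])"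
  have sc_mult: "sc (a * b) = sc a * sc b" for a b
    unfolding sc_def by (rule fps_compose_mult_distrib) simp
  have sc_poly: "sc (fps_of_poly P) = fps_of_poly (ps P)" for P
    unfolding sc_def ps_def by (rule fps_of_poly_scale)
  have alg_ps: "alg_poly (ps P)" if "int_poly P" for P
    unfolding ps_def by (rule alg_poly_scale[OF alg_poly_int_poly[OF that] algR])
  have "\<exists>E k Q. alg_poly E \<and> alg_poly Q \<and> ps D * E = (1 - monom 1 p) ^ k * Q \<and>
           (\<forall>z. norm z \<le> 1 \<longrightarrow> poly Q z \<noteq> 0)"
  proof (rule poly_factor_unit_circle[OF p alg_ps[OF Dint]])
    have "poly (ps D) 0 \<noteq> 0" using D0 by (simp add: ps_def poly_pcompose poly_0_coeff_0)
    then show "ps D \<noteq> 0" by auto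
    fix z assume z: "poly (ps D) z = 0" "norm z \<le> 1"
    then have root: "poly D (of_real R * z) = 0" by (simp add: ps_def poly_pcompose mult.commute)
    then have "norm (of_real R * z) = R"
      using R_le[OF root] z(2) R by (simp add: norm_mult mult_left_le)
    from root_power[OF root this] show "z ^ p = 1" using R by (simp add: power_mult_distrib)
  qed
  then obtain E k Q where E: "alg_poly E" "alg_poly Q" "ps D * E = (1 - monom 1 p) ^ k * Q"
     and Q: "\<And>z. norm z \<le> 1 \<Longrightarrow> poly Q z \<noteq> 0" by blast
  \<comment> \<open>Stated for an arbitrary splitting of \<open>D\<close>, so that it applies to
    \<open>F\<close> with denominator \<open>D1\<close> and to \<open>G\<close> with denominator
    \<open>D2\<close>; the other factor goes into the numerator.\<close>
  have eq: "sc H * (1 - fps_X ^ p) ^ k * fps_of_poly Q = fps_of_poly (ps (D' * N) * E)"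
    if "D = D' * D''" "fps_of_poly D'' * H = fps_of_poly N" for H D' D'' N
  proof -
    have "sc H * (1 - fps_X ^ p) ^ k * fps_of_poly Q = sc H * fps_of_poly ((1 - monom 1 p) ^ k * Q)"
      by (simp add: fps_of_poly_mult fps_of_poly_power fps_of_poly_diff fps_of_poly_monom mult.assoc)
    also have "\<dots> = sc H * (sc (fps_of_poly D) * fps_of_poly E)"
      by (simp only: E(3)[symmetric] fps_of_poly_mult sc_poly)
    also have "\<dots> = sc (fps_of_poly D' * (fps_of_poly D'' * H)) * fps_of_poly E"
      unfolding that(1) by (simp only: fps_of_poly_mult sc_mult mult_ac)
    also have "\<dots> = fps_of_poly (ps (D' * N) * E)"
      by (simp only: that(2) fps_of_poly_mult[symmetric] sc_poly)
    finally show ?thesis .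
  qed
  have sc_FG: "sc F = Abs_fps (\<lambda>n. of_real (R ^ n * f n))" "sc G = Abs_fps (\<lambda>n. of_real (R ^ n * g n))"
    by (simp_all add: sc_def F_def G_def fps_eq_iff)
  have C0: "C \<ge> 0"
  proof -
    have "0 < C * f 1" using f(1)[of 0] f(2)[of 0] by simp
    then show ?thesis using f(1)[of 1] by (simp add: zero_less_mult_iff)
  qed
  \<comment> \<open>The substitution multiplies the one-step ratios of \<open>f\<close> by
    \<open>R\<close> or its inverse; \<open>C'\<close> covers both directions and the comparison
    with \<open>g\<close>.\<close>
  define C' where "C' = max C (max (C / R) (C * R))"
  have "\<exists>v. \<forall>t<p. algebraic (v t) \<and>
     (\<lambda>m. (R ^ (p * m + t) * g (p * m + t)) / (R ^ (p * m + t) * f (p * m + t))) \<longlonglongrightarrow> v t"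
  proof (rule quotient_sections_algebraic_normalized[OF p E(2) Q, where C = C' and k = k])
    fix n
    show "0 < R ^ n * f n" "0 \<le> R ^ n * g n" using R f(1)[of n] g(1)[of n] by auto
    have mono: "a \<le> C' * b" if "a \<le> c * b" "c \<le> C'" "0 \<le> b" for a b c
      using that by (meson mult_right_mono order_trans)
    show "R ^ n * f n \<le> C' * (R ^ Suc n * f (Suc n))"
    proof (rule mono[of _ "C / R"])
      have "R ^ n * f n \<le> R ^ n * (C * f (Suc n))" using f(2)[of n] R by (intro mult_left_mono) auto
      also have "\<dots> = C / R * (R ^ Suc n * f (Suc n))" using R by simp
      finally show "R ^ n * f n \<le> C / R * (R ^ Suc n * f (Suc n))" .
    qed (use R f(1)[of "Suc n"] in \<open>auto simp: C'_def\<close>)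
    show "R ^ Suc n * f (Suc n) \<le> C' * (R ^ n * f n)"
    proof (rule mono[of _ "C * R"])
      have "R ^ Suc n * f (Suc n) \<le> R ^ Suc n * (C * f n)" using f(3)[of n] R by (intro mult_left_mono) auto
      then show "R ^ Suc n * f (Suc n) \<le> C * R * (R ^ n * f n)" by (simp add: mult_ac)
    qed (use R f(1)[of n] in \<open>auto simp: C'_def\<close>)
    show "R ^ n * g n \<le> C' * (R ^ n * f n)"
    proof (rule mono[of _ C])
      have "R ^ n * g n \<le> R ^ n * (C * f n)" using g(2)[of n] R by (intro mult_left_mono) auto
      then show "R ^ n * g n \<le> C * (R ^ n * f n)" by (simp add: mult_ac)
    qed (use R f(1)[of n] in \<open>auto simp: C'_def\<close>)
  next
    show "\<not> summable (\<lambda>n. R ^ n * f n)"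
      using F_div[OF z0(1)] f(1) z0(2) by (simp add: conv_at_def F_def less_imp_le mult.commute)
    show "alg_poly (ps (D2 * N1) * E)" "alg_poly (ps (D1 * N2) * E)"
      using D1 D2 N1 N2 E by (auto simp: berstel_denom_def intro!: alg_poly_mult alg_ps int_poly_mult)
    show "Abs_fps (\<lambda>n. of_real (R ^ n * f n)) * (1 - fps_X ^ p) ^ k * fps_of_poly Q
        = fps_of_poly (ps (D2 * N1) * E)"
      unfolding sc_FG[symmetric] by (rule eq[OF _ N1(2)]) (simp add: D_def mult.commute)
    show "Abs_fps (\<lambda>n. of_real (R ^ n * g n)) * (1 - fps_X ^ p) ^ k * fps_of_poly Q
        = fps_of_poly (ps (D1 * N2) * E)"
      unfolding sc_FG[symmetric] by (rule eq[OF _ N2(2)]) (simp add: D_def)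
  qed
  moreover have eq: "(R ^ n * g n) / (R ^ n * f n) = g n / f n" for n using R by simp
  ultimately show ?thesis using p unfolding eq by blast
qed

section \<open>Iterated morphisms\<close>

lemma morph_ext_append: "morph_ext h (xs @ ys) = morph_ext h xs @ morph_ext h ys"
  by (simp add: morph_ext_def)

lemma iter_append: "(morph_ext h ^^ n) (xs @ ys) = (morph_ext h ^^ n) xs @ (morph_ext h ^^ n) ys"
  by (induction n) (simp_all add: morph_ext_append)

lemma iter_Nil [simp]: "(morph_ext h ^^ n) [] = []"
  by (induction n) (simp_all add: morph_ext_def)

lemma iter_Suc: "(morph_ext h ^^ Suc n) xs = (morph_ext h ^^ n) (morph_ext h xs)"
  by (simp add: funpow_swap1)

lemma iter_Suc_singleton: "(morph_ext h ^^ Suc n) [c] = (morph_ext h ^^ n) (h c)"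
  by (simp only: iter_Suc) (simp add: morph_ext_def)

lemma iter_1: "(morph_ext h ^^ 1) [c] = h c"
  by (simp add: morph_ext_def)

lemma iter_add: "(morph_ext h ^^ (m + n)) xs = (morph_ext h ^^ m) ((morph_ext h ^^ n) xs)"
  by (simp add: funpow_add)

lemma set_iter: "set ((morph_ext h ^^ n) xs) = (\<Union>c\<in>set xs. set ((morph_ext h ^^ n) [c]))"
proof (induction xs)
  case (Cons x xs)
  then show ?case using iter_append[of n h "[x]" xs] by simp
qed simp

lemma length_iter: "length ((morph_ext h ^^ n) xs) = (\<Sum>c\<leftarrow>xs. length ((morph_ext h ^^ n) [c]))"
proof (induction xs)
  case (Cons x xs)
  then show ?case using iter_append[of n h "[x]" xs] by simp
qed simp

definition power_morph :: "(nat \<Rightarrow> nat list) \<Rightarrow> nat \<Rightarrow> nat \<Rightarrow> nat list" where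
  "power_morph h p c = (morph_ext h ^^ p) [c]"

lemma morph_ext_power_morph: "morph_ext (power_morph h p) = morph_ext h ^^ p"
proof
  fix xs
  show "morph_ext (power_morph h p) xs = (morph_ext h ^^ p) xs"
  proof (induction xs)
    case Nil
    show ?case by (simp only: iter_Nil) (simp add: morph_ext_def)
  next
    case (Cons x xs)
    have "morph_ext (power_morph h p) (x # xs) = (morph_ext h ^^ p) [x] @ morph_ext (power_morph h p) xs"
      by (simp add: morph_ext_def power_morph_def)
    also have "\<dots> = (morph_ext h ^^ p) ([x] @ xs)" unfolding Cons iter_append ..
    finally show ?case by simp
  qed
qed

lemma iter_power_morph: "(morph_ext (power_morph h p) ^^ n) = (morph_ext h ^^ (p * n))"
  by (simp add: morph_ext_power_morph funpow_mult mult.commute)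

lemma set_iter_subset:
  assumes "\<And>c. c \<in> S \<Longrightarrow> set (h c) \<subseteq> S" "set xs \<subseteq> S"
  shows "set ((morph_ext h ^^ n) xs) \<subseteq> S"
  using assms(2)
proof (induction n arbitrary: xs)
  case (Suc n)
  have "set (morph_ext h xs) \<subseteq> S" using Suc.prems assms(1) by (auto simp: morph_ext_def)
  then show ?case unfolding iter_Suc by (rule Suc.IH)
qed simp

lemma prolongable_power_morph:
  assumes "prolongable S h a" "p > 0"
  shows "prolongable S (power_morph h p) a"
proof -
  obtain x where x: "h a = a # x" "x \<noteq> []" "\<And>n. (morph_ext h ^^ n) x \<noteq> []"
    and S: "finite S" "a \<in> S" "\<And>c. c \<in> S \<Longrightarrow> set (h c) \<subseteq> S"
    using assms(1) by (auto simp: prolongable_def)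
  obtain q where q: "p = Suc q" using assms(2) by (cases p) auto
  have hd: "\<exists>y. (morph_ext h ^^ n) [a] = a # y" for n
  proof (induction n)
    case (Suc n)
    then show ?case using x(1) iter_append[of n h "[a]" x] by (auto simp only: iter_Suc_singleton) auto
  qed simp
  obtain y where y: "(morph_ext h ^^ q) [a] = a # y" using hd by blast
  define x' where "x' = y @ (morph_ext h ^^ q) x"
  have "power_morph h p a = a # x'"
    using iter_append[of q h "[a]" x] x(1) y
    by (simp add: power_morph_def q iter_Suc_singleton x'_def del: funpow.simps)
  moreover have ne: "(morph_ext (power_morph h p) ^^ n) x' \<noteq> []" for n
    unfolding iter_power_morph x'_def iter_append using x(3)[of "p * n + q"] by (simp add: iter_add)
  moreover have "x' \<noteq> []" using ne[of 0] by simp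
  moreover have "set (power_morph h p c) \<subseteq> S" if "c \<in> S" for c
    unfolding power_morph_def by (rule set_iter_subset[OF S(3)]) (use that in auto)
  ultimately show ?thesis using S unfolding prolongable_def by blast
qed

lemma is_fixpoint_word_power_morph:
  "is_fixpoint_word h a u \<Longrightarrow> is_fixpoint_word (power_morph h p) a u"
  by (simp add: is_fixpoint_word_def iter_power_morph)

lemma length_iter_uniform:
  assumes "\<And>c. c \<in> S \<Longrightarrow> length (h c) = m" "\<And>c. c \<in> S \<Longrightarrow> set (h c) \<subseteq> S" "set xs \<subseteq> S"
  shows "length ((morph_ext h ^^ n) xs) = m ^ n * length xs"
  using assms(3)
proof (induction n arbitrary: xs)
  case (Suc n)
  have "set (morph_ext h xs) \<subseteq> S" using Suc.prems assms(2) by (auto simp: morph_ext_def)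
  moreover have "length (morph_ext h xs) = m * length xs"
    using Suc.prems assms(1) by (induction xs) (auto simp: morph_ext_def)
  ultimately show ?case using Suc.IH[of "morph_ext h xs"] by (simp add: funpow_swap1)
qed simp

text \<open>Choosing \<open>p\<close> as a multiple of the period not below the preperiod puts all
  positive multiples of \<open>p\<close> on the same point of the cycle, as for the idempotent power
  in a finite semigroup.\<close>

lemma eventually_periodic_funpow:
  fixes Z :: "nat \<Rightarrow> 'b"
  assumes "finite (range Z)" "\<And>n. Z (Suc n) = F (Z n)"
  shows "\<exists>p>0. \<forall>k>0. Z (p * k) = Z p"
proof -
  have "\<not> inj Z" using assms(1) finite_imageD by blast
  then obtain m' n' where "m' \<noteq> n'" "Z m' = Z n'" unfolding inj_def by blast
  then obtain m n where mn: "m < n" "Z m = Z n" by (cases m' n' rule: linorder_cases) auto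
  define q where "q = n - m"
  have step: "Z (m + i + q) = Z (m + i)" for i
  proof (induction i)
    case 0
    then show ?case using mn by (simp add: q_def)
  next
    case (Suc i)
    then show ?case using assms(2)[of "m + i + q"] assms(2)[of "m + i"] by simp
  qed
  have per: "Z (k + q * j) = Z k" if "k \<ge> m" for k j
  proof (induction j)
    case (Suc j)
    have eq: "m + (k + q * j - m) + q = k + q * Suc j" "m + (k + q * j - m) = k + q * j"
      using that by simp_all
    show ?case using step[of "k + q * j - m"] Suc unfolding eq(2) by (simp add: algebra_simps)
  qed simp
  define p where "p = q * Suc m"
  have q: "q > 0" using mn by (simp add: q_def)
  have "p \<ge> m" using q by (simp add: p_def trans_le_add2)
  show ?thesis
  proof (intro exI conjI allI impI)
    show "p > 0" using q by (simp add: p_def)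
    fix k :: nat assume "k > 0"
    then obtain l where l: "k = Suc l" by (cases k) auto
    have "p * k = p + q * (Suc m * l)" by (simp add: l p_def algebra_simps)
    then show "Z (p * k) = Z p" using per[OF \<open>p \<ge> m\<close>] by simp
  qed
qed

text \<open>The set \<open>Z n\<close> of letters whose \<open>n\<close>-th image stays in
  \<open>C\<close> determines \<open>Z (Suc n)\<close>, and there are finitely many such sets.
  Eventual periodicity thus turns a condition on all iterates into one on a single image.\<close>

lemma ex_power_idempotent:
  assumes "finite S" and S: "\<And>c. c \<in> S \<Longrightarrow> set (h c) \<subseteq> S"
  shows "\<exists>p>0. \<forall>n>0. \<forall>c\<in>S. set ((morph_ext (power_morph h p) ^^ n) [c]) \<subseteq> C
     \<longleftrightarrow> set (power_morph h p c) \<subseteq> C"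
proof -
  define Z where "Z = (\<lambda>n. {c \<in> S. set ((morph_ext h ^^ n) [c]) \<subseteq> C})"
  have "finite (range Z)"
    by (rule finite_subset[of _ "Pow S"]) (use assms(1) in \<open>auto simp: Z_def\<close>)
  moreover have "Z (Suc n) = {c \<in> S. set (h c) \<subseteq> Z n}" for n
  proof -
    have "set ((morph_ext h ^^ n) (h c)) \<subseteq> C \<longleftrightarrow> (\<forall>d\<in>set (h c). set ((morph_ext h ^^ n) [d]) \<subseteq> C)" for c
      by (subst set_iter) blast
    then have "Z (Suc n) = {c \<in> S. \<forall>d\<in>set (h c). set ((morph_ext h ^^ n) [d]) \<subseteq> C}"
      unfolding Z_def iter_Suc_singleton by simp
    also have "\<dots> = {c \<in> S. set (h c) \<subseteq> Z n}"
    proof (rule Collect_cong, rule conj_cong[OF refl])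
      fix c assume "c \<in> S"
      then have "d \<in> S" if "d \<in> set (h c)" for d using S that by blast
      then show "(\<forall>d\<in>set (h c). set ((morph_ext h ^^ n) [d]) \<subseteq> C) \<longleftrightarrow> set (h c) \<subseteq> Z n"
        unfolding Z_def by auto
    qed
    finally show ?thesis .
  qed
  ultimately obtain p where p: "p > 0" "\<And>k. k > 0 \<Longrightarrow> Z (p * k) = Z p"
    using eventually_periodic_funpow[of Z "\<lambda>z. {c \<in> S. set (h c) \<subseteq> z}"] by blast
  have "set ((morph_ext h ^^ (p * n)) [c]) \<subseteq> C \<longleftrightarrow> set ((morph_ext h ^^ p) [c]) \<subseteq> C"
    if "n > 0" "c \<in> S" for n c
  proof -
    have "c \<in> Z (p * n) \<longleftrightarrow> c \<in> Z p" by (simp only: p(2)[OF that(1)])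
    then show ?thesis using that(2) by (simp add: Z_def)
  qed
  with p(1) show ?thesis
    unfolding iter_power_morph power_morph_def by (intro exI[of _ p] conjI allI impI ballI) auto
qed

text \<open>The value 0 for a list without a hit makes \<open>last_idx_append\<close> hold without
  side conditions.\<close>

primrec last_idx :: "('b \<Rightarrow> bool) \<Rightarrow> 'b list \<Rightarrow> nat" where
  "last_idx P [] = 0"
| "last_idx P (x # xs) = (if \<exists>y\<in>set xs. P y then Suc (last_idx P xs) else 0)"

lemma last_idx:
  assumes "\<exists>y\<in>set ys. P y"
  shows "last_idx P ys < length ys" "P (ys ! last_idx P ys)"
    and "last_idx P ys < j \<Longrightarrow> j < length ys \<Longrightarrow> \<not> P (ys ! j)"
proof -
  have "last_idx P ys < length ys \<and> P (ys ! last_idx P ys) \<and>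
    (\<forall>j. last_idx P ys < j \<longrightarrow> j < length ys \<longrightarrow> \<not> P (ys ! j))"
    using assms
  proof (induction ys)
    case (Cons x xs)
    show ?case
    proof (cases "\<exists>y\<in>set xs. P y")
      case True
      have "\<not> P ((x # xs) ! j)" if "Suc (last_idx P xs) < j" "j < length (x # xs)" for j
        using that Cons.IH[OF True] by (cases j) auto
      then show ?thesis using True Cons.IH[OF True] by simp
    next
      case False
      then have "\<not> P ((x # xs) ! j)" if "0 < j" "j < length (x # xs)" for j
        using that by (cases j) auto
      then show ?thesis using False Cons.prems by auto
    qed
  qed simp
  then show "last_idx P ys < length ys" "P (ys ! last_idx P ys)"
    "last_idx P ys < j \<Longrightarrow> j < length ys \<Longrightarrow> \<not> P (ys ! j)" by auto
qed

lemma last_idx_eq_0: "\<not> (\<exists>y\<in>set ys. P y) \<Longrightarrow> last_idx P ys = 0"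
  by (cases ys) auto

lemma last_idx_append:
  "last_idx P (xs @ ys) = (if \<exists>y\<in>set ys. P y then length xs + last_idx P ys else last_idx P xs)"
proof (induction xs)
  case Nil
  show ?case using last_idx_eq_0[of ys P] by auto
next
  case (Cons x xs)
  then show ?case by (auto simp: bex_Un)
qed

lemma last_idx_append1: "\<exists>y\<in>set ys. P y \<Longrightarrow> last_idx P (xs @ ys) = length xs + last_idx P ys"
  and last_idx_append2: "\<not> (\<exists>y\<in>set ys. P y) \<Longrightarrow> last_idx P (xs @ ys) = last_idx P xs"
  by (simp_all only: last_idx_append if_True if_False)

definition first_idx :: "('b \<Rightarrow> bool) \<Rightarrow> 'b list \<Rightarrow> nat" where
  "first_idx P ys = length (takeWhile (\<lambda>y. \<not> P y) ys)"

lemma first_idx: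
  assumes "\<exists>y\<in>set ys. P y"
  shows "first_idx P ys < length ys" "P (ys ! first_idx P ys)"
    and "j < first_idx P ys \<Longrightarrow> \<not> P (ys ! j)"
proof -
  show lt: "first_idx P ys < length ys" unfolding first_idx_def
    using assms by (induction ys) auto
  show "P (ys ! first_idx P ys)"
    using nth_length_takeWhile[OF lt[unfolded first_idx_def]] by (simp add: first_idx_def)
  show "\<not> P (ys ! j)" if "j < first_idx P ys"
    using that set_takeWhileD[of "ys ! j" "\<lambda>y. \<not> P y" ys] takeWhile_nth[of j "\<lambda>y. \<not> P y" ys]
      nth_mem[of j "takeWhile (\<lambda>y. \<not> P y) ys"]
    by (auto simp: first_idx_def)
qed

lemma first_idx_append1: "\<exists>y\<in>set xs. P y \<Longrightarrow> first_idx P (xs @ ys) = first_idx P xs"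
  and first_idx_append2: "\<not> (\<exists>y\<in>set xs. P y) \<Longrightarrow> first_idx P (xs @ ys) = length xs + first_idx P ys"
  by (induction xs) (auto simp: first_idx_def)

section \<open>Blocks and their boundaries\<close>

text \<open>Records the two letters around a block rather than its ends, since these letters can be
  traced through the morphism. A block at position 0 has no such pair, and adjacent positions
  enclose an empty block; neither affects the limsup.\<close>

definition boundary_pair :: "(nat \<Rightarrow> 'a) \<Rightarrow> 'a set \<Rightarrow> nat \<Rightarrow> nat \<Rightarrow> bool" where
  "boundary_pair w D x y \<longleftrightarrow> x < y \<and> w x \<notin> D \<and> w y \<notin> D \<and> (\<forall>z. x < z \<longrightarrow> z < y \<longrightarrow> w z \<in> D)"

lemma blk_end:
  assumes "infinite {n. w n \<notin> D}"
  shows "blk_start w D k \<le> blk_end w D k" "w (Suc (blk_end w D k)) \<notin> D"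
    and "\<And>j. blk_start w D k \<le> j \<Longrightarrow> w (Suc j) \<notin> D \<Longrightarrow> blk_end w D k \<le> j"
proof -
  define P where "P = (\<lambda>j. blk_start w D k \<le> j \<and> w (Suc j) \<notin> D)"
  obtain n where n: "n > blk_start w D k" "w n \<notin> D"
    using assms unfolding infinite_nat_iff_unbounded by auto
  then have "P (n - 1)" by (cases n) (auto simp: P_def)
  then have "P (LEAST j. P j)" by (rule LeastI)
  then show "blk_start w D k \<le> blk_end w D k" "w (Suc (blk_end w D k)) \<notin> D"
    by (auto simp: P_def blk_end_def)
  show "blk_end w D k \<le> j" if "blk_start w D k \<le> j" "w (Suc j) \<notin> D" for j
    unfolding blk_end_def using that by (intro Least_le) auto
qed

lemma blk_start_props:
  assumes "infinite (block_starts w D)"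
  shows "strict_mono (blk_start w D)" "blk_start w D k \<in> block_starts w D"
    and "i \<in> block_starts w D \<Longrightarrow> \<exists>k. i = blk_start w D k"
proof -
  show "strict_mono (blk_start w D)" "blk_start w D k \<in> block_starts w D"
    using strict_mono_enumerate[OF assms] enumerate_in_set[OF assms]
    by (simp_all add: blk_start_def[abs_def])
  show "\<exists>k. i = blk_start w D k" if "i \<in> block_starts w D"
    using enumerate_Ex[OF assms that] by (auto simp: blk_start_def)
qed

lemma boundary_pair_block:
  assumes inf: "infinite {n. w n \<notin> D}" and starts: "infinite (block_starts w D)"
    and pos: "blk_start w D k > 0"
  shows "boundary_pair w D (blk_start w D k - 1) (Suc (blk_end w D k))"
proof -
  note e = blk_end[OF inf, of k]
  have s: "w (blk_start w D k) \<in> D" "w (blk_start w D k - 1) \<notin> D"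
    using blk_start_props(2)[OF starts, of k] pos by (auto simp: block_starts_def)
  have "w z \<in> D" if z: "blk_start w D k - 1 < z" "z < Suc (blk_end w D k)" for z
  proof (cases "z = blk_start w D k")
    case False
    then have "blk_start w D k \<le> z - 1" "z - 1 < blk_end w D k" using z by auto
    then have "w (Suc (z - 1)) \<in> D" using e(3)[of "z - 1"] by auto
    then show ?thesis using z by simp
  qed (use s in auto)
  then show ?thesis using s e pos by (auto simp: boundary_pair_def)
qed

lemma block_of_boundary_pair:
  assumes inf: "infinite {n. w n \<notin> D}" and starts: "infinite (block_starts w D)"
    and xy: "boundary_pair w D x y" "Suc x < y"
  shows "\<exists>k. blk_start w D k = Suc x \<and> blk_end w D k = y - 1"
proof -
  have "Suc x \<in> block_starts w D" using xy by (auto simp: boundary_pair_def block_starts_def)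
  then obtain k where k: "blk_start w D k = Suc x" using blk_start_props(3)[OF starts] by metis
  note e = blk_end[OF inf, of k, unfolded k]
  have "blk_end w D k \<le> y - 1" using xy by (intro e(3)) (auto simp: boundary_pair_def)
  moreover have "\<not> blk_end w D k < y - 1"
  proof
    assume "blk_end w D k < y - 1"
    then have "w (Suc (blk_end w D k)) \<in> D" using xy(1) e(1) by (auto simp: boundary_pair_def)
    then show False using e(2) by simp
  qed
  ultimately show ?thesis using k by auto
qed

text \<open>With finitely many starts, each letter of \<open>D\<close> lies before the position
  \<open>nxt i\<close> chosen beyond the start \<open>i\<close> of its block. The sum
  \<open>E\<close> bounds all these positions, against runs of unbounded length.\<close>

lemma infinite_block_starts:
  assumes inf: "infinite {n. w n \<notin> D}" and unb: "\<And>L. \<exists>p. \<forall>t<L. w (p + t) \<in> D"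
  shows "infinite (block_starts w D)"
proof
  assume fin: "finite (block_starts w D)"
  have "\<forall>i. \<exists>n\<ge>i. w n \<notin> D" using inf unfolding infinite_nat_iff_unbounded_le by auto
  then obtain nxt where nxt: "\<And>i. nxt i \<ge> i \<and> w (nxt i) \<notin> D" by metis
  define E where "E = (\<Sum>i\<in>block_starts w D. nxt i)"
  have lt: "z < E" if z: "w z \<in> D" for z
  proof -
    define i where "i = (LEAST i. i \<le> z \<and> (\<forall>y. i \<le> y \<longrightarrow> y \<le> z \<longrightarrow> w y \<in> D))"
    have i: "i \<le> z \<and> (\<forall>y. i \<le> y \<longrightarrow> y \<le> z \<longrightarrow> w y \<in> D)"
      unfolding i_def by (rule LeastI[of _ z]) (use z in auto)
    have "i = 0 \<or> w (i - 1) \<notin> D"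
    proof (rule ccontr)
      assume *: "\<not> (i = 0 \<or> w (i - 1) \<notin> D)"
      have "i \<le> i - 1" unfolding i_def
      proof (rule Least_le, fold i_def, intro conjI allI impI)
        show "i - 1 \<le> z" using i[THEN conjunct1] by simp
        fix y assume "i - 1 \<le> y" "y \<le> z"
        then show "w y \<in> D" using i * by (cases "y = i - 1") auto
      qed
      then show False using * by auto
    qed
    then have "i \<in> block_starts w D" using i by (auto simp: block_starts_def)
    then have "nxt i \<le> E" unfolding E_def using fin by (intro member_le_sum) auto
    moreover have "\<not> nxt i \<le> z" using i nxt[of i] by auto
    ultimately show ?thesis by simp
  qed
  obtain p where "\<forall>t<Suc E. w (p + t) \<in> D" using unb by blast
  then have "w (p + E) \<in> D" by simp
  from lt[OF this] show False by simp
qed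

text \<open>A ratio is at most 1 + (y - x)/i_k. Replacing the left boundary by the leftmost one,
  \<open>X e m\<close>, bounds it by \<open>Y e m / X e m\<close>. Gaps of bounded length contribute
  at most 1 in the limit, and every ratio with positive start is at least 1, whence the 1 in the
  maximum.\<close>

lemma limsup_block_ratio:
  fixes X Y :: "'e \<Rightarrow> nat \<Rightarrow> nat" and v :: "'e \<Rightarrow> real"
  assumes inf: "infinite {n. w n \<notin> D}" and starts: "infinite (block_starts w D)"
    and E: "finite E"
    and pair: "\<And>e m. e \<in> E \<Longrightarrow> boundary_pair w D (X e m) (Y e m)"
    and pos: "\<And>e m. e \<in> E \<Longrightarrow> X e m > 0"
    and unbdd: "\<And>e. e \<in> E \<Longrightarrow> filterlim (X e) at_top sequentially"
    and lim: "\<And>e. e \<in> E \<Longrightarrow> (\<lambda>m. real (Y e m) / real (X e m)) \<longlonglongrightarrow> v e"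
    and cover: "\<And>x y. boundary_pair w D x y \<Longrightarrow>
      y - x \<le> K \<or> (\<exists>e\<in>E. \<exists>m. y - x = Y e m - X e m \<and> X e m \<le> x)"
  shows "limsup (\<lambda>k. ereal (real (blk_end w D k) / real (blk_start w D k))) = ereal (Max (insert 1 (v ` E)))"
proof -
  define i where "i = blk_start w D"
  define j where "j = blk_end w D"
  define \<Lambda> where "\<Lambda> = Max (insert 1 (v ` E))"
  have \<Lambda>: "1 \<le> \<Lambda>" "\<And>e. e \<in> E \<Longrightarrow> v e \<le> \<Lambda>" "\<Lambda> = 1 \<or> (\<exists>e\<in>E. \<Lambda> = v e)"
  proof -
    have "\<Lambda> \<in> insert 1 (v ` E)" unfolding \<Lambda>_def using E by (intro Max_in) auto
    then show "\<Lambda> = 1 \<or> (\<exists>e\<in>E. \<Lambda> = v e)" by auto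
  qed (use E in \<open>auto simp: \<Lambda>_def\<close>)
  have mono: "strict_mono i" using blk_start_props(1)[OF starts] by (simp add: i_def)
  have i_ge: "k \<le> i k" for k using mono by (rule strict_mono_imp_increasing)
  have "limsup (\<lambda>k. ereal (real (j k) / real (i k))) \<le> ereal \<Lambda>"
    unfolding Limsup_le_iff
  proof (intro allI impI)
    fix c' assume "ereal \<Lambda> < c'"
    then obtain c where "ereal \<Lambda> < ereal c" and c': "ereal c < c'" using ereal_dense2 by blast
    then have c: "\<Lambda> < c" by simp
    have "\<forall>e\<in>E. \<exists>M. \<forall>m\<ge>M. real (Y e m) / real (X e m) < c"
    proof
      fix e assume "e \<in> E"
      then have "v e < c" using \<Lambda>(2) c(1) by force
      from order_tendstoD(2)[OF lim[OF \<open>e \<in> E\<close>] this]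
      show "\<exists>M. \<forall>m\<ge>M. real (Y e m) / real (X e m) < c" by (simp add: eventually_sequentially)
    qed
    then obtain M where M: "\<And>e m. e \<in> E \<Longrightarrow> m \<ge> M e \<Longrightarrow> real (Y e m) / real (X e m) < c" by metis
    \<comment> \<open>Besides \<open>K\<close> this absorbs the finitely many gap lengths with
      \<open>m\<close> below \<open>M e\<close>, so a longer gap forces \<open>m\<close> into the
      range where the ratio is below \<open>c\<close>.\<close>
    define K' where "K' = K + (\<Sum>e\<in>E. \<Sum>m<M e. Y e m - X e m)"
    have K': "Y e m - X e m \<le> K'" if "e \<in> E" "m < M e" for e m
    proof -
      have "Y e m - X e m \<le> (\<Sum>m<M e. Y e m - X e m)"
        by (rule member_le_sum) (use that in auto)
      also have "\<dots> \<le> (\<Sum>e\<in>E. \<Sum>m<M e. Y e m - X e m)"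
        by (rule member_le_sum[of e E "\<lambda>e. \<Sum>m<M e. Y e m - X e m"]) (use that E in auto)
      finally show ?thesis by (simp add: K'_def)
    qed
    obtain N where N: "real N > real K' / (c - 1)" using reals_Archimedean2 by blast
    have "\<forall>\<^sub>F k in sequentially. k > N" by (rule eventually_gt_at_top)
    then show "\<forall>\<^sub>F k in sequentially. ereal (real (j k) / real (i k)) < c'"
    proof eventually_elim
      case (elim k)
      have ik: "i k > N" using elim i_ge[of k] by linarith
      define x where "x = i k - 1"
      define y where "y = Suc (j k)"
      have bp: "boundary_pair w D x y"
        using boundary_pair_block[OF inf starts, of k] ik by (simp add: x_def y_def i_def j_def)
      have xy: "x < y" using bp by (simp add: boundary_pair_def)
      have ix: "real (i k) = real x + 1" using ik by (simp add: x_def)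
      have ratio: "real (j k) / real (i k) \<le> 1 + real (y - x) / real (i k)"
        using ik xy ix by (simp add: field_simps of_nat_diff y_def)
      have c1: "c > 1" using \<Lambda>(1) c by simp
      have "real (j k) / real (i k) < c"
      proof (cases "y - x \<le> K'")
        case True
        have "real K' < (c - 1) * real (i k)"
        proof -
          have "real K' < (c - 1) * real N" using N c1 by (simp add: field_simps)
          also have "\<dots> \<le> (c - 1) * real (i k)" using ik c1 by (intro mult_left_mono) auto
          finally show ?thesis .
        qed
        then have "real K' / real (i k) < c - 1" using ik by (simp add: field_simps)
        moreover have "real (y - x) / real (i k) \<le> real K' / real (i k)"
          using True by (intro divide_right_mono) auto
        ultimately show ?thesis using ratio by linarith
      next
        case False
        then have "\<not> y - x \<le> K" by (simp add: K'_def)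
        then obtain e m where em: "e \<in> E" "y - x = Y e m - X e m" "X e m \<le> x"
          using cover[OF bp] by blast
        have m: "m \<ge> M e" using K'[OF em(1), of m] False em(2) by force
        have X: "X e m < Y e m" using pair[OF em(1)] by (simp add: boundary_pair_def)
        have "real (y - x) / real (i k) \<le> real (Y e m - X e m) / real (X e m)"
          unfolding em(2) using em(3) pos[OF em(1), of m] ix by (intro divide_left_mono) auto
        moreover have "1 + real (Y e m - X e m) / real (X e m) = real (Y e m) / real (X e m)"
          using X pos[OF em(1), of m] by (simp add: of_nat_diff field_simps)
        ultimately show ?thesis using M[OF em(1) m] ratio by linarith
      qed
      then show ?case 
        by (intro less_trans[OF _ c']) simp
    qed
  qed
  moreover have "ereal \<Lambda> \<le> limsup (\<lambda>k. ereal (real (j k) / real (i k)))"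
  proof (rule ccontr)
    assume "\<not> ereal \<Lambda> \<le> limsup (\<lambda>k. ereal (real (j k) / real (i k)))"
    then have "limsup (\<lambda>k. ereal (real (j k) / real (i k))) < ereal \<Lambda>" by (simp only: not_le)
    from dense[OF this] obtain c' where c': "limsup (\<lambda>k. ereal (real (j k) / real (i k))) < c'" "c' < ereal \<Lambda>"
      by (elim exE conjE)
    have "\<forall>\<^sub>F k in sequentially. ereal (real (j k) / real (i k)) < c'"
      using c'(1) by (rule Limsup_lessD)
    then have "\<not> (\<exists>\<^sub>F k in sequentially. c' < ereal (real (j k) / real (i k)))"
      unfolding not_frequently by (rule eventually_mono) auto
    moreover have "\<exists>\<^sub>F k in sequentially. c' < ereal (real (j k) / real (i k))"
    proof (cases "\<Lambda> = 1")
      case True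
      have "\<forall>\<^sub>F k in sequentially. k > 0" by (rule eventually_gt_at_top)
      then have "\<forall>\<^sub>F k in sequentially. c' < ereal (real (j k) / real (i k))"
      proof eventually_elim
        case (elim k)
        then have "i k > 0" "i k \<le> j k"
          using i_ge[of k] blk_end(1)[OF inf, of k] by (auto simp: i_def j_def)
        then have "1 \<le> real (j k) / real (i k)" by simp
        then have "ereal 1 \<le> ereal (real (j k) / real (i k))" by (simp only: ereal_less_eq)
        then show ?case using less_le_trans[of c' "ereal 1"] c'(2) True by simp
      qed
      then show ?thesis by (rule eventually_frequently[OF sequentially_bot])
    next
      case False
      then obtain e where e: "e \<in> E" "\<Lambda> = v e" using \<Lambda>(3) by blast
      \<comment> \<open>A bound above 1 guarantees that the pairs found below enclose a nonempty
        block.\<close>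
      have "max c' (ereal 1) < ereal \<Lambda>" using c'(2) False \<Lambda>(1) by auto
      then obtain c where c: "max c' (ereal 1) < ereal c" and "ereal c < ereal \<Lambda>"
        using ereal_dense2 by blast
      then have c\<Lambda>: "c < \<Lambda>" by simp
      have c1: "c > 1" using c by simp
      \<comment> \<open>The block inside a pair runs from \<open>X e m + 1\<close> to
        \<open>Y e m - 1\<close>; as \<open>X e m\<close> tends to infinity, these shifts do not
        change the limit.\<close>
      have inv: "(\<lambda>m. 1 / real (X e m)) \<longlonglongrightarrow> 0"
        using filterlim_compose[OF lim_1_over_n unbdd[OF e(1)]] .
      have "(\<lambda>m. (real (Y e m) / real (X e m) - 1 / real (X e m)) / (1 + 1 / real (X e m)))
          \<longlonglongrightarrow> (v e - 0) / (1 + 0)"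
        by (intro tendsto_intros lim[OF e(1)] inv) auto
      moreover have "(real (Y e m) / real (X e m) - 1 / real (X e m)) / (1 + 1 / real (X e m))
          = (real (Y e m) - 1) / (real (X e m) + 1)" for m
      proof -
        have "real (Y e m) / real (X e m) - 1 / real (X e m) = (real (Y e m) - 1) / real (X e m)"
          "1 + 1 / real (X e m) = (real (X e m) + 1) / real (X e m)"
          using pos[OF e(1), of m] by (simp_all add: diff_divide_distrib add_divide_distrib)
        then show ?thesis using pos[OF e(1), of m] by simp
      qed
      ultimately have "(\<lambda>m. (real (Y e m) - 1) / (real (X e m) + 1)) \<longlonglongrightarrow> \<Lambda>"
        using e(2) by simp
      from order_tendstoD(1)[OF this c\<Lambda>]
      have ev: "\<forall>\<^sub>F m in sequentially. c < (real (Y e m) - 1) / (real (X e m) + 1)" .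
      show ?thesis unfolding frequently_sequentially
      proof
        fix N
        have "\<forall>\<^sub>F m in sequentially. i N < X e m"
          using unbdd[OF e(1), unfolded filterlim_at_top, rule_format, of "Suc (i N)"]
          by (simp add: Suc_le_eq)
        then have "\<forall>\<^sub>F m in sequentially. i N < X e m \<and> c < (real (Y e m) - 1) / (real (X e m) + 1)"
          using ev by (rule eventually_conj)
        then obtain m where m: "i N < X e m" "c < (real (Y e m) - 1) / (real (X e m) + 1)"
          using eventually_happens by force
        have "c * (real (X e m) + 1) < real (Y e m) - 1"
          using m(2) by (subst (asm) pos_less_divide_eq) auto
        moreover have "real (X e m) + 1 \<le> c * (real (X e m) + 1)"
          using mult_right_mono[of 1 c "real (X e m) + 1"] c1 by simp
        ultimately have "real (X e m) + 1 < real (Y e m) - 1" by (rule order.strict_trans1[rotated])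
        then have "real (Suc (X e m)) < real (Y e m)" by simp
        then have SX: "Suc (X e m) < Y e m" by (simp only: of_nat_less_iff)
        then obtain k where k: "i k = Suc (X e m)" "j k = Y e m - 1"
          using block_of_boundary_pair[OF inf starts pair[OF e(1)]] unfolding i_def j_def by blast
        have "i N < i k" using m(1) k(1) by simp
        then have Nk: "N \<le> k" using mono by (simp add: strict_mono_less)
        have "real (j k) / real (i k) = (real (Y e m) - 1) / (real (X e m) + 1)"
          using SX by (simp add: k of_nat_diff add.commute)
        with m(2) have "ereal c < ereal (real (j k) / real (i k))" by simp
        moreover have "c' < ereal c" using c(1) by simp
        ultimately have "c' < ereal (real (j k) / real (i k))" by (rule less_trans[rotated])
        with Nk show "\<exists>k\<ge>N. c' < ereal (real (j k) / real (i k))" by blast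
      qed
    qed
    ultimately show False by contradiction
  qed
  ultimately show ?thesis unfolding i_def j_def \<Lambda>_def by (rule antisym)
qed

section \<open>Gaps between marked letters\<close>

text \<open>The set \<open>C\<close> stands for the letters coded into the block alphabet, and a
  position is marked if its letter lies outside \<open>C\<close>. By \<open>idem\<close>,
  \<open>h\<close> is already the power for which one iterate decides goodness.\<close>

locale marked_fixpoint =
  fixes S :: "nat set" and h :: "nat \<Rightarrow> nat list" and a :: nat and u :: "nat \<Rightarrow> nat" and C :: "nat set"
  assumes prol: "prolongable S h a" and fixp: "is_fixpoint_word h a u"
    and idem: "\<And>n c. n > 0 \<Longrightarrow> c \<in> S \<Longrightarrow> set ((morph_ext h ^^ n) [c]) \<subseteq> C \<longleftrightarrow> set (h c) \<subseteq> C"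
    and infinite_marks: "infinite {z. u z \<notin> C}"
begin

abbreviation H :: "nat \<Rightarrow> nat list \<Rightarrow> nat list" where
  "H n \<equiv> morph_ext h ^^ n"

definition len :: "nat \<Rightarrow> nat" where
  "len n = length (H n [a])"

definition pre :: "nat \<Rightarrow> nat list" where
  "pre x = map u [0..<x]"

text \<open>As \<open>u\<close> is fixed by \<open>h\<close>, this is where the \<open>n\<close>-th
  image of the letter at \<open>x\<close> begins. It need not be strictly increasing in
  \<open>x\<close>, because \<open>h\<close> may erase letters.\<close>

definition pos :: "nat \<Rightarrow> nat \<Rightarrow> nat" where
  "pos n x = length (H n (pre x))"

lemma S: "finite S" "a \<in> S" "c \<in> S \<Longrightarrow> set (h c) \<subseteq> S"
  using prol by (auto simp: prolongable_def)

lemma set_H: "set xs \<subseteq> S \<Longrightarrow> set (H n xs) \<subseteq> S"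
  by (rule set_iter_subset) (use S in auto)

lemma ex_tail: "\<exists>x. h a = a # x \<and> x \<noteq> [] \<and> (\<forall>n. H n x \<noteq> [])"
  using prol unfolding prolongable_def by blast

definition tail :: "nat list" where
  "tail = (SOME x. h a = a # x \<and> x \<noteq> [] \<and> (\<forall>n. H n x \<noteq> []))"

lemma tail: "h a = a # tail" "tail \<noteq> []" "H n tail \<noteq> []"
  using someI_ex[OF ex_tail] by (auto simp: tail_def[symmetric])

lemma H_Suc_a: "H (Suc n) [a] = H n [a] @ H n tail"
  using iter_append[of n h "[a]" tail] by (simp only: iter_Suc_singleton tail(1)) simp

lemma len_less: "len n < len (Suc n)"
  using tail(3)[of n] unfolding len_def H_Suc_a by simp

lemma len_mono: "m \<le> n \<Longrightarrow> len m \<le> len n"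
  by (rule lift_Suc_mono_le) (use len_less in \<open>auto intro: less_imp_le\<close>)

lemma len_gt: "n < len n"
proof (induction n)
  case 0
  show ?case by (simp add: len_def)
next
  case (Suc n)
  then show ?case using len_less[of n] by linarith
qed

lemma length_pre [simp]: "length (pre x) = x"
  by (simp add: pre_def)

lemma nth_pre [simp]: "z < x \<Longrightarrow> pre x ! z = u z"
  by (simp add: pre_def)

lemma pre_Suc: "pre (Suc x) = pre x @ [u x]"
  by (simp add: pre_def)

lemma pre_append: "x \<le> y \<Longrightarrow> pre y = pre x @ map u [x..<y]"
  unfolding pre_def using upt_add_eq_append[of 0 x "y - x"] by simp

lemma H_a: "H n [a] = pre (len n)"
proof (rule nth_equalityI)
  fix i assume "i < length (H n [a])"
  then show "H n [a] ! i = pre (len n) ! i"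
    using fixp by (simp add: is_fixpoint_word_def len_def)
qed (simp add: len_def)

lemma set_pre: "set (pre x) \<subseteq> S"
proof -
  have "pre (len x) = pre x @ map u [x..<len x]" using len_gt[of x] by (intro pre_append) simp
  moreover have "set (pre (len x)) \<subseteq> S" unfolding H_a[symmetric] by (rule set_H) (use S in auto)
  ultimately show ?thesis by auto
qed

lemma u_S: "u z \<in> S"
  using set_pre[of "Suc z"] by (simp add: pre_Suc)

text \<open>Every prefix lies inside some h^k(a), whose \<open>n\<close>-th image h^(n+k)(a) is
  again a prefix.\<close>

lemma H_pre: "H n (pre x) = pre (pos n x)"
proof -
  have x: "x \<le> len x" using len_gt[of x] by simp
  have "pre (len (n + x)) = H n (pre (len x))" by (simp only: H_a[symmetric] iter_add)
  also have "\<dots> = H n (pre x) @ H n (map u [x..<len x])" by (simp only: pre_append[OF x] iter_append)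
  finally have eq: "pre (len (n + x)) = H n (pre x) @ H n (map u [x..<len x])" .
  have le: "pos n x \<le> len (n + x)"
    using arg_cong[OF eq, of length] by (simp add: pos_def)
  have "H n (pre x) = take (pos n x) (pre (len (n + x)))" unfolding eq by (simp add: pos_def)
  also have "\<dots> = pre (pos n x)" unfolding pre_append[OF le] by simp
  finally show ?thesis .
qed

lemma pos_0_left [simp]: "pos 0 x = x"
  by (simp add: pos_def)

lemma pos_0_right [simp]: "pos n 0 = 0"
  by (simp add: pos_def pre_def)

lemma pos_Suc: "pos n (Suc x) = pos n x + length (H n [u x])"
  by (simp add: pos_def pre_Suc iter_append)

lemma pos_diff: "x \<le> y \<Longrightarrow> pos n y = pos n x + length (H n (map u [x..<y]))"
  by (simp add: pos_def pre_append iter_append)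

lemma pos_mono: "x \<le> y \<Longrightarrow> pos n x \<le> pos n y"
  by (simp add: pos_diff)

lemma pos_len: "pos n (len k) = len (n + k)"
  by (simp only: pos_def H_a[symmetric] iter_add[symmetric]) (simp only: len_def)

lemma pos_1: "pos n 1 = len n"
proof -
  have "len 0 = 1" by (simp add: len_def)
  then show ?thesis using pos_len[of n 0] by simp
qed

lemma pos_add: "pos (m + n) x = pos m (pos n x)"
  by (simp only: pos_def[of "m + n"] iter_add H_pre[of n] pos_def[of m])

lemma u_pos:
  assumes "i < length (H n [u x])"
  shows "u (pos n x + i) = H n [u x] ! i"
proof -
  have "pre (pos n (Suc x)) = pre (pos n x) @ H n [u x]"
    unfolding H_pre[symmetric] pre_Suc iter_append ..
  then have "pre (pos n (Suc x)) ! (pos n x + i) = H n [u x] ! i"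
    by (simp add: nth_append)
  moreover have "pos n x + i < pos n (Suc x)" using assms by (simp add: pos_Suc)
  ultimately show ?thesis by simp
qed

text \<open>The index of the letter whose \<open>n\<close>-th image covers \<open>z\<close>. Taking
  the least candidate skips letters with empty image.\<close>

definition anc :: "nat \<Rightarrow> nat \<Rightarrow> nat" where
  "anc n z = (LEAST x. z < pos n (Suc x))"

lemma anc: "pos n (anc n z) \<le> z" "z < pos n (Suc (anc n z))"
proof -
  have "z < pos n (Suc (len z))"
    using pos_mono[of "len z" "Suc (len z)" n] len_gt[of "n + z"] by (simp add: pos_len)
  then show "z < pos n (Suc (anc n z))" unfolding anc_def by (rule LeastI)
  show "pos n (anc n z) \<le> z"
  proof (cases "anc n z")
    case (Suc x)
    then have "\<not> z < pos n (Suc x)" unfolding anc_def by (intro not_less_Least) simp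
    then show ?thesis using Suc by simp
  qed simp
qed

lemma anc_eqI:
  assumes "pos n x \<le> z" "z < pos n (Suc x)"
  shows "anc n z = x"
proof (rule ccontr)
  assume "anc n z \<noteq> x"
  then consider "Suc (anc n z) \<le> x" | "Suc x \<le> anc n z" by linarith
  then show False
  proof cases
    case 1
    then show ?thesis using pos_mono[OF 1, of n] anc(2)[of z n] assms by linarith
  next
    case 2
    then show ?thesis using pos_mono[OF 2, of n] anc(1)[of n z] assms by linarith
  qed
qed

lemma anc_mono: "z \<le> z' \<Longrightarrow> anc n z \<le> anc n z'"
  unfolding anc_def[of n z] by (rule Least_le) (use anc(2)[of z' n] in linarith)

lemma anc_eq_0: "z < n \<Longrightarrow> anc n z = 0"
  by (rule anc_eqI) (use len_gt[of n] pos_1[of n] in auto)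

section \<open>Good and bad letters, first and last marks in images\<close>

abbreviation good :: "nat \<Rightarrow> bool" where
  "good c \<equiv> set (h c) \<subseteq> C"

lemma good_iff: "n > 0 \<Longrightarrow> c \<in> S \<Longrightarrow> set (H n [c]) \<subseteq> C \<longleftrightarrow> good c"
  by (rule idem)

lemma good_list:
  assumes "n > 0" "set xs \<subseteq> S"
  shows "set (H n xs) \<subseteq> C \<longleftrightarrow> (\<forall>c\<in>set xs. good c)"
proof -
  have "set (H n xs) \<subseteq> C \<longleftrightarrow> (\<forall>c\<in>set xs. set (H n [c]) \<subseteq> C)"
    by (subst set_iter) blast
  also have "\<dots> \<longleftrightarrow> (\<forall>c\<in>set xs. good c)"
    using assms(2) by (intro ball_cong good_iff[OF assms(1)]) auto
  finally show ?thesis .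
qed

text \<open>Compare the criterion for the second iterate with that for the first. Consequently every
  bad letter has a bad letter in its image.\<close>

lemma good_image: "c \<in> S \<Longrightarrow> good c \<longleftrightarrow> (\<forall>d\<in>set (h c). good d)"
  using good_iff[of "Suc 1" c] good_list[of 1 "h c"] S(3)[of c] by (simp only: iter_Suc_singleton)

lemma ex_mark: "n > 0 \<Longrightarrow> c \<in> S \<Longrightarrow> \<not> good c \<Longrightarrow> \<exists>y\<in>set (H n [c]). y \<notin> C"
  using good_iff[of n c] by blast

text \<open>Meaningful for bad \<open>c\<close> and \<open>n > 0\<close>; otherwise the image may
  contain no mark and the offset is only a default.\<close>

definition loff :: "nat \<Rightarrow> nat \<Rightarrow> nat" where
  "loff n c = last_idx (\<lambda>d. d \<notin> C) (H n [c])"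

definition foff :: "nat \<Rightarrow> nat \<Rightarrow> nat" where
  "foff n c = first_idx (\<lambda>d. d \<notin> C) (H n [c])"

definition lam :: "nat \<Rightarrow> nat" where
  "lam c = last_idx (\<lambda>d. \<not> good d) (h c)"

definition fam :: "nat \<Rightarrow> nat" where
  "fam c = first_idx (\<lambda>d. \<not> good d) (h c)"

lemma lam:
  assumes "c \<in> S" "\<not> good c"
  shows "lam c < length (h c)" "\<not> good (h c ! lam c)" "h c ! lam c \<in> S"
    and "\<And>j. lam c < j \<Longrightarrow> j < length (h c) \<Longrightarrow> good (h c ! j)"
proof -
  have ex: "\<exists>d\<in>set (h c). \<not> good d" using good_image[OF assms(1)] assms(2) by blast
  note l = last_idx[OF ex, folded lam_def]
  show "lam c < length (h c)" "\<not> good (h c ! lam c)" using l by auto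
  then show "h c ! lam c \<in> S" using S(3)[OF assms(1)] nth_mem by blast
  show "good (h c ! j)" if "lam c < j" "j < length (h c)" for j using l(3)[OF that] by simp
qed

lemma fam:
  assumes "c \<in> S" "\<not> good c"
  shows "fam c < length (h c)" "\<not> good (h c ! fam c)" "h c ! fam c \<in> S"
    and "\<And>j. j < fam c \<Longrightarrow> good (h c ! j)"
proof -
  have ex: "\<exists>d\<in>set (h c). \<not> good d" using good_image[OF assms(1)] assms(2) by blast
  note l = first_idx[OF ex, folded fam_def]
  show "fam c < length (h c)" "\<not> good (h c ! fam c)" using l by auto
  then show "h c ! fam c \<in> S" using S(3)[OF assms(1)] nth_mem by blast
  show "good (h c ! j)" if "j < fam c" for j using l(3)[OF that] by simp
qed

text \<open>Everything behind the last bad letter of \<open>h c\<close> is good and yields no mark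
  after \<open>n > 0\<close> more steps. The case \<open>n = 0\<close> is excluded because a bad
  letter may be unmarked and a good one marked.\<close>

lemma loff_Suc:
  assumes c: "c \<in> S" "\<not> good c" and n: "n > 0"
  shows "loff (Suc n) c = length (H n (take (lam c) (h c))) + loff n (h c ! lam c)"
proof -
  note l = lam[OF c]
  have split: "h c = take (lam c) (h c) @ [h c ! lam c] @ drop (Suc (lam c)) (h c)"
    using l(1) by (simp add: id_take_nth_drop)
  have "good d" if "d \<in> set (drop (Suc (lam c)) (h c))" for d
  proof -
    obtain i where "i < length (h c) - Suc (lam c)" "d = h c ! (Suc (lam c) + i)"
      using \<open>d \<in> set (drop _ _)\<close> unfolding in_set_conv_nth by auto
    then show ?thesis using l(4)[of "Suc (lam c) + i"] by simp
  qed
  moreover have "set (drop (Suc (lam c)) (h c)) \<subseteq> S" using set_drop_subset S(3)[OF c(1)] by fast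
  ultimately have no: "\<not> (\<exists>y\<in>set (H n (drop (Suc (lam c)) (h c))). y \<notin> C)"
    using good_list[OF n] by blast
  have "loff (Suc n) c = last_idx (\<lambda>d. d \<notin> C)
      (H n (take (lam c) (h c)) @ (H n [h c ! lam c] @ H n (drop (Suc (lam c)) (h c))))"
    unfolding loff_def iter_Suc_singleton iter_append[symmetric] split[symmetric] ..
  also have "\<dots> = length (H n (take (lam c) (h c))) +
      last_idx (\<lambda>d. d \<notin> C) (H n [h c ! lam c] @ H n (drop (Suc (lam c)) (h c)))"
    by (rule last_idx_append1) (use ex_mark[OF n l(3,2)] in auto)
  finally show ?thesis by (simp only: last_idx_append2[OF no] loff_def)
qed

lemma foff_Suc:
  assumes c: "c \<in> S" "\<not> good c" and n: "n > 0"
  shows "foff (Suc n) c = length (H n (take (fam c) (h c))) + foff n (h c ! fam c)"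
proof -
  note l = fam[OF c]
  have split: "h c = take (fam c) (h c) @ [h c ! fam c] @ drop (Suc (fam c)) (h c)"
    using l(1) by (simp add: id_take_nth_drop)
  have "good d" if "d \<in> set (take (fam c) (h c))" for d
  proof -
    obtain i where "i < fam c" "d = h c ! i"
      using \<open>d \<in> set (take _ _)\<close> unfolding in_set_conv_nth by auto
    then show ?thesis using l(4)[of i] by simp
  qed
  moreover have "set (take (fam c) (h c)) \<subseteq> S" using set_take_subset S(3)[OF c(1)] by fast
  ultimately have no: "\<not> (\<exists>y\<in>set (H n (take (fam c) (h c))). y \<notin> C)"
    using good_list[OF n] by blast
  have "foff (Suc n) c = first_idx (\<lambda>d. d \<notin> C)
      (H n (take (fam c) (h c)) @ (H n [h c ! fam c] @ H n (drop (Suc (fam c)) (h c))))"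
    unfolding foff_def iter_Suc_singleton iter_append[symmetric] split[symmetric] ..
  also have "\<dots> = length (H n (take (fam c) (h c))) +
      first_idx (\<lambda>d. d \<notin> C) (H n [h c ! fam c] @ H n (drop (Suc (fam c)) (h c)))"
    by (rule first_idx_append2[OF no])
  finally show ?thesis
    unfolding foff_def using first_idx_append1[OF ex_mark[OF n l(3,2)]] by simp
qed

definition lpos :: "nat \<Rightarrow> nat \<Rightarrow> nat" where
  "lpos n x = pos n x + loff n (u x)"

definition fpos :: "nat \<Rightarrow> nat \<Rightarrow> nat" where
  "fpos n x = pos n x + foff n (u x)"

lemma lpos:
  assumes "n > 0" "\<not> good (u x)"
  shows "pos n x \<le> lpos n x" "lpos n x < pos n (Suc x)" "u (lpos n x) \<notin> C"
    and "\<And>z. lpos n x < z \<Longrightarrow> z < pos n (Suc x) \<Longrightarrow> u z \<in> C"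
proof -
  note l = last_idx[OF ex_mark[OF assms(1) u_S assms(2)], folded loff_def]
  show "pos n x \<le> lpos n x" "lpos n x < pos n (Suc x)" using l(1) by (auto simp: lpos_def pos_Suc)
  show "u (lpos n x) \<notin> C" using l(2) u_pos[OF l(1)] by (simp add: lpos_def)
  fix z assume z: "lpos n x < z" "z < pos n (Suc x)"
  define i where "i = z - pos n x"
  have i: "z = pos n x + i" "loff n (u x) < i" "i < length (H n [u x])"
    using z by (auto simp: i_def lpos_def pos_Suc)
  show "u z \<in> C" using l(3)[OF i(2,3)] u_pos[OF i(3)] i(1) by simp
qed

lemma fpos:
  assumes "n > 0" "\<not> good (u x)"
  shows "pos n x \<le> fpos n x" "fpos n x < pos n (Suc x)" "u (fpos n x) \<notin> C"
    and "\<And>z. pos n x \<le> z \<Longrightarrow> z < fpos n x \<Longrightarrow> u z \<in> C"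
proof -
  note l = first_idx[OF ex_mark[OF assms(1) u_S assms(2)], folded foff_def]
  show "pos n x \<le> fpos n x" "fpos n x < pos n (Suc x)" using l(1) by (auto simp: fpos_def pos_Suc)
  show "u (fpos n x) \<notin> C" using l(2) u_pos[OF l(1)] by (simp add: fpos_def)
  fix z assume z: "pos n x \<le> z" "z < fpos n x"
  define i where "i = z - pos n x"
  have i: "z = pos n x + i" "i < foff n (u x)" "i < length (H n [u x])"
    using z l(1) by (auto simp: i_def fpos_def)
  show "u z \<in> C" using l(3)[OF i(2)] u_pos[OF i(3)] i(1) by simp
qed

text \<open>With membership in \<open>C\<close> this is a boundary pair of the coded word; with
  \<open>good\<close> it is the same notion for ancestors. The parameter \<open>P\<close> lets gaps
  be carried up and down the levels.\<close>

definition gap :: "(nat \<Rightarrow> bool) \<Rightarrow> nat \<Rightarrow> nat \<Rightarrow> bool" where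
  "gap P x y \<longleftrightarrow> x < y \<and> \<not> P (u x) \<and> \<not> P (u y) \<and> (\<forall>z. x < z \<longrightarrow> z < y \<longrightarrow> P (u z))"

abbreviation mark_gap :: "nat \<Rightarrow> nat \<Rightarrow> bool" where
  "mark_gap \<equiv> gap (\<lambda>c. c \<in> C)"

text \<open>Between the last mark stemming from \<open>x\<close> and the first one stemming from
  \<open>y\<close> lie only images of good letters and the unmarked remainders of the two outer
  images.\<close>

lemma mark_gap_image:
  assumes "n > 0" "gap good x y"
  shows "mark_gap (lpos n x) (fpos n y)"
proof -
  have xy: "x < y" "\<not> good (u x)" "\<not> good (u y)" "\<And>z. x < z \<Longrightarrow> z < y \<Longrightarrow> good (u z)"
    using assms(2) by (auto simp: gap_def)
  note lx = lpos[OF assms(1) xy(2)] and fy = fpos[OF assms(1) xy(3)]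
  have m: "pos n (Suc x) \<le> pos n y" using xy(1) by (intro pos_mono) simp
  have "u z \<in> C" if z: "lpos n x < z" "z < fpos n y" for z
  proof -
    note az = anc[where n = n and z = z]
    have "x \<le> anc n z"
      by (rule ccontr) (use pos_mono[of "Suc (anc n z)" x n] az(2) lx(1) z(1) in linarith)
    moreover have "anc n z \<le> y"
      by (rule ccontr) (use pos_mono[of "Suc y" "anc n z" n] az(1) fy(2) z(2) in linarith)
    ultimately consider "anc n z = x" | "anc n z = y" | "x < anc n z" "anc n z < y" by linarith
    then show ?thesis
    proof cases
      case 1
      then show ?thesis using lx(4)[OF z(1)] az(2) by simp
    next
      case 2
      then show ?thesis using fy(4)[OF _ z(2)] az(1) by simp
    next
      case 3
      then have "set (H n [u (anc n z)]) \<subseteq> C" using good_iff[OF assms(1) u_S] xy(4) by blast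
      moreover define i where "i = z - pos n (anc n z)"
      have i: "z = pos n (anc n z) + i" "i < length (H n [u (anc n z)])"
        using az by (auto simp: i_def pos_Suc)
      ultimately show ?thesis using u_pos[OF i(2)] i nth_mem[OF i(2)] by auto
    qed
  qed
  then show ?thesis using lx fy m by (auto simp: gap_def)
qed

lemma bad_anc:
  assumes "n > 0" "u z \<notin> C"
  shows "\<not> good (u (anc n z))"
proof
  assume "good (u (anc n z))"
  then have "set (H n [u (anc n z)]) \<subseteq> C" using good_iff[OF assms(1) u_S] by blast
  moreover define i where "i = z - pos n (anc n z)"
  have i: "z = pos n (anc n z) + i" "i < length (H n [u (anc n z)])"
    using anc[where n = n and z = z] by (auto simp: i_def pos_Suc)
  have "u z \<in> set (H n [u (anc n z)])"
    using nth_mem[OF i(2)] u_pos[OF i(2)] unfolding i(1)[symmetric] by simp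
  ultimately show False using assms(2) by blast
qed

text \<open>The converse of \<open>mark_gap_image\<close> when the ancestors of the two ends differ:
  the image of any letter strictly between them lies inside the gap, so that letter is good.\<close>

lemma gap_anc:
  assumes n: "n > 0" and g: "mark_gap x y" and less: "anc n x < anc n y"
  shows "gap good (anc n x) (anc n y)" "x = lpos n (anc n x)" "y = fpos n (anc n y)"
proof -
  have xy: "x < y" "u x \<notin> C" "u y \<notin> C" "\<And>z. x < z \<Longrightarrow> z < y \<Longrightarrow> u z \<in> C"
    using g by (auto simp: gap_def)
  have bad: "\<not> good (u (anc n x))" "\<not> good (u (anc n y))" using bad_anc[OF n] xy by auto
  have "good (u z)" if z: "anc n x < z" "z < anc n y" for z
  proof -
    have le: "x < pos n z" "pos n (Suc z) \<le> y"
      using pos_mono[of "Suc (anc n x)" z n] pos_mono[of "Suc z" "anc n y" n] z anc[where n = n and z = x] anc[where n = n and z = y]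
      by linarith+
    have "set (H n [u z]) \<subseteq> C"
    proof
      fix d assume "d \<in> set (H n [u z])"
      then obtain i where i: "i < length (H n [u z])" "d = H n [u z] ! i" by (auto simp: in_set_conv_nth)
      have "u (pos n z + i) \<in> C" using le i(1) by (intro xy(4)) (auto simp: pos_Suc)
      then show "d \<in> C" using u_pos[OF i(1)] i(2) by simp
    qed
    then show ?thesis using good_iff[OF n u_S] by blast
  qed
  then show gg: "gap good (anc n x) (anc n y)" using less bad by (auto simp: gap_def)
  note lx = lpos[OF n bad(1)] and fy = fpos[OF n bad(2)]
  have m: "pos n (Suc (anc n x)) \<le> pos n (anc n y)" using less by (intro pos_mono) simp
  show "x = lpos n (anc n x)"
  proof (rule linorder_cases[of x "lpos n (anc n x)"])
    assume "x < lpos n (anc n x)"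
    moreover have "lpos n (anc n x) < y" using lx(2) m anc(1)[of n y] by linarith
    ultimately show ?thesis using xy(4) lx(3) by blast
  next
    assume "lpos n (anc n x) < x"
    then show ?thesis using lx(4)[of x] anc(2)[of x n] xy(2) by blast
  qed
  show "y = fpos n (anc n y)"
  proof (rule linorder_cases[of y "fpos n (anc n y)"])
    assume "y < fpos n (anc n y)"
    then show ?thesis using fy(4)[of y] anc(1)[of n y] xy(3) by blast
  next
    assume "fpos n (anc n y) < y"
    moreover have "x < fpos n (anc n y)" using fy(1) m anc(2)[of x n] by linarith
    ultimately show ?thesis using xy(4) fy(3) by blast
  qed
qed

text \<open>The gaps between neighbouring bad letters inside the image of one letter, taken at the
  first occurrence of that letter: all long gaps between marks are images of translates of these.\<close>

definition seeds :: "(nat \<times> nat) set" where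
  "seeds = {(x, y). gap good x y \<and>
     (\<exists>q. pos 1 q \<le> x \<and> y < pos 1 (Suc q) \<and> (\<forall>q'<q. u q' \<noteq> u q))}"

text \<open>A first occurrence is determined by its letter, so only finitely many \<open>q\<close>
  arise, each with an image of finite length.\<close>

lemma finite_seeds: "finite seeds"
proof -
  define Q where "Q = {q. \<forall>q'<q. u q' \<noteq> u q}"
  have "inj_on u Q"
  proof (rule inj_onI)
    fix x y assume "x \<in> Q" "y \<in> Q" "u x = u y"
    then have "\<not> x < y" "\<not> y < x" unfolding Q_def by (fastforce, fastforce)
    then show "x = y" by simp
  qed
  moreover have "finite (u ` Q)" by (rule finite_subset[OF _ S(1)]) (use u_S in auto)
  ultimately have "finite Q" by (rule finite_imageD[rotated])
  moreover have "seeds \<subseteq> (\<Union>q\<in>Q. {..<pos 1 (Suc q)} \<times> {..<pos 1 (Suc q)})"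
    by (auto simp: seeds_def Q_def gap_def)
  moreover have "finite (\<Union>q\<in>Q. {..<pos 1 (Suc q)} \<times> {..<pos 1 (Suc q)})"
    using \<open>finite Q\<close> by blast
  ultimately show ?thesis using finite_subset by blast
qed

text \<open>Trace both ends back to the last level \<open>n\<close> at which their ancestors differ.
  One level higher they share the ancestor \<open>q\<close>, so the gap comes from two bad letters
  inside \<open>h (u q)\<close>; for \<open>n = 0\<close> the gap itself lies in such an image.
  Moving to the first occurrence \<open>q0\<close> of the letter keeps the length and never
  increases the left end.\<close>

lemma mark_gap_cover:
  assumes g: "mark_gap x y" and B: "\<And>c. c \<in> S \<Longrightarrow> length (h c) \<le> B"
  shows "y - x \<le> B \<or> (\<exists>n>0. \<exists>(x0, y0)\<in>seeds. y - x = fpos n y0 - lpos n x0 \<and> lpos n x0 \<le> x)"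
proof -
  have xy: "x < y" using g by (simp add: gap_def)
  define n where "n = (GREATEST n. anc n x < anc n y)"
  have a0: "anc 0 z = z" for z by (rule anc_eqI) auto
  \<comment> \<open>Above level \<open>y\<close> both ends descend from position 0, so a greatest
    level with different ancestors exists.\<close>
  have bnd: "n \<le> y" if "anc n x < anc n y" for n
  proof (rule ccontr)
    assume "\<not> n \<le> y"
    then show False using that xy anc_eq_0[of y n] by simp
  qed
  have n: "anc n x < anc n y" unfolding n_def
    by (rule GreatestI_nat[of _ 0 y]) (use a0 xy bnd in auto)
  have "\<not> anc (Suc n) x < anc (Suc n) y"
  proof
    assume "anc (Suc n) x < anc (Suc n) y"
    then have "Suc n \<le> n" unfolding n_def by (rule Greatest_le_nat[of _ _ y]) (use bnd in auto)
    then show False by simp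
  qed
  then have eq: "anc (Suc n) y = anc (Suc n) x" using anc_mono[of x y "Suc n"] xy by simp
  define q where "q = anc (Suc n) x"
  define x' where "x' = anc n x"
  define y' where "y' = anc n y"
  have pos_S: "pos (Suc n) z = pos n (pos 1 z)" for z using pos_add[of n 1 z] by simp
  have qx: "pos 1 q \<le> x'"
  proof (rule ccontr)
    assume "\<not> pos 1 q \<le> x'"
    then have "pos n (Suc x') \<le> pos n (pos 1 q)" by (intro pos_mono) simp
    then show False using anc(2)[of x n] anc(1)[of "Suc n" x] pos_S by (simp add: x'_def q_def)
  qed
  have qy: "y' < pos 1 (Suc q)"
  proof (rule ccontr)
    assume "\<not> y' < pos 1 (Suc q)"
    then have "pos n (pos 1 (Suc q)) \<le> pos n y'" by (intro pos_mono) simp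
    then show False using anc(1)[of n y] anc(2)[of y "Suc n"] pos_S eq by (simp add: y'_def q_def)
  qed
  have lenq: "pos 1 (Suc q) = pos 1 q + length (h (u q))" using pos_Suc[of 1 q] by (simp only: iter_1)
  show ?thesis
  proof (cases "n = 0")
    case True
    then have "y - x \<le> length (h (u q))" using qx qy lenq a0 by (simp add: x'_def y'_def)
    then show ?thesis using B[OF u_S[of q]] by simp
  next
    case False
    then have n0: "n > 0" by simp
    note ga = gap_anc[OF n0 g n, folded x'_def y'_def]
    define q0 where "q0 = (LEAST q'. u q' = u q)"
    have q0: "u q0 = u q" unfolding q0_def by (rule LeastI) simp
    have q0_min: "\<forall>q'<q0. u q' \<noteq> u q0"
      unfolding q0 unfolding q0_def using not_less_Least by blast
    have q0_le: "q0 \<le> q" unfolding q0_def by (rule Least_le) simp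
    define x0 where "x0 = pos 1 q0 + (x' - pos 1 q)"
    define y0 where "y0 = pos 1 q0 + (y' - pos 1 q)"
    have shift: "u (pos 1 q0 + i) = u (pos 1 q + i)" if "i < length (h (u q))" for i
      using u_pos[of i 1 q0] u_pos[of i 1 q] that q0 by (simp only: iter_1)
    have x'y': "x' < y'" using ga(1) by (simp add: gap_def)
    have ux: "u (z - pos 1 q + pos 1 q0) = u z" if "x' \<le> z" "z \<le> y'" for z
      using shift[of "z - pos 1 q"] that qx qy lenq by (simp add: add.commute)
    have gap0: "gap good x0 y0"
      unfolding gap_def
    proof (intro conjI allI impI)
      show "x0 < y0" using x'y' qx by (simp add: x0_def y0_def)
      show "\<not> good (u x0)" "\<not> good (u y0)"
        using ux[of x'] ux[of y'] x'y' ga(1) by (simp_all add: x0_def y0_def gap_def add.commute)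
      fix z assume z: "x0 < z" "z < y0"
      define z' where "z' = z - pos 1 q0 + pos 1 q"
      have z': "x' < z'" "z' < y'" "z = z' - pos 1 q + pos 1 q0"
        using z qx x'y' by (auto simp: z'_def x0_def y0_def)
      then have "good (u z')" using ga(1) by (simp add: gap_def)
      moreover have "u z = u z'" using ux[of z'] z' by simp
      ultimately show "good (u z)" by simp
    qed
    have "pos 1 (Suc q0) = pos 1 q0 + length (h (u q))" using pos_Suc[of 1 q0] by (simp only: iter_1 q0)
    then have "(x0, y0) \<in> seeds"
      unfolding seeds_def using gap0 q0_min qx qy lenq x'y'
      by (auto simp: x0_def y0_def intro!: exI[of _ q0])
    moreover have "y - x = fpos n y0 - lpos n x0 \<and> lpos n x0 \<le> x"
    proof -
      have ux0: "u x0 = u x'" "u y0 = u y'"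
        using ux[of x'] ux[of y'] x'y' by (simp_all add: x0_def y0_def add.commute)
      have "map u [x0..<y0] = map u [x'..<y']"
      proof (rule nth_equalityI)
        fix i assume "i < length (map u [x0..<y0])"
        then have i: "i < y0 - x0" by simp
        then have "x' + i - pos 1 q + pos 1 q0 = x0 + i" "x' + i \<le> y'" "i < y' - x'"
          using qx x'y' by (auto simp: x0_def y0_def)
        then show "map u [x0..<y0] ! i = map u [x'..<y'] ! i"
          using ux[of "x' + i"] i by simp
      qed (use qx x'y' in \<open>simp add: x0_def y0_def\<close>)
      then have "pos n y0 - pos n x0 = pos n y' - pos n x'" "pos n x0 \<le> pos n y0" "pos n x' \<le> pos n y'"
        using pos_diff[of x0 y0 n] pos_diff[of x' y' n] gap0 x'y' by (auto simp: gap_def)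
      moreover have "lpos n x0 < fpos n y0"
        using mark_gap_image[OF n0 gap0] by (simp add: gap_def)
      moreover have "x0 \<le> x'" using pos_mono[OF q0_le, of 1] qx by (simp add: x0_def)
      then have "pos n x0 \<le> pos n x'" by (rule pos_mono)
      ultimately show ?thesis
        using ga(2,3) xy by (simp add: lpos_def fpos_def ux0)
    qed
    ultimately show ?thesis using n0 by blast
  qed
qed

end

section \<open>Growth of the gaps\<close>

text \<open>Unrolling along the orbit of \<open>b\<close> gives partial sums of a series dominated
  by a geometric one, plus a remainder of order m^(-n), since \<open>s\<close> and
  \<open>y 1\<close> are bounded on the finite \<open>T\<close>.\<close>

lemma geometric_recurrence_convergent:
  fixes y :: "nat \<Rightarrow> 'b \<Rightarrow> real"
  assumes m: "m > (1::real)" and fin: "finite T" and F: "\<And>b. b \<in> T \<Longrightarrow> F b \<in> T"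
    and rec: "\<And>n b. n > 0 \<Longrightarrow> b \<in> T \<Longrightarrow> y (Suc n) b = m ^ n * s b + y n (F b)"
    and b: "b \<in> T"
  shows "convergent (\<lambda>n. y n b / m ^ n)"
proof -
  have orbit: "(F ^^ k) b \<in> T" if "b \<in> T" for k b
    using that F by (induction k) auto
  have expand: "y (Suc n) b / m ^ Suc n = (\<Sum>k<n. s ((F ^^ k) b) / m ^ Suc k) + y 1 ((F ^^ n) b) / m ^ Suc n"
    if "b \<in> T" for n b
    using that
  proof (induction n arbitrary: b)
    case (Suc n)
    have "y (Suc (Suc n)) b / m ^ Suc (Suc n) = s b / m + (y (Suc n) (F b) / m ^ Suc n) / m"
      using rec[of "Suc n" b] Suc.prems m by (simp add: field_simps)
    also have "\<dots> = s b / m + ((\<Sum>k<n. s ((F ^^ k) (F b)) / m ^ Suc k) + y 1 ((F ^^ n) (F b)) / m ^ Suc n) / m"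
      by (simp only: Suc.IH[OF F[OF Suc.prems]])
    also have "\<dots> = (\<Sum>k<Suc n. s ((F ^^ k) b) / m ^ Suc k) + y 1 ((F ^^ Suc n) b) / m ^ Suc (Suc n)"
      using m by (simp add: sum.lessThan_Suc_shift funpow_swap1 add_divide_distrib sum_divide_distrib
          del: sum.lessThan_Suc) (simp add: mult_ac)
    finally show ?case .
  qed simp
  define K where "K = (\<Sum>b\<in>T. \<bar>s b\<bar> + \<bar>y 1 b\<bar>)"
  have K: "\<bar>s b\<bar> \<le> K" "\<bar>y 1 b\<bar> \<le> K" if "b \<in> T" for b
    using member_le_sum[of b T "\<lambda>b. \<bar>s b\<bar> + \<bar>y 1 b\<bar>"] that fin by (auto simp: K_def)
  have geo: "summable (\<lambda>k. K * (1 / m) ^ Suc k)"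
    using m by (intro summable_mult) (subst summable_Suc_iff, auto intro!: summable_geometric)
  have bound: "\<bar>x / m ^ Suc k\<bar> \<le> K * (1 / m) ^ Suc k" if "\<bar>x\<bar> \<le> K" for x k
    using that m by (simp add: abs_divide power_divide divide_right_mono)
  have "summable (\<lambda>k. s ((F ^^ k) b) / m ^ Suc k)"
    by (rule summable_comparison_test'[OF geo, of 0]) (unfold real_norm_def, intro bound K orbit b)
  then have "(\<lambda>n. \<Sum>k<n. s ((F ^^ k) b) / m ^ Suc k) \<longlonglongrightarrow> (\<Sum>k. s ((F ^^ k) b) / m ^ Suc k)"
    by (rule summable_LIMSEQ)
  moreover have "(\<lambda>n. y 1 ((F ^^ n) b) / m ^ Suc n) \<longlonglongrightarrow> 0"
    by (rule Lim_null_comparison[OF _ summable_LIMSEQ_zero[OF geo]])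
       (intro always_eventually allI, unfold real_norm_def, intro bound K orbit b)
  ultimately have "(\<lambda>n. y (Suc n) b / m ^ Suc n) \<longlonglongrightarrow> (\<Sum>k. s ((F ^^ k) b) / m ^ Suc k) + 0"
    unfolding expand[OF b] by (rule tendsto_add)
  then have "convergent (\<lambda>n. y (Suc n) b / m ^ Suc n)" by (auto simp: convergent_def)
  then show ?thesis by (subst (asm) convergent_Suc_iff)
qed

text \<open>The limits satisfy \<open>L b = s b / m + L (F b) / m\<close>. The orbit of
  \<open>b\<close> enters a cycle, and around a cycle of length \<open>q\<close> this reads
  \<open>L c = r + L c / m ^ q\<close> with rational \<open>r\<close>, which determines
  \<open>L c\<close>.\<close>

lemma geometric_recurrence_rational_limit:
  fixes y :: "nat \<Rightarrow> 'b \<Rightarrow> real"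
  assumes m: "m > (1::real)" "m \<in> \<rat>" and fin: "finite T" and F: "\<And>b. b \<in> T \<Longrightarrow> F b \<in> T"
    and s: "\<And>b. b \<in> T \<Longrightarrow> s b \<in> \<rat>"
    and rec: "\<And>n b. n > 0 \<Longrightarrow> b \<in> T \<Longrightarrow> y (Suc n) b = m ^ n * s b + y n (F b)"
    and b: "b \<in> T"
  shows "\<exists>l\<in>\<rat>. (\<lambda>n. y n b / m ^ n) \<longlonglongrightarrow> l"
proof -
  define L where "L = (\<lambda>b. lim (\<lambda>n. y n b / m ^ n))"
  have lim: "(\<lambda>n. y n b / m ^ n) \<longlonglongrightarrow> L b" if "b \<in> T" for b
    unfolding L_def using geometric_recurrence_convergent[where y = y and F = F and s = s, OF m(1) fin F rec that]
    by (simp only: convergent_LIMSEQ_iff)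
  have step: "L b = s b / m + L (F b) / m" if "b \<in> T" for b
  proof (rule LIMSEQ_unique)
    show "(\<lambda>n. y (Suc n) b / m ^ Suc n) \<longlonglongrightarrow> L b" using lim[OF that] by (rule LIMSEQ_Suc)
    have "(\<lambda>n. s b / m + (y n (F b) / m ^ n) / m) \<longlonglongrightarrow> s b / m + L (F b) / m"
      using m by (intro tendsto_intros lim F that) auto
    moreover have "\<forall>\<^sub>F n in sequentially. s b / m + (y n (F b) / m ^ n) / m = y (Suc n) b / m ^ Suc n"
      using eventually_gt_at_top[of 0]
    proof eventually_elim
      case (elim n)
      show ?case using rec[OF elim that] m by (simp add: field_simps)
    qed
    ultimately show "(\<lambda>n. y (Suc n) b / m ^ Suc n) \<longlonglongrightarrow> s b / m + L (F b) / m"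
      by (rule Lim_transform_eventually)
  qed
  have orbit: "(F ^^ k) b \<in> T" if "b \<in> T" for k b
    using that F by (induction k) auto
  have steps: "\<exists>r\<in>\<rat>. L b = r + L ((F ^^ k) b) / m ^ k" if "b \<in> T" for k b
  proof (induction k)
    case (Suc k)
    then obtain r where r: "r \<in> \<rat>" "L b = r + L ((F ^^ k) b) / m ^ k" by blast
    define c where "c = (F ^^ k) b"
    have c: "c \<in> T" using orbit that by (simp add: c_def)
    have "L b = (r + s c / m / m ^ k) + L ((F ^^ Suc k) b) / m ^ Suc k"
      using r(2) step[OF c] by (simp add: c_def add_divide_distrib mult.commute)
    moreover have "r + s c / m / m ^ k \<in> \<rat>" using r(1) s[OF c] m(2) by auto
    ultimately show ?case by blast
  qed (auto intro: bexI[of _ 0])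
  have "\<not> inj_on (\<lambda>k. (F ^^ k) b) UNIV"
    using finite_imageD[of "\<lambda>k. (F ^^ k) b" UNIV] finite_subset[OF _ fin, of "range (\<lambda>k. (F ^^ k) b)"]
      orbit[OF b] by auto
  then obtain i' j' where "i' \<noteq> j'" "(F ^^ i') b = (F ^^ j') b" unfolding inj_on_def by blast
  then obtain i j where ij: "i < j" "(F ^^ i) b = (F ^^ j) b"
    by (cases i' j' rule: linorder_cases) auto
  define c where "c = (F ^^ i) b"
  define q where "q = j - i"
  have q: "q > 0" "(F ^^ q) c = c"
  proof -
    have "(F ^^ q) c = (F ^^ (q + i)) b" by (simp add: c_def funpow_add)
    then show "(F ^^ q) c = c" using ij by (simp add: q_def c_def)
  qed (use ij in \<open>simp add: q_def\<close>)
  have c: "c \<in> T" unfolding c_def by (rule orbit[OF b])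
  obtain r where r: "r \<in> \<rat>" "L c = r + L ((F ^^ q) c) / m ^ q" using steps[OF c] by blast
  have mq: "m ^ q > 1" using m(1) q(1) by (simp add: one_less_power)
  have "x = r * M / (M - 1)" if "x = r + x / M" "M > 1" for x M :: real
    using that by (simp add: field_simps)
  then have "L c = r * m ^ q / (m ^ q - 1)" using r(2)[unfolded q(2)] mq by blast
  then have "L c \<in> \<rat>" using r(1) m(2) by auto
  moreover obtain r' where "r' \<in> \<rat>" "L b = r' + L c / m ^ i" using steps[OF b, of i] unfolding c_def by blast
  ultimately have "L b \<in> \<rat>" using m(2) by auto
  then show ?thesis using lim[OF b] by blast
qed

section \<open>Linear systems for lengths and offsets\<close>

definition nat_series :: "(nat \<Rightarrow> nat) \<Rightarrow> complex fps" where
  "nat_series f = Abs_fps (\<lambda>n. of_real (real (f n)))"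

lemma nat_series_add: "nat_series (\<lambda>n. f n + g n) = nat_series f + nat_series g"
  by (simp add: nat_series_def fps_eq_iff)

lemma nat_series_sum_list: "nat_series (\<lambda>n. \<Sum>c\<leftarrow>xs. f c n) = (\<Sum>c\<leftarrow>xs. nat_series (f c))"
  by (induction xs) (simp_all add: nat_series_add, simp add: nat_series_def fps_eq_iff)

lemma nat_series_shift: "nat_series f = of_nat (f 0) + fps_X * nat_series (\<lambda>n. f (Suc n))"
proof (rule fps_ext)
  fix n
  show "fps_nth (nat_series f) n = fps_nth (of_nat (f 0) + fps_X * nat_series (\<lambda>n. f (Suc n))) n"
    by (cases n) (simp_all add: nat_series_def fps_of_nat[symmetric])
qed

lemma sum_list_eq_sum_count:
  fixes f :: "'b \<Rightarrow> 'c::comm_semiring_1"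
  assumes "finite I" "set xs \<subseteq> I"
  shows "(\<Sum>x\<leftarrow>xs. f x) = (\<Sum>i\<in>I. of_nat (count_list xs i) * f i)"
  using assms(2)
proof (induction xs)
  case (Cons x xs)
  have "(\<Sum>i\<in>I. of_nat (count_list (x # xs) i) * f i)
      = (\<Sum>i\<in>I. (if i = x then f x else 0) + of_nat (count_list xs i) * f i)"
    by (intro sum.cong) (auto simp: algebra_simps)
  also have "\<dots> = f x + (\<Sum>i\<in>I. of_nat (count_list xs i) * f i)"
    using Cons.prems assms(1) by (simp add: sum.distrib)
  finally show ?case using Cons by simp
qed simp

context marked_fixpoint
begin

text \<open>The system is X times the incidence matrix of \<open>h\<close>. Indices are shifted by 2
  throughout because the offset recurrences need a positive index and the lower bound
  \<open>len_le_lpos\<close> starts at index 2.\<close>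

lemma berstel_length:
  assumes "c \<in> S"
  shows "berstel_series (nat_series (\<lambda>n. length (H (n + 2) [c])))"
proof (rule berstel_linear_system[OF S(1) _ _ _ _ assms])
  fix c assume c: "c \<in> S"
  have "nat_series (\<lambda>n. length (H (n + 2) [c])) =
      of_nat (length (H 2 [c])) + fps_X * nat_series (\<lambda>n. length (H (Suc (n + 2)) [c]))"
    by (subst nat_series_shift) (simp only: add_0 add_Suc)
  also have "nat_series (\<lambda>n. length (H (Suc (n + 2)) [c]))
      = (\<Sum>d\<leftarrow>h c. nat_series (\<lambda>n. length (H (n + 2) [d])))"
    unfolding iter_Suc_singleton nat_series_sum_list[symmetric] by (subst length_iter) simp
  also have "\<dots> = (\<Sum>d\<in>S. of_nat (count_list (h c) d) * nat_series (\<lambda>n. length (H (n + 2) [d])))"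
    by (rule sum_list_eq_sum_count[OF S(1) S(3)[OF c]])
  finally show "nat_series (\<lambda>n. length (H (n + 2) [c])) = of_nat (length (H 2 [c])) +
      (\<Sum>d\<in>S. fps_X * of_nat (count_list (h c) d) * nat_series (\<lambda>n. length (H (n + 2) [d])))"
    by (simp only: sum_distrib_left mult.assoc)
qed (auto intro: berstel_mult berstel_X berstel_of_nat)

lemma berstel_length_list:
  assumes "set xs \<subseteq> S"
  shows "berstel_series (nat_series (\<lambda>n. length (H (n + 2) xs)))"
proof -
  have "nat_series (\<lambda>n. length (H (n + 2) xs)) = (\<Sum>c\<leftarrow>xs. nat_series (\<lambda>n. length (H (n + 2) [c])))"
    unfolding nat_series_sum_list[symmetric] by (subst length_iter) simp
  moreover have "berstel_series \<dots>"
    by (rule berstel_sum_list) (use assms berstel_length in auto)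
  ultimately show ?thesis by simp
qed

text \<open>Both \<open>loff\<close> and \<open>foff\<close> satisfy a recurrence of this shape.\<close>

lemma berstel_offset:
  assumes rec: "\<And>n c. n > 0 \<Longrightarrow> c \<in> S \<Longrightarrow> \<not> good c \<Longrightarrow>
      off (Suc n) c = length (H n (take (l c) (h c))) + off n (h c ! l c)"
    and l: "\<And>c. c \<in> S \<Longrightarrow> \<not> good c \<Longrightarrow> h c ! l c \<in> S" "\<And>c. c \<in> S \<Longrightarrow> \<not> good c \<Longrightarrow> \<not> good (h c ! l c)"
    and c: "c \<in> S" "\<not> good c"
  shows "berstel_series (nat_series (\<lambda>n. off (n + 2) c))"
proof (rule berstel_linear_system[where I = "{c \<in> S. \<not> good c}"
      and A = "\<lambda>c. of_nat (off 2 c) + fps_X * nat_series (\<lambda>n. length (H (n + 2) (take (l c) (h c))))"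
      and B = "\<lambda>c d. if d = h c ! l c then fps_X else 0"])
  fix c assume c: "c \<in> {c \<in> S. \<not> good c}"
  have "nat_series (\<lambda>n. off (n + 2) c) = of_nat (off 2 c) + fps_X * nat_series (\<lambda>n. off (Suc (n + 2)) c)"
    by (subst nat_series_shift) (simp only: add_0 add_Suc)
  also have "(\<lambda>n. off (Suc (n + 2)) c) = (\<lambda>n. length (H (n + 2) (take (l c) (h c))) + off (n + 2) (h c ! l c))"
    by (rule ext, rule rec) (use c in auto)
  also have "fps_X * nat_series \<dots> = fps_X * nat_series (\<lambda>n. length (H (n + 2) (take (l c) (h c)))) +
      fps_X * nat_series (\<lambda>n. off (n + 2) (h c ! l c))"
    by (simp only: nat_series_add distrib_left)
  also have "fps_X * nat_series (\<lambda>n. off (n + 2) (h c ! l c)) =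
      (\<Sum>d\<in>{c \<in> S. \<not> good c}. if d = h c ! l c then fps_X * nat_series (\<lambda>n. off (n + 2) d) else 0)"
    by (subst sum.delta) (use S(1) l c in auto)
  also have "\<dots> = (\<Sum>d\<in>{c \<in> S. \<not> good c}. (if d = h c ! l c then fps_X else 0) * nat_series (\<lambda>n. off (n + 2) d))"
    by (intro sum.cong) auto
  finally show "nat_series (\<lambda>n. off (n + 2) c) =
      of_nat (off 2 c) + fps_X * nat_series (\<lambda>n. length (H (n + 2) (take (l c) (h c)))) +
      (\<Sum>d\<in>{c \<in> S. \<not> good c}. (if d = h c ! l c then fps_X else 0) * nat_series (\<lambda>n. off (n + 2) d))"
    by (simp only: add.assoc)
  have "set (take (l c) (h c)) \<subseteq> S" using set_take_subset S(3)[of c] c by fast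
  then show "berstel_series (of_nat (off 2 c) + fps_X * nat_series (\<lambda>n. length (H (n + 2) (take (l c) (h c)))))"
    by (intro berstel_add berstel_of_nat berstel_mult berstel_X berstel_length_list)
qed (use S(1) c in \<open>auto intro: berstel_X berstel_0\<close>)

lemma berstel_lpos: "\<not> good (u x) \<Longrightarrow> berstel_series (nat_series (\<lambda>n. lpos (n + 2) x))"
  unfolding lpos_def pos_def nat_series_add
  by (intro berstel_add berstel_length_list set_pre berstel_offset[where off = loff and l = lam, OF loff_Suc lam(3,2)] u_S)

lemma berstel_fpos: "\<not> good (u x) \<Longrightarrow> berstel_series (nat_series (\<lambda>n. fpos (n + 2) x))"
  unfolding fpos_def pos_def nat_series_add
  by (intro berstel_add berstel_length_list set_pre berstel_offset[where off = foff and l = fam, OF foff_Suc fam(3,2)] u_S)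

section \<open>Comparison of the gap ends with the length of the image of \<open>a\<close>\<close>

definition bnd :: nat where
  "bnd = Max (insert 1 ((\<lambda>c. length (h c)) ` S))"

lemma bnd: "1 \<le> bnd" "c \<in> S \<Longrightarrow> length (h c) \<le> bnd"
  using S(1) by (auto simp: bnd_def)

lemma length_H_le: "set xs \<subseteq> S \<Longrightarrow> length (H n xs) \<le> bnd ^ n * length xs"
proof (induction n arbitrary: xs)
  case (Suc n)
  have "set (morph_ext h xs) \<subseteq> S" using Suc.prems S(3) by (auto simp: morph_ext_def)
  then have "length (H (Suc n) xs) \<le> bnd ^ n * length (morph_ext h xs)"
    unfolding iter_Suc by (rule Suc.IH)
  also have "length (morph_ext h xs) \<le> bnd * length xs"
    using Suc.prems
  proof (induction xs)
    case (Cons x xs)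
    then show ?case using bnd(2)[of x] by (simp add: morph_ext_def)
  qed (simp add: morph_ext_def)
  finally show ?case by (simp add: mult_ac)
qed simp

lemma len_add_le: "len (n + k) \<le> bnd ^ k * len n"
proof -
  have "len (n + k) = length (H k (H n [a]))" by (simp only: len_def add.commute[of n] iter_add)
  then show ?thesis using length_H_le[of "H n [a]" k] set_H[of "[a]" n] S(2) by (simp add: len_def)
qed

text \<open>The fixed point is h(a) followed by the images h^n(tail) for n = 1, 2, and so on. If all
  letters of \<open>tail\<close> were good, no mark would occur from position \<open>len 1\<close>
  on.\<close>

lemma ex_bad_tail: "\<exists>c\<in>set tail. \<not> good c"
proof (rule ccontr)
  assume "\<not> (\<exists>c\<in>set tail. \<not> good c)"
  moreover have "set tail \<subseteq> S" using S(3)[OF S(2)] tail(1) by auto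
  ultimately have C: "set (H n tail) \<subseteq> C" if "n > 0" for n using good_list[OF that] by blast
  have "u z \<in> C" if z: "z \<ge> len 1" for z
  proof -
    define n where "n = (LEAST n. z < len (Suc n))"
    have "z < len (Suc z)" using len_gt[of "Suc z"] by simp
    then have n: "z < len (Suc n)" unfolding n_def by (rule LeastI)
    have "n > 0" using n z by (intro gr0I) auto
    then obtain k where k: "n = Suc k" by (cases n) auto
    have "\<not> z < len (Suc k)" by (rule not_less_Least) (use k n_def in auto)
    then have le: "len n \<le> z" by (simp add: k)
    have "u z = H (Suc n) [a] ! z" using n by (simp only: H_a nth_pre)
    also have "\<dots> = H n tail ! (z - len n)" using le by (simp add: H_Suc_a nth_append len_def del: funpow.simps)
    also have "\<dots> \<in> set (H n tail)"
      using n le by (intro nth_mem) (simp add: len_def[of "Suc n"] H_Suc_a len_def[of n, symmetric] del: funpow.simps)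
    finally show ?thesis using C[OF \<open>n > 0\<close>] by blast
  qed
  then have "{z. u z \<notin> C} \<subseteq> {..<len 1}" by (force simp: not_le[symmetric])
  then show False using infinite_marks finite_subset by blast
qed

text \<open>This keeps the denominators of the ratios of the order of \<open>len n\<close>. For
  positive \<open>x\<close> the whole image of the first letter lies to the left. For
  \<open>x = 0\<close> the last bad letter of \<open>h a\<close> lies in \<open>tail\<close>, so the
  image of the leading \<open>a\<close> precedes the mark.\<close>

lemma len_le_lpos:
  assumes n: "n > 0" and x: "\<not> good (u x)"
  shows "len n \<le> lpos (Suc n) x"
proof (cases "x = 0")
  case False
  have "len n \<le> len (Suc n)" by (rule len_mono) simp
  also have "\<dots> \<le> pos (Suc n) x" using pos_mono[of 1 x "Suc n"] False unfolding pos_1 by simp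
  finally show ?thesis by (simp add: lpos_def)
next
  case True
  have u0: "u 0 = a" using fixp[unfolded is_fixpoint_word_def, rule_format, where n = 0 and i = 0] by simp
  have a: "\<not> good a" using x True u0 by simp
  obtain j where j: "j < length tail" "\<not> good (tail ! j)"
    using ex_bad_tail by (metis in_set_conv_nth)
  have "\<not> lam a < Suc j" using lam(4)[OF S(2) a, of "Suc j"] j tail(1) by auto
  then obtain k where k: "lam a = Suc k" by (cases "lam a") auto
  have "take (lam a) (h a) = [a] @ take k tail" by (simp add: k tail(1))
  then have "length (H n (take (lam a) (h a))) \<ge> len n" by (simp only: iter_append len_def) simp
  then show ?thesis using loff_Suc[OF S(2) a n] by (simp add: lpos_def True u0)
qed

lemma fpos_le_len:
  assumes n: "n > 0" and y: "\<not> good (u y)"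
  shows "fpos n y \<le> bnd ^ y * len n"
proof -
  have "fpos n y \<le> pos n (Suc y)" using fpos(2)[OF n y] by simp
  also have "\<dots> \<le> pos n (len y)" using len_gt[of y] by (intro pos_mono) simp
  also have "\<dots> \<le> bnd ^ y * len n" unfolding pos_len by (rule len_add_le)
  finally show ?thesis .
qed

text \<open>Both ends lie between \<open>len (n + 1)\<close> and a constant multiple of it; all
  comparisons demanded by \<open>quotient_sections_algebraic\<close> are read off from this.\<close>

lemma gap_ratio_sections_algebraic:
  assumes g: "gap good x y"
  shows "\<exists>p>0. \<exists>v. \<forall>t<p. algebraic (v t) \<and>
    (\<lambda>m. real (fpos (p * m + t + 2) y) / real (lpos (p * m + t + 2) x)) \<longlonglongrightarrow> v t"
proof -
  have bad: "\<not> good (u x)" "\<not> good (u y)" using g by (auto simp: gap_def)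
  define f where "f = (\<lambda>n. lpos (n + 2) x)"
  define g' where "g' = (\<lambda>n. fpos (n + 2) y)"
  define L where "L = (\<lambda>n. len (n + 1))"
  have Lf: "L n \<le> f n" for n
    using len_le_lpos[of "n + 1" x] bad by (simp add: L_def f_def)
  have fg: "f n < g' n" for n
    using mark_gap_image[OF _ g, of "n + 2"] by (simp add: f_def g'_def gap_def)
  have L1: "L (Suc n) \<le> bnd * L n" for n
    using len_add_le[of "n + 1" 1] by (simp add: L_def)
  have L2: "L n \<le> L (Suc n)" for n unfolding L_def by (rule len_mono) simp
  have gL: "g' n \<le> bnd ^ Suc y * L n" for n
  proof -
    have "g' n \<le> bnd ^ y * L (Suc n)" using fpos_le_len[of "n + 2" y] bad by (simp add: g'_def L_def)
    also have "\<dots> \<le> bnd ^ y * (bnd * L n)" using L1 by (rule mult_le_mono2)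
    finally show ?thesis by (simp add: mult_ac)
  qed
  \<comment> \<open>\<open>Suc y\<close> factors \<open>bnd\<close> bound \<open>g'\<close> by
    \<open>L\<close>; one more pays for the step from \<open>L (Suc n)\<close> back to
    \<open>L n\<close> in \<open>f2\<close>.\<close>
  define c where "c = bnd ^ Suc (Suc y)"
  have c: "bnd ^ Suc y \<le> c" using bnd(1) by (simp add: c_def)
  have gf: "g' n \<le> c * f n" for n
    using gL[of n] mult_le_mono[OF c Lf[of n]] by linarith
  have f1: "f n \<le> c * f (Suc n)" for n
  proof -
    have "f n \<le> bnd ^ Suc y * L n" using fg[of n] gL[of n] by linarith
    also have "\<dots> \<le> c * f (Suc n)"
      using L2[of n] Lf[of "Suc n"] by (intro mult_le_mono c) linarith
    finally show ?thesis .
  qed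
  have f2: "f (Suc n) \<le> c * f n" for n
  proof -
    have "f (Suc n) \<le> bnd ^ Suc y * L (Suc n)" using fg[of "Suc n"] gL[of "Suc n"] by linarith
    also have "\<dots> \<le> bnd ^ Suc y * (bnd * f n)"
      using L1[of n] mult_le_mono2[OF Lf[of n], of bnd] by (intro mult_le_mono2) linarith
    also have "\<dots> = c * f n" by (simp add: c_def)
    finally show ?thesis .
  qed
  have fpos: "f n > 0" for n using Lf[of n] len_gt[of "n + 1"] by (simp add: L_def)
  have "\<exists>p>0. \<exists>v. \<forall>t<p. algebraic (v t) \<and> (\<lambda>m. real (g' (p * m + t)) / real (f (p * m + t))) \<longlonglongrightarrow> v t"
  proof (rule quotient_sections_algebraic[where C = "real c"])
    show "berstel_series (Abs_fps (\<lambda>n. complex_of_real (real (f n))))"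
      "berstel_series (Abs_fps (\<lambda>n. complex_of_real (real (g' n))))"
      using berstel_lpos[OF bad(1)] berstel_fpos[OF bad(2)] by (simp_all add: nat_series_def f_def g'_def)
  qed (use fpos in \<open>auto simp: f1 f2 gf simp flip: of_nat_mult\<close>)
  then show ?thesis by (simp add: f_def g'_def)
qed

lemma offset_uniform_limit:
  assumes unif: "\<And>c. c \<in> S \<Longrightarrow> length (h c) = m"
    and rec: "\<And>n c. n > 0 \<Longrightarrow> c \<in> S \<Longrightarrow> \<not> good c \<Longrightarrow>
      off (Suc n) c = length (H n (take (l c) (h c))) + off n (h c ! l c)"
    and l: "\<And>c. c \<in> S \<Longrightarrow> \<not> good c \<Longrightarrow> h c ! l c \<in> S" "\<And>c. c \<in> S \<Longrightarrow> \<not> good c \<Longrightarrow> \<not> good (h c ! l c)"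
    and c: "c \<in> S" "\<not> good c"
  shows "\<exists>q\<in>\<rat>. (\<lambda>n. real (off n c) / real m ^ n) \<longlonglongrightarrow> q"
proof (rule geometric_recurrence_rational_limit[where T = "{c \<in> S. \<not> good c}" and F = "\<lambda>c. h c ! l c"
      and s = "\<lambda>c. real (length (take (l c) (h c)))" and y = "\<lambda>n c. real (off n c)"])
  have "m \<ge> 2" using unif[OF S(2)] tail(1,2) by (cases tail) auto
  then show "1 < real m" by simp
  fix n :: nat and c assume n: "n > 0" and c: "c \<in> {c \<in> S. \<not> good c}"
  have "set (take (l c) (h c)) \<subseteq> S" using set_take_subset S(3)[of c] c by fast
  then have "length (H n (take (l c) (h c))) = m ^ n * length (take (l c) (h c))"
    by (intro length_iter_uniform[OF unif S(3)])
  then show "real (off (Suc n) c) = real m ^ n * real (length (take (l c) (h c))) + real (off n (h c ! l c))"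
    using rec[OF n, of c] c by simp
qed (use S(1) l c in auto)

text \<open>For uniform \<open>h\<close> the image of position \<open>z\<close> begins exactly at
  m^n z, so only the offsets need a limit, and one limit serves all residue classes.\<close>

lemma gap_ratio_rational:
  assumes g: "gap good x y" and unif: "\<And>c. c \<in> S \<Longrightarrow> length (h c) = m"
  shows "\<exists>q\<in>\<rat>. (\<lambda>n. real (fpos n y) / real (lpos n x)) \<longlonglongrightarrow> q"
proof -
  have bad: "\<not> good (u x)" "\<not> good (u y)" using g by (auto simp: gap_def)
  have m: "m \<ge> 2" using unif[OF S(2)] tail(1,2) by (cases tail) auto
  have pos: "real (pos n z) / real m ^ n = real z" for n z
  proof -
    have "pos n z = m ^ n * z"
      unfolding pos_def using length_iter_uniform[of S h m "pre z" n] unif S(3) set_pre by simp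
    then show ?thesis using m by simp
  qed
  obtain q1 where q1: "q1 \<in> \<rat>" "(\<lambda>n. real (loff n (u x)) / real m ^ n) \<longlonglongrightarrow> q1"
    using offset_uniform_limit[where off = loff and l = lam, OF unif loff_Suc lam(3,2) u_S bad(1)] by blast
  obtain q2 where q2: "q2 \<in> \<rat>" "(\<lambda>n. real (foff n (u y)) / real m ^ n) \<longlonglongrightarrow> q2"
    using offset_uniform_limit[where off = foff and l = fam, OF unif foff_Suc fam(3,2) u_S bad(2)] by blast
  have l1: "(\<lambda>n. real (lpos n x) / real m ^ n) \<longlonglongrightarrow> real x + q1"
    unfolding lpos_def of_nat_add add_divide_distrib pos by (intro tendsto_intros q1)
  have l2: "(\<lambda>n. real (fpos n y) / real m ^ n) \<longlonglongrightarrow> real y + q2"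
    unfolding fpos_def of_nat_add add_divide_distrib pos by (intro tendsto_intros q2)
  \<comment> \<open>The bound \<open>len_le_lpos\<close>, with \<open>len n\<close> equal to m^n,
    keeps the limit of the denominator away from 0.\<close>
  have "1 / real m \<le> real x + q1"
  proof (rule tendsto_lowerbound[OF LIMSEQ_Suc[OF l1]])
    show "\<forall>\<^sub>F n in sequentially. 1 / real m \<le> real (lpos (Suc n) x) / real m ^ Suc n"
      using eventually_gt_at_top[of 0]
    proof eventually_elim
      case (elim n)
      have "len n = m ^ n"
        unfolding len_def using length_iter_uniform[of S h m "[a]" n] unif S by simp
      then have "real m ^ n \<le> real (lpos (Suc n) x)"
        using len_le_lpos[OF elim bad(1)] by (metis of_nat_le_iff of_nat_power)
      then have "real m ^ n / real m ^ Suc n \<le> real (lpos (Suc n) x) / real m ^ Suc n"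
        by (rule divide_right_mono) simp
      then show ?case using m by simp
    qed
  qed simp
  moreover have "1 / real m > 0" using m by simp
  ultimately have nz: "real x + q1 \<noteq> 0" by linarith
  have "(\<lambda>n. (real (fpos n y) / real m ^ n) / (real (lpos n x) / real m ^ n))
      \<longlonglongrightarrow> (real y + q2) / (real x + q1)"
    by (intro tendsto_divide l1 l2 nz)
  moreover have "(real (fpos n y) / real m ^ n) / (real (lpos n x) / real m ^ n)
      = real (fpos n y) / real (lpos n x)" for n
    using m by simp
  ultimately have "(\<lambda>n. real (fpos n y) / real (lpos n x)) \<longlonglongrightarrow> (real y + q2) / (real x + q1)"
    by (simp only:)
  moreover have "(real y + q2) / (real x + q1) \<in> \<rat>" using q1(1) q2(1) by auto
  ultimately show ?thesis by blast
qed

lemma gap_ratio_sections: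
  assumes g: "gap good x y"
  shows "\<exists>p>0. \<exists>v. \<forall>t<p. algebraic (v t) \<and> ((\<exists>m. \<forall>c\<in>S. length (h c) = m) \<longrightarrow> v t \<in> \<rat>) \<and>
    (\<lambda>m. real (fpos (p * m + t + 2) y) / real (lpos (p * m + t + 2) x)) \<longlonglongrightarrow> v t"
proof (cases "\<exists>m. \<forall>c\<in>S. length (h c) = m")
  case True
  then obtain m where "\<And>c. c \<in> S \<Longrightarrow> length (h c) = m" by blast
  from gap_ratio_rational[OF g this] obtain q where
    q: "q \<in> \<rat>" "(\<lambda>n. real (fpos n y) / real (lpos n x)) \<longlonglongrightarrow> q" by blast
  show ?thesis
  proof (rule exI[of _ 1], intro conjI exI[of _ "\<lambda>_. q"] allI impI)
    fix t :: nat assume "t < 1"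
    then show "(\<lambda>m. real (fpos (1 * m + t + 2) y) / real (lpos (1 * m + t + 2) x)) \<longlonglongrightarrow> q"
      using LIMSEQ_ignore_initial_segment[OF q(2), of 2] by simp
  qed (use q rat_imp_algebraic in auto)
next
  case False
  with gap_ratio_sections_algebraic[OF g] show ?thesis by (simp only: simp_thms)
qed

section \<open>Assembly of the limsup\<close>

lemma limsup_block_ratio_marked:
  fixes w :: "nat \<Rightarrow> 'a"
  assumes wD: "\<And>z. w z \<in> D \<longleftrightarrow> u z \<in> C" and starts: "infinite (block_starts w D)"
  shows "\<exists>r. algebraic r \<and> ((\<exists>m. \<forall>c\<in>S. length (h c) = m) \<longrightarrow> r \<in> \<rat>) \<and>
    limsup (\<lambda>k. ereal (real (blk_end w D k) / real (blk_start w D k))) = ereal r"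
proof -
  have bp: "boundary_pair w D x y \<longleftrightarrow> mark_gap x y" for x y
    by (simp add: boundary_pair_def gap_def wD)
  define ok where "ok = (\<lambda>s p v. p > 0 \<and> (\<forall>t<p. algebraic (v t) \<and>
    ((\<exists>m. \<forall>c\<in>S. length (h c) = m) \<longrightarrow> v t \<in> \<rat>) \<and>
    (\<lambda>m. real (fpos (p * m + t + 2) (snd s)) / real (lpos (p * m + t + 2) (fst s))) \<longlonglongrightarrow> (v t :: real)))"
  have "\<forall>s\<in>seeds. \<exists>p v. ok s p v"
  proof
    fix s assume "s \<in> seeds"
    then have "gap good (fst s) (snd s)" by (auto simp: seeds_def)
    from gap_ratio_sections[OF this] show "\<exists>p v. ok s p v" unfolding ok_def by blast
  qed
  then obtain p v where pv: "\<And>s. s \<in> seeds \<Longrightarrow> ok s (p s) (v s)" by metis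
  have p: "p s > 0" if "s \<in> seeds" for s using pv[OF that] by (simp add: ok_def)
  \<comment> \<open>A family is a seed together with a residue class modulo the period of that seed;
    along it the ratio has a single limit.\<close>
  define E where "E = Sigma seeds (\<lambda>s. {..<p s})"
  define idx where "idx = (\<lambda>e m. p (fst e) * m + snd e + 2 :: nat)"
  define X where "X = (\<lambda>e m. lpos (idx e m) (fst (fst e)))"
  define Y where "Y = (\<lambda>e m. fpos (idx e m) (snd (fst e)))"
  define V where "V = (\<lambda>e. v (fst e) (snd e))"
  have E: "fst e \<in> seeds" "snd e < p (fst e)" "gap good (fst (fst e)) (snd (fst e))" if "e \<in> E" for e
    using that by (auto simp: E_def seeds_def)
  have V: "algebraic (V e)" "(\<exists>m. \<forall>c\<in>S. length (h c) = m) \<longrightarrow> V e \<in> \<rat>"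
      "(\<lambda>m. real (Y e m) / real (X e m)) \<longlonglongrightarrow> V e" if "e \<in> E" for e
    using pv[OF E(1)[OF that]] E(2)[OF that] unfolding ok_def V_def X_def Y_def idx_def by blast+
  have X_gt: "m < X e m" if e: "e \<in> E" for e m
  proof -
    have "m \<le> p (fst e) * m" using p[OF E(1)[OF e]] by simp
    then have "m \<le> p (fst e) * m + snd e + 1" by linarith
    also have "\<dots> < len (p (fst e) * m + snd e + 1)" by (rule len_gt)
    also have "\<dots> \<le> X e m"
      unfolding X_def idx_def using len_le_lpos[of "p (fst e) * m + snd e + 1" "fst (fst e)"] E(3)[OF e]
      by (simp add: gap_def)
    finally show ?thesis .
  qed
  \<comment> \<open>Since \<open>idx\<close> starts at level 2, the gaps produced at level 1 are put
    into the bound for short gaps, next to those inside the image of one letter.\<close>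
  define K where "K = bnd + (\<Sum>s\<in>seeds. fpos 1 (snd s) - lpos 1 (fst s))"
  have "limsup (\<lambda>k. ereal (real (blk_end w D k) / real (blk_start w D k))) = ereal (Max (insert 1 (V ` E)))"
  proof (rule limsup_block_ratio[where X = X and Y = Y and K = K])
    show "infinite {n. w n \<notin> D}" using infinite_marks by (simp add: wD)
    show "infinite (block_starts w D)" by (rule starts)
    show "finite E" unfolding E_def using finite_seeds by auto
    fix e assume e: "e \<in> E"
    show "boundary_pair w D (X e m) (Y e m)" for m
      unfolding bp X_def Y_def by (rule mark_gap_image) (auto simp: idx_def E(3)[OF e])
    show "0 < X e m" for m using X_gt[OF e, of m] by simp
    show "filterlim (X e) at_top sequentially"
      by (rule filterlim_at_top_mono[OF filterlim_ident])
         (use X_gt[OF e] in \<open>auto intro!: always_eventually less_imp_le\<close>)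
    show "(\<lambda>m. real (Y e m) / real (X e m)) \<longlonglongrightarrow> V e" by (rule V(3)[OF e])
  next
    fix x y assume "boundary_pair w D x y"
    then have "mark_gap x y" by (simp only: bp)
    from mark_gap_cover[OF this bnd(2)]
    consider "y - x \<le> bnd" | n s where "n > 0" "s \<in> seeds" "y - x = fpos n (snd s) - lpos n (fst s)"
      "lpos n (fst s) \<le> x" by fastforce
    then show "y - x \<le> K \<or> (\<exists>e\<in>E. \<exists>m. y - x = Y e m - X e m \<and> X e m \<le> x)"
    proof cases
      case 1
      then show ?thesis by (simp add: K_def)
    next
      case (2 n s)
      show ?thesis
      proof (cases "n = 1")
        case True
        have "y - x \<le> (\<Sum>s\<in>seeds. fpos 1 (snd s) - lpos 1 (fst s))"
          unfolding 2(3) True by (rule member_le_sum) (use 2 finite_seeds in auto)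
        then show ?thesis by (simp add: K_def)
      next
        case False
        define e where "e = (s, (n - 2) mod p s)"
        have "e \<in> E" using 2 p by (simp add: E_def e_def)
        moreover have "idx e ((n - 2) div p s) = n"
          using False 2(1) by (simp add: idx_def e_def)
        then have "y - x = Y e ((n - 2) div p s) - X e ((n - 2) div p s)" "X e ((n - 2) div p s) \<le> x"
          unfolding X_def Y_def using 2 by (simp_all add: e_def)
        ultimately show ?thesis by blast
      qed
    qed
  qed
  moreover have "Max (insert 1 (V ` E)) \<in> insert 1 (V ` E)"
    by (rule Max_in) (use finite_seeds in \<open>auto simp: E_def\<close>)
  ultimately show ?thesis using V(1,2) by (intro exI[of _ "Max (insert 1 (V ` E))"]) auto
qed

end

text \<open>Passing to the power \<open>p\<close> changes neither the fixed point nor uniformity: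
  the image length becomes \<open>m ^ p\<close>, so the rational case survives the
  reduction.\<close>

lemma limsup_block_ratio_morphic:
  fixes w :: "nat \<Rightarrow> 'a"
  assumes prol: "prolongable S h a" and fixp: "is_fixpoint_word h a u" and w: "\<And>n. w n = \<tau> (u n)"
    and inf: "infinite {n. w n \<notin> D}" and unb: "\<And>L. \<exists>p. \<forall>t<L. w (p + t) \<in> D"
  shows "\<exists>r. algebraic r \<and> ((\<exists>m. \<forall>c\<in>S. length (h c) = m) \<longrightarrow> r \<in> \<rat>) \<and>
    limsup (\<lambda>k. ereal (real (blk_end w D k) / real (blk_start w D k))) = ereal r"
proof -
  define C where "C = {c. \<tau> c \<in> D}"
  have S': "finite S" "\<And>c. c \<in> S \<Longrightarrow> set (h c) \<subseteq> S" using prol by (auto simp: prolongable_def)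
  have "\<exists>p>0. \<forall>n>0. \<forall>c\<in>S. set ((morph_ext (power_morph h p) ^^ n) [c]) \<subseteq> C
      \<longleftrightarrow> set (power_morph h p c) \<subseteq> C"
    by (rule ex_power_idempotent[OF S'(1)]) (rule S'(2))
  then obtain p where p: "p > 0" and idem: "\<forall>n>0. \<forall>c\<in>S. set ((morph_ext (power_morph h p) ^^ n) [c]) \<subseteq> C
      \<longleftrightarrow> set (power_morph h p c) \<subseteq> C" by (elim exE conjE)
  interpret marked_fixpoint S "power_morph h p" a u C
  proof
    show "prolongable S (power_morph h p) a" by (rule prolongable_power_morph[OF prol p])
    show "is_fixpoint_word (power_morph h p) a u" by (rule is_fixpoint_word_power_morph[OF fixp])
    show "infinite {z. u z \<notin> C}" using inf by (simp add: C_def w)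
  qed (use idem in simp)
  have wD: "w z \<in> D \<longleftrightarrow> u z \<in> C" for z by (simp add: C_def w)
  from limsup_block_ratio_marked[OF wD infinite_block_starts[OF inf unb]] obtain r where r: "algebraic r"
    "(\<exists>m. \<forall>c\<in>S. length (power_morph h p c) = m) \<longrightarrow> r \<in> \<rat>"
    "limsup (\<lambda>k. ereal (real (blk_end w D k) / real (blk_start w D k))) = ereal r"
    by (elim exE conjE)
  have "r \<in> \<rat>" if "\<forall>c\<in>S. length (h c) = m" for m
  proof -
    have "length (power_morph h p c) = m ^ p" if "c \<in> S" for c
      using length_iter_uniform[of S h m "[c]" p] S'(2) \<open>\<forall>c\<in>S. length (h c) = m\<close> that
      by (simp add: power_morph_def)
    then show ?thesis using r(2) by blast
  qed
  with r(1,3) show ?thesis by (intro exI[of _ r]) auto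
qed

theorem theorem20:
  fixes w :: "nat \<Rightarrow> 'a" and Sigma D :: "'a set"
  assumes "finite Sigma" and "\<And>n. w n \<in> Sigma"
    and "morphic w"
    and "D \<subset> Sigma" and "D \<noteq> {}"
    and "infinite {n. w n \<notin> D}"
    and "\<And>L. \<exists>p. \<forall>t<L. w (p + t) \<in> D"
  shows "(\<exists>x::real. algebraic x \<and>
            limsup (\<lambda>k. ereal (real (blk_end w D k) / real (blk_start w D k))) = ereal x)
       \<and> (automatic w \<longrightarrow> (\<exists>x::real. x \<in> \<rat> \<and>
            limsup (\<lambda>k. ereal (real (blk_end w D k) / real (blk_start w D k))) = ereal x))"
proof (intro conjI impI)
  obtain S h a u \<tau> where "prolongable S h a" "is_fixpoint_word h a u" "\<And>n. w n = \<tau> (u n)"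
    using assms(3) unfolding morphic_def by blast
  from limsup_block_ratio_morphic[OF this assms(6,7)]
  show "\<exists>x::real. algebraic x \<and>
      limsup (\<lambda>k. ereal (real (blk_end w D k) / real (blk_start w D k))) = ereal x" by blast
next
  assume "automatic w"
  then obtain S h a u \<tau> m where *: "prolongable S h a" "is_fixpoint_word h a u" "\<And>n. w n = \<tau> (u n)"
    and "\<forall>c\<in>S. length (h c) = m"
    unfolding automatic_def by blast
  with limsup_block_ratio_morphic[OF * assms(6,7)]
  show "\<exists>x::real. x \<in> \<rat> \<and>
      limsup (\<lambda>k. ereal (real (blk_end w D k) / real (blk_start w D k))) = ereal x" by blast
qed

end
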